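(* Let $W$ be a Coxeter group with reflection arrangement $\mathcal A$, let $\tilde{\mathcal A}=\operatorname{Spec}\tilde S_{\mathcal A}$ and let $\bar{\mathcal A}$ be the normalization of $\mathcal A$. (1) $\mathcal A=\tilde{\mathcal A}$ (i.e. $S_{\mathcal A}=\tilde S_{\mathcal A}$) if and only if $\mathcal A$ contains only one hyperplane (equivalently, $W$ has type $A_1$). (2) $\tilde{\mathcal A}=\bar{\mathcal A}$ (i.e. $\tilde S_{\mathcal A}$ is the integral closure of $S_{\mathcal A}$ in its total ring of fractions) if and only if $\mathcal A$ is Boolean (equivalently, $W$ has type $A_1\times\cdots\times A_1$).
   Context: A Coxeter group is a finite group $W\subset\mathrm{GL}(V)$ generated by reflections defined over $\mathbb{R}$, where $V=V_{\mathbb R}\otimes_{\mathbb R}\mathbb{C}$, $\dim V=\ell\ge1$, with $V^W=0$. $S=\mathbb{C}[V]=\mathbb{C}[x_1,\dots,x_\ell]$, and $S^W=\mathbb{C}[p_1,\dots,p_\ell]$ with $p_i$ homogeneous basic invariants (for reducible $W$: the union of homogeneous basic invariants of the irreducible summands). $J=(\partial_{x_j}(p_i))$, and $\Delta=\det J$ is a reduced equation of $\mathcal A$ (the set, and also the union, of the reflecting hyperplanes). $S_{\mathcal A}=S/S\Delta$ has total ring of fractions $Q_{\mathcal A}$. $\tilde I_{\mathcal A}\subset S_{\mathcal A}$ is the ideal generated by all $(\ell-1)\times(\ell-1)$ minors of $J$ (equal to $S_{\mathcal A}$ if $\ell=1$), and $\tilde S_{\mathcal A}=\operatorname{End}_{S_{\mathcal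 A}}(\tilde I_{\mathcal A})=\{q\in Q_{\mathcal A}\mid q\tilde I_{\mathcal A}\subseteq\tilde I_{\mathcal A}\}$; as an $S$-module it is isomorphic to $\operatorname{coker}J$. Boolean means that, in suitable linear coordinates, $\mathcal A$ is the arrangement of coordinate hyperplanes $x_1\cdots x_\ell=0$. *)

theory Defs
  imports
    "Jordan_Normal_Form.Determinant"
    "HOL-Library.Poly_Mapping"
    "HOL-Algebra.QuotRing"
    "HOL-Algebra.Generated_Groups"
begin

section \<open>Polynomials over the complex numbers\<close>

text \<open>A polynomial is a finitely supported map from monomials to coefficients; a monomial is a
  finitely supported map from variable indices to exponents.  The ring
  \<open>S = \<complex>[x\<^sub>1, \<dots>, x\<^sub>n]\<close> consists of those using only the variables with index below \<open>n\<close>.\<close>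

type_synonym mpoly = "(nat \<Rightarrow>\<^sub>0 nat) \<Rightarrow>\<^sub>0 complex"

definition mconst :: "complex \<Rightarrow> mpoly" where
  "mconst c = Poly_Mapping.single 0 c"

definition mvar :: "nat \<Rightarrow> mpoly" where
  "mvar i = Poly_Mapping.single (Poly_Mapping.single i 1) 1"

definition mpolys :: "nat \<Rightarrow> mpoly set" where
  "mpolys n = {f. \<forall>m \<in> Poly_Mapping.keys f. Poly_Mapping.keys m \<subseteq> {..<n}}"

definition S_ring :: "nat \<Rightarrow> mpoly ring" where
  "S_ring n = \<lparr>carrier = mpolys n, mult = (*), one = 1, zero = 0, add = (+)\<rparr>"

text \<open>The substitution \<open>x\<^sub>i \<mapsto> \<sigma> i\<close>.\<close>

definition msubst :: "(nat \<Rightarrow> mpoly) \<Rightarrow> mpoly \<Rightarrow> mpoly" where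
  "msubst \<sigma> f = (\<Sum>m \<in> Poly_Mapping.keys f. mconst (Poly_Mapping.lookup f m) *
     (\<Prod>i \<in> Poly_Mapping.keys m. \<sigma> i ^ Poly_Mapping.lookup m i))"

text \<open>The partial derivative with respect to \<open>x\<^sub>j\<close>.  Where the truncated difference
  \<open>m - Poly_Mapping.single j 1\<close> is not the intended monomial, its coefficient is 0.\<close>

definition mderiv :: "nat \<Rightarrow> mpoly \<Rightarrow> mpoly" where
  "mderiv j f = (\<Sum>m \<in> Poly_Mapping.keys f.
     Poly_Mapping.single (m - Poly_Mapping.single j 1)
       (of_nat (Poly_Mapping.lookup m j) * Poly_Mapping.lookup f m))"

definition mhomogeneous :: "mpoly \<Rightarrow> bool" where
  "mhomogeneous f \<longleftrightarrow> (\<exists>d. \<forall>m \<in> Poly_Mapping.keys f.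
     (\<Sum>i \<in> Poly_Mapping.keys m. Poly_Mapping.lookup m i) = d)"

section \<open>Coxeter groups and their reflection arrangements\<close>

text \<open>A basis of \<open>V\<^sub>\<real>\<close> is fixed, so that \<open>V\<^sub>\<real> = \<real>\<^sup>n\<close> and \<open>V = \<complex>\<^sup>n\<close>; elements of \<open>GL(V)\<close> defined
  over \<open>\<real>\<close> are the invertible complex matrices with real entries.\<close>

definition GL :: "nat \<Rightarrow> complex mat monoid" where
  "GL n = units_of (ring_mat TYPE(complex) n ())"

definition fixed_space :: "nat \<Rightarrow> complex mat \<Rightarrow> complex vec set" where
  "fixed_space n s = {v \<in> carrier_vec n. s *\<^sub>v v = v}"

definition hyperplane :: "nat \<Rightarrow> complex vec \<Rightarrow> complex vec set" where
  "hyperplane n a = {v \<in> carrier_vec n. a \<bullet> v = 0}"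

text \<open>Reflections defined over \<open>\<real>\<close>.  A real linear map of finite order fixing a hyperplane
  pointwise, and different from the identity, has order two.\<close>

definition is_reflection :: "nat \<Rightarrow> complex mat \<Rightarrow> bool" where
  "is_reflection n s \<longleftrightarrow> s \<in> carrier_mat n n \<and> (\<forall>i<n. \<forall>j<n. s $$ (i, j) \<in> \<real>) \<and>
     s * s = 1\<^sub>m n \<and>
     (\<exists>a \<in> carrier_vec n. a \<noteq> 0\<^sub>v n \<and> fixed_space n s = hyperplane n a)"

definition reflections :: "nat \<Rightarrow> complex mat set \<Rightarrow> complex mat set" where
  "reflections n W = {s \<in> W. is_reflection n s}"

definition coxeter_group :: "nat \<Rightarrow> complex mat set \<Rightarrow> bool" where
  "coxeter_group n W \<longleftrightarrow> finite W \<and> subgroup W (GL n) \<and>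
     generate (GL n) (reflections n W) = W \<and>
     {v \<in> carrier_vec n. \<forall>w \<in> W. w *\<^sub>v v = v} = {0\<^sub>v n}"

definition arrangement :: "nat \<Rightarrow> complex mat set \<Rightarrow> complex vec set set" where
  "arrangement n W = fixed_space n ` reflections n W"

text \<open>In the linear coordinates \<open>y\<^sub>i = row P i \<bullet> x\<close> the hyperplanes are those given by
  \<open>y\<^sub>i = 0\<close>.\<close>

definition boolean_arrangement :: "nat \<Rightarrow> complex vec set set \<Rightarrow> bool" where
  "boolean_arrangement n \<A> \<longleftrightarrow> (\<exists>P \<in> carrier_mat n n. invertible_mat P \<and>
     \<A> = (\<lambda>i. hyperplane n (row P i)) ` {..<n})"

text \<open>Type \<open>A\<^sub>1 \<times> \<cdots> \<times> A\<^sub>1\<close> (\<open>k\<close> factors): the Coxeter graph has \<open>k\<close> vertices and no edges, that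
  is, \<open>W\<close> is generated by \<open>k\<close> pairwise commuting reflections subject to no further relations.
  The cardinality condition expresses the absence of further relations.\<close>

definition type_A1_power :: "nat \<Rightarrow> nat \<Rightarrow> complex mat set \<Rightarrow> bool" where
  "type_A1_power k n W \<longleftrightarrow> (\<exists>R \<subseteq> reflections n W. finite R \<and> card R = k \<and>
     generate (GL n) R = W \<and> (\<forall>r \<in> R. \<forall>s \<in> R. r * s = s * r) \<and> card W = 2 ^ k)"

section \<open>Basic invariants\<close>

text \<open>\<open>f \<circ> w\<close> as a polynomial function on \<open>V\<close>: the substitution
  \<open>x\<^sub>i \<mapsto> \<Sum>\<^sub>j w\<^sub>i\<^sub>j x\<^sub>j\<close>.\<close>

definition mlin_comp :: "nat \<Rightarrow> mpoly \<Rightarrow> complex mat \<Rightarrow> mpoly" where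
  "mlin_comp n f w = msubst (\<lambda>i. \<Sum>j<n. mconst (w $$ (i, j)) * mvar j) f"

definition invariants :: "nat \<Rightarrow> complex mat set \<Rightarrow> mpoly set" where
  "invariants n W = {f \<in> mpolys n. \<forall>w \<in> W. mlin_comp n f w = f}"

text \<open>\<open>S\<^sup>W = \<complex>[p\<^sub>1, \<dots>, p\<^sub>n]\<close>: surjectivity says that the \<open>p\<^sub>i\<close> generate, injectivity that they are
  algebraically independent.\<close>

definition basic_invariants :: "nat \<Rightarrow> complex mat set \<Rightarrow> (nat \<Rightarrow> mpoly) \<Rightarrow> bool" where
  "basic_invariants n W p \<longleftrightarrow> (\<forall>i<n. mhomogeneous (p i)) \<and>
     bij_betw (msubst p) (mpolys n) (invariants n W)"

definition jacobian :: "nat \<Rightarrow> (nat \<Rightarrow> mpoly) \<Rightarrow> mpoly mat" where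
  "jacobian n p = mat n n (\<lambda>(i, j). mderiv j (p i))"

section \<open>The total ring of fractions\<close>

definition nonzerodivisors :: "('a, 'b) ring_scheme \<Rightarrow> 'a set" where
  "nonzerodivisors R =
     {b \<in> carrier R. \<forall>a \<in> carrier R. a \<otimes>\<^bsub>R\<^esub> b = \<zero>\<^bsub>R\<^esub> \<longrightarrow> a = \<zero>\<^bsub>R\<^esub>}"

text \<open>The fraction \<open>a / b\<close>, as the set of all pairs \<open>(c, d)\<close> with \<open>c / d = a / b\<close>.\<close>

definition frac_of :: "('a, 'b) ring_scheme \<Rightarrow> 'a \<Rightarrow> 'a \<Rightarrow> ('a \<times> 'a) set" where
  "frac_of R a b =
     {(c, d). c \<in> carrier R \<and> d \<in> nonzerodivisors R \<and> a \<otimes>\<^bsub>R\<^esub> d = c \<otimes>\<^bsub>R\<^esub> b}"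

text \<open>The unions below are unions of equal sets: the results do not depend on the chosen
  representatives.\<close>

definition total_fractions :: "('a, 'b) ring_scheme \<Rightarrow> ('a \<times> 'a) set ring" where
  "total_fractions R =
     \<lparr>carrier = {frac_of R a b | a b. a \<in> carrier R \<and> b \<in> nonzerodivisors R},
      mult = (\<lambda>X Y. \<Union>(a, b)\<in>X. \<Union>(c, d)\<in>Y. frac_of R (a \<otimes>\<^bsub>R\<^esub> c) (b \<otimes>\<^bsub>R\<^esub> d)),
      one = frac_of R \<one>\<^bsub>R\<^esub> \<one>\<^bsub>R\<^esub>,
      zero = frac_of R \<zero>\<^bsub>R\<^esub> \<one>\<^bsub>R\<^esub>,
      add = (\<lambda>X Y. \<Union>(a, b)\<in>X. \<Union>(c, d)\<in>Y.
        frac_of R (a \<otimes>\<^bsub>R\<^esub> d \<oplus>\<^bsub>R\<^esub> c \<otimes>\<^bsub>R\<^esub> b) (b \<otimes>\<^bsub>R\<^esub> d))\<rparr>"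

definition frac_embed :: "('a, 'b) ring_scheme \<Rightarrow> 'a \<Rightarrow> ('a \<times> 'a) set" where
  "frac_embed R a = frac_of R a \<one>\<^bsub>R\<^esub>"

text \<open>The integral closure in \<open>Q\<close> of a subring with underlying set \<open>K\<close>.\<close>

definition integral_closure :: "('a, 'b) ring_scheme \<Rightarrow> 'a set \<Rightarrow> 'a set" where
  "integral_closure Q K = {q \<in> carrier Q. \<exists>(d::nat) c. (\<forall>i<d. c i \<in> K) \<and>
     q [^]\<^bsub>Q\<^esub> d \<oplus>\<^bsub>Q\<^esub> (\<Oplus>\<^bsub>Q\<^esub>i\<in>{..<d}. c i \<otimes>\<^bsub>Q\<^esub> q [^]\<^bsub>Q\<^esub> i) = \<zero>\<^bsub>Q\<^esub>}"

section \<open>The rings \<open>S\<^sub>\<A>\<close>, \<open>Q\<^sub>\<A>\<close> and \<open>S\<^sub>\<A>\<close> with a tilde\<close>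

definition S_A :: "nat \<Rightarrow> (nat \<Rightarrow> mpoly) \<Rightarrow> mpoly set ring" where
  "S_A n p = S_ring n Quot (PIdl\<^bsub>S_ring n\<^esub> det (jacobian n p))"

definition Q_A :: "nat \<Rightarrow> (nat \<Rightarrow> mpoly) \<Rightarrow> (mpoly set \<times> mpoly set) set ring" where
  "Q_A n p = total_fractions (S_A n p)"

definition residue_class :: "nat \<Rightarrow> (nat \<Rightarrow> mpoly) \<Rightarrow> mpoly \<Rightarrow> mpoly set" where
  "residue_class n p f = (PIdl\<^bsub>S_ring n\<^esub> det (jacobian n p)) +>\<^bsub>S_ring n\<^esub> f"

text \<open>The ideal of submaximal minors.  For \<open>n = 1\<close> the only minor is the determinant of the
  \<open>0 \<times> 0\<close> matrix, which is 1, so that the ideal is all of \<open>S\<^sub>\<A>\<close>.\<close>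

definition I_tilde :: "nat \<Rightarrow> (nat \<Rightarrow> mpoly) \<Rightarrow> mpoly set set" where
  "I_tilde n p = Idl\<^bsub>S_A n p\<^esub>
     {residue_class n p (det (mat_delete (jacobian n p) i j)) | i j. i < n \<and> j < n}"

text \<open>\<open>S\<^sub>\<A>\<close> and its ideal of minors are viewed inside \<open>Q\<^sub>\<A>\<close> through \<open>a \<mapsto> a / 1\<close>.\<close>

definition S_A_in_Q :: "nat \<Rightarrow> (nat \<Rightarrow> mpoly) \<Rightarrow> (mpoly set \<times> mpoly set) set set" where
  "S_A_in_Q n p = frac_embed (S_A n p) ` carrier (S_A n p)"

definition S_tilde :: "nat \<Rightarrow> (nat \<Rightarrow> mpoly) \<Rightarrow> (mpoly set \<times> mpoly set) set set" where
  "S_tilde n p = {q \<in> carrier (Q_A n p). \<forall>x \<in> frac_embed (S_A n p) ` I_tilde n p.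
     q \<otimes>\<^bsub>Q_A n p\<^esub> x \<in> frac_embed (S_A n p) ` I_tilde n p}"

definition S_bar :: "nat \<Rightarrow> (nat \<Rightarrow> mpoly) \<Rightarrow> (mpoly set \<times> mpoly set) set set" where
  "S_bar n p = integral_closure (Q_A n p) (S_A_in_Q n p)"

end

theory Submission
  imports Defs "HOL-Computational_Algebra.Field_as_Ring"
begin

text \<open>Write \<open>\<Delta>\<close> for the Jacobian determinant and \<open>I\<close> for the ideal of submaximal minors.
  Averaging suitable polynomials over \<open>W\<close> produces invariants with prescribed jets at a point, so
  the kernel and the first order behaviour of the Jacobian matrix are known at a generic point of any
  intersection \<open>X\<close> of two hyperplanes \<open>\<alpha> = 0\<close>, \<open>\<beta> = 0\<close>.  It follows that \<open>I\<close> is contained in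
  \<open>(\<alpha>, \<beta>)\<close> and that \<open>f \<alpha>, f \<beta> \<in> I\<close> for some \<open>f\<close> not vanishing on \<open>X\<close>.

  If there are two hyperplanes, then \<open>\<Delta> = \<alpha> \<beta> E\<close>, and for a generic \<open>b = \<alpha> + c \<beta>\<close> the fraction
  \<open>f E \<alpha> / b\<close> maps \<open>I\<close> into itself without being a polynomial; so equality in (1) forces a single
  hyperplane.  If three hyperplanes meet in codimension two, the idempotent of the total ring of
  fractions supported on one of them is integral but does not map \<open>I\<close> into itself; so equality in (2)
  forces all reflections to commute, that is, the arrangement is Boolean.  In the Boolean case, with
  linear forms \<open>y\<^sub>i\<close>, the invariants \<open>y\<^sub>i\<^sup>2\<close> show that up to units \<open>\<Delta> = \<Prod> y\<^sub>i\<close> and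
  \<open>I = (\<Delta> / y\<^sub>1, \<dots>, \<Delta> / y\<^sub>n)\<close>; both rings then consist of the fractions whose restriction to
  each hyperplane is a polynomial, because polynomial rings are integrally closed.\<close>

section \<open>Substitution homomorphisms\<close>

text \<open>Everything known about the matrix \<open>J\<close> comes through the chain rule: an
  invariant is F = f(p), so dF is a combination of the rows of \<open>J\<close>. First-order jets
  bound the kernel of \<open>J\<close> at a point. To see that the minors vanish only to first order
  along X, second-order jets are needed: if the 2-jet of F is a multiple of the invariant quadratic
  form, the partial derivatives of f give a covector in the left kernel of \<open>J\<close> that
  pairs the derivative of \<open>J\<close> nondegenerately with the kernel. An obstacle throughout
  is that the invariant form is complex bilinear and has isotropic vectors; W being real, pairing
  with conjugates restores definiteness.

  The fraction f E \<alpha> / b is 0 modulo \<alpha> E and equals f E modulo \<beta>, where b is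
  \<alpha>. Were it a polynomial, f would lie in (\<alpha>, \<beta>) and vanish on X. In (2), the
  idempotent of \<alpha> maps f \<beta> to a multiple of \<beta> \<gamma> that is congruent to f
  \<beta> modulo \<alpha>, with \<gamma> the third form. If this product came from \<open>I\<close>,
  f would lie in (\<alpha>, \<gamma>) and again vanish on X.\<close>

definition monom_eval :: "(nat \<Rightarrow> 'b::comm_ring_1) \<Rightarrow> (nat \<Rightarrow>\<^sub>0 nat) \<Rightarrow> 'b" where
  "monom_eval \<sigma> m = (\<Prod>i \<in> Poly_Mapping.keys m. \<sigma> i ^ Poly_Mapping.lookup m i)"

text \<open>The coefficient map \<kappa> is a parameter so that one construction serves substitution
  (\<open>mconst\<close>), evaluation at a point (the identity), restriction to a line (constant
  polynomials in t) and expansion along a direction (\<open>shift\<close>).\<close>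

definition insertion :: "(complex \<Rightarrow> 'b::comm_ring_1) \<Rightarrow> (nat \<Rightarrow> 'b) \<Rightarrow> mpoly \<Rightarrow> 'b" where
  "insertion \<kappa> \<sigma> f = (\<Sum>m \<in> Poly_Mapping.keys f. \<kappa> (Poly_Mapping.lookup f m) * monom_eval \<sigma> m)"

lemma monom_eval_superset:
  assumes "finite A" "Poly_Mapping.keys m \<subseteq> A"
  shows "monom_eval \<sigma> m = (\<Prod>i \<in> A. \<sigma> i ^ Poly_Mapping.lookup m i)"
  unfolding monom_eval_def
  by (rule prod.mono_neutral_left) (use assms in \<open>auto simp: in_keys_iff\<close>)

lemma monom_eval_zero [simp]: "monom_eval \<sigma> 0 = 1"
  by (simp add: monom_eval_def)

lemma monom_eval_add: "monom_eval \<sigma> (m + m') = monom_eval \<sigma> m * monom_eval \<sigma> m'"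
proof -
  let ?A = "Poly_Mapping.keys m \<union> Poly_Mapping.keys m'"
  have "monom_eval \<sigma> (m + m') = (\<Prod>i\<in>?A. \<sigma> i ^ Poly_Mapping.lookup (m + m') i)"
    by (rule monom_eval_superset) (auto simp: keys_add)
  also have "\<dots> = (\<Prod>i\<in>?A. \<sigma> i ^ Poly_Mapping.lookup m i) * (\<Prod>i\<in>?A. \<sigma> i ^ Poly_Mapping.lookup m' i)"
    by (simp add: lookup_add power_add prod.distrib)
  also have "\<dots> = monom_eval \<sigma> m * monom_eval \<sigma> m'"
    using monom_eval_superset[of ?A m \<sigma>] monom_eval_superset[of ?A m' \<sigma>] by simp
  finally show ?thesis .
qed

lemma single_induct [case_names zero single_add]:
  assumes "P 0" "\<And>m c f. P f \<Longrightarrow> P (Poly_Mapping.single m c + f)"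
  shows "P (f :: 'a \<Rightarrow>\<^sub>0 'b::comm_monoid_add)"
proof (induction f rule: update_induct)
  case const
  then show ?case using assms(1) .
next
  case (update f a b)
  have "Poly_Mapping.update a b f = Poly_Mapping.single a b + f"
    using update.hyps
    by (intro poly_mapping_eqI) (auto simp: lookup_update lookup_add lookup_single in_keys_iff)
  then show ?case using assms(2) update.IH by simp
qed

lemma msubst_eq_insertion: "msubst \<sigma> = insertion mconst \<sigma>"
  by (auto simp: msubst_def insertion_def monom_eval_def)

lemma mconst_hom: "comm_ring_hom mconst"
  by unfold_locales (auto simp: mconst_def single_add mult_single)

lemma id_hom: "comm_ring_hom (\<lambda>c::complex. c)"
  by unfold_locales auto

context
  fixes \<kappa> :: "complex \<Rightarrow> 'b::comm_ring_1"
  assumes \<kappa>: "comm_ring_hom \<kappa>"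
begin

interpretation \<kappa>: comm_ring_hom \<kappa> by (rule \<kappa>)

lemma insertion_superset:
  assumes "finite A" "Poly_Mapping.keys f \<subseteq> A"
  shows "insertion \<kappa> \<sigma> f = (\<Sum>m \<in> A. \<kappa> (Poly_Mapping.lookup f m) * monom_eval \<sigma> m)"
  unfolding insertion_def
  by (rule sum.mono_neutral_left) (use assms in \<open>auto simp: in_keys_iff\<close>)

lemma insertion_single [simp]:
  "insertion \<kappa> \<sigma> (Poly_Mapping.single m c) = \<kappa> c * monom_eval \<sigma> m"
  by (subst insertion_superset[of "{m}"]) auto

lemma insertion_zero [simp]: "insertion \<kappa> \<sigma> 0 = 0"
  by (simp add: insertion_def)

lemma insertion_add [simp]: "insertion \<kappa> \<sigma> (f + g) = insertion \<kappa> \<sigma> f + insertion \<kappa> \<sigma> g"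
proof -
  let ?A = "Poly_Mapping.keys f \<union> Poly_Mapping.keys g"
  have "insertion \<kappa> \<sigma> (f + g) = (\<Sum>m \<in> ?A. \<kappa> (Poly_Mapping.lookup (f + g) m) * monom_eval \<sigma> m)"
    by (rule insertion_superset) (auto simp: keys_add)
  also have "\<dots> = insertion \<kappa> \<sigma> f + insertion \<kappa> \<sigma> g"
    using insertion_superset[of ?A f \<sigma>] insertion_superset[of ?A g \<sigma>]
    by (simp add: lookup_add \<kappa>.hom_add algebra_simps sum.distrib)
  finally show ?thesis .
qed

lemma insertion_mult [simp]: "insertion \<kappa> \<sigma> (f * g) = insertion \<kappa> \<sigma> f * insertion \<kappa> \<sigma> g"
proof (induction f rule: single_induct)
  case (single_add m c f)
  have "insertion \<kappa> \<sigma> (Poly_Mapping.single m c * g) = \<kappa> c * monom_eval \<sigma> m * insertion \<kappa> \<sigma> g"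
  proof (induction g rule: single_induct)
    case (single_add m' c' g)
    then show ?case
      by (simp add: distrib_left mult_single \<kappa>.hom_mult monom_eval_add mult_ac)
  qed simp
  then show ?case using single_add by (simp add: distrib_right)
qed simp

lemma insertion_hom: "comm_ring_hom (insertion \<kappa> \<sigma>)"
proof
  show "insertion \<kappa> \<sigma> 1 = 1"
    using insertion_single[of \<sigma> 0 1] by (simp add: \<kappa>.hom_one)
qed auto

lemma insertion_mconst [simp]: "insertion \<kappa> \<sigma> (mconst c) = \<kappa> c"
  by (simp add: mconst_def)

lemma insertion_mvar [simp]: "insertion \<kappa> \<sigma> (mvar i) = \<sigma> i"
  by (simp add: mvar_def \<kappa>.hom_one monom_eval_def)

lemma insertion_cong:
  assumes "f \<in> mpolys n" "\<And>i. i < n \<Longrightarrow> \<sigma> i = \<tau> i"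
  shows "insertion \<kappa> \<sigma> f = insertion \<kappa> \<tau> f"
  unfolding insertion_def monom_eval_def
  by (intro sum.cong refl arg_cong2[of _ _ _ _ "(*)"] prod.cong)
     (use assms in \<open>auto simp: mpolys_def subset_iff\<close>)

end

lemma insertion_comp:
  assumes "comm_ring_hom \<kappa>" "comm_ring_hom h"
  shows "h (insertion \<kappa> \<sigma> f) = insertion (h \<circ> \<kappa>) (h \<circ> \<sigma>) f"
proof -
  interpret h: comm_ring_hom h by fact
  show ?thesis
    by (simp add: insertion_def monom_eval_def h.hom_sum h.hom_mult h.hom_prod h.hom_power)
qed

lemma mvar_power: "mvar i ^ k = Poly_Mapping.single (Poly_Mapping.single i k) 1"
  by (induction k) (auto simp: mvar_def mult_single single_add[symmetric] simp flip: single_one)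

lemma monom_eval_mvar: "monom_eval mvar m = Poly_Mapping.single m 1"
proof (induction m rule: single_induct)
  case (single_add i k m)
  have "monom_eval mvar (Poly_Mapping.single i k) = Poly_Mapping.single (Poly_Mapping.single i k) 1"
    by (cases "k = 0") (auto simp: monom_eval_def mvar_power)
  then show ?case using single_add by (simp add: monom_eval_add mult_single)
qed simp

lemma insertion_mvar_id: "insertion mconst mvar f = f"
proof (induction f rule: single_induct)
  case (single_add m c f)
  then show ?case
    by (simp add: insertion_add[OF mconst_hom] insertion_single[OF mconst_hom] monom_eval_mvar)
      (simp add: mconst_def mult_single)
qed (simp add: mconst_hom)

section \<open>The subring of polynomials in the first \<open>n\<close> variables\<close>

lemma mconst_mpolys [simp]: "mconst c \<in> mpolys n"
  by (auto simp: mconst_def mpolys_def)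

lemma mvar_mpolys [simp]: "i < n \<Longrightarrow> mvar i \<in> mpolys n"
  by (auto simp: mvar_def mpolys_def)

lemma zero_mpolys [simp]: "0 \<in> mpolys n"
  by (auto simp: mpolys_def)

lemma one_mpolys [simp]: "1 \<in> mpolys n"
  by (auto simp: mpolys_def)

lemma add_mpolys [simp]: "f \<in> mpolys n \<Longrightarrow> g \<in> mpolys n \<Longrightarrow> f + g \<in> mpolys n"
  using keys_add[of f g] by (force simp: mpolys_def)

lemma mult_mpolys [simp]: "f \<in> mpolys n \<Longrightarrow> g \<in> mpolys n \<Longrightarrow> f * g \<in> mpolys n"
proof -
  assume "f \<in> mpolys n" "g \<in> mpolys n"
  then show ?thesis
    using keys_mult[of f g] keys_add unfolding mpolys_def by (fastforce simp: subset_iff)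
qed

lemma uminus_mpolys [simp]: "f \<in> mpolys n \<Longrightarrow> - f \<in> mpolys n"
  by (auto simp: mpolys_def in_keys_iff)

lemma diff_mpolys [simp]: "f \<in> mpolys n \<Longrightarrow> g \<in> mpolys n \<Longrightarrow> f - g \<in> mpolys n"
  using add_mpolys[of f n "- g"] by simp

lemma sum_mpolys [simp, intro]: "(\<And>i. i \<in> A \<Longrightarrow> f i \<in> mpolys n) \<Longrightarrow> sum f A \<in> mpolys n"
  by (induction A rule: infinite_finite_induct) auto

lemma prod_mpolys [simp, intro]: "(\<And>i. i \<in> A \<Longrightarrow> f i \<in> mpolys n) \<Longrightarrow> prod f A \<in> mpolys n"
  by (induction A rule: infinite_finite_induct) auto

lemma power_mpolys [simp]: "f \<in> mpolys n \<Longrightarrow> f ^ k \<in> mpolys n"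
  by (induction k) auto

text \<open>S is generated by constants and variables: the monomial expansion
  \<open>insertion_mvar_id\<close> is built from them by sums and products. Claims about
  homomorphisms and derivations are thereby reduced to generators.\<close>

lemma mpolys_induct [consumes 1, case_names const var add mult]:
  assumes "f \<in> mpolys n"
    and const: "\<And>c. P (mconst c)"
    and var: "\<And>i. i < n \<Longrightarrow> P (mvar i)"
    and add: "\<And>f g. f \<in> mpolys n \<Longrightarrow> g \<in> mpolys n \<Longrightarrow> P f \<Longrightarrow> P g \<Longrightarrow> P (f + g)"
    and mult: "\<And>f g. f \<in> mpolys n \<Longrightarrow> g \<in> mpolys n \<Longrightarrow> P f \<Longrightarrow> P g \<Longrightarrow> P (f * g)"
  shows "P f"
proof -
  let ?Q = "\<lambda>f. f \<in> mpolys n \<and> P f"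
  have 0: "?Q 0" and 1: "?Q 1"
    using const[of 0] const[of 1] by (auto simp: mconst_def)
  have prod: "?Q (\<Prod>i\<in>A. g i)" if "\<And>i. i \<in> A \<Longrightarrow> ?Q (g i)" for A :: "nat set" and g
    using that by (induction A rule: infinite_finite_induct) (use 1 mult in auto)
  have pow: "?Q (mvar i ^ k)" if "i < n" for i k
    by (induction k) (use 1 var[OF that] that mult in auto)
  have sum: "?Q (\<Sum>i\<in>A. g i)" if "\<And>i. i \<in> A \<Longrightarrow> ?Q (g i)" for A :: "(nat \<Rightarrow>\<^sub>0 nat) set" and g
    using that by (induction A rule: infinite_finite_induct) (use 0 add in auto)
  have "?Q (insertion mconst mvar f)"
    unfolding insertion_def monom_eval_def
  proof (rule sum)
    fix m assume m: "m \<in> Poly_Mapping.keys f"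
    have "?Q (\<Prod>i\<in>Poly_Mapping.keys m. mvar i ^ Poly_Mapping.lookup m i)"
      by (rule prod, rule pow) (use m assms(1) in \<open>auto simp: mpolys_def\<close>)
    then show "?Q (mconst (Poly_Mapping.lookup f m) *
        (\<Prod>i\<in>Poly_Mapping.keys m. mvar i ^ Poly_Mapping.lookup m i))"
      using const mult by auto
  qed
  then show ?thesis by (simp add: insertion_mvar_id)
qed

lemma insertion_mpolys:
  assumes "f \<in> mpolys n" "\<And>i. i < n \<Longrightarrow> \<sigma> i \<in> mpolys k"
  shows "insertion mconst \<sigma> f \<in> mpolys k"
  using assms(1) by (induction rule: mpolys_induct) (auto simp: mconst_hom assms(2))

text \<open>The type has infinitely many variables, S only the first n. Setting the others to 0 is a
  ring retraction onto S, which carries identities of the ambient ring into S.\<close>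

definition mpolys_retract :: "nat \<Rightarrow> mpoly \<Rightarrow> mpoly" where
  "mpolys_retract n = insertion mconst (\<lambda>i. if i < n then mvar i else 0)"

lemma mpolys_retract_hom: "comm_ring_hom (mpolys_retract n)"
  unfolding mpolys_retract_def by (rule insertion_hom[OF mconst_hom])

lemma mpolys_retract_id: "f \<in> mpolys n \<Longrightarrow> mpolys_retract n f = f"
  unfolding mpolys_retract_def
  by (subst insertion_cong[where \<tau> = mvar and n = n, OF mconst_hom]) (auto simp: insertion_mvar_id)

lemma mpolys_retract_in [simp]: "mpolys_retract n f \<in> mpolys n"
proof -
  have "monom_eval (\<lambda>i. if i < n then mvar i else 0) m \<in> mpolys n" for m
    unfolding monom_eval_def by auto
  then show ?thesis
    unfolding mpolys_retract_def insertion_def by auto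
qed

text \<open>The retraction moves the cofactor into S, so plain \<open>dvd\<close> between elements
  of S expresses divisibility in S.\<close>

lemma dvd_mpolys:
  assumes "f \<in> mpolys n" "g \<in> mpolys n" "f dvd g"
  obtains k where "k \<in> mpolys n" "g = f * k"
proof -
  interpret r: comm_ring_hom "mpolys_retract n" by (rule mpolys_retract_hom)
  obtain k where "g = f * k" using assms(3) by auto
  then have "mpolys_retract n g = mpolys_retract n f * mpolys_retract n k"
    by (simp add: r.hom_mult)
  then show ?thesis
    using that[of "mpolys_retract n k"] assms by (simp add: mpolys_retract_id)
qed

section \<open>Evaluation at points\<close>

definition peval :: "complex vec \<Rightarrow> mpoly \<Rightarrow> complex" where
  "peval v = insertion (\<lambda>c. c) (vec_index v)"

lemma peval_hom: "comm_ring_hom (peval v)"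
  unfolding peval_def by (rule insertion_hom[OF id_hom])

interpretation peval: comm_ring_hom "peval v" for v by (rule peval_hom)

lemma peval_mconst [simp]: "peval v (mconst c) = c"
  and peval_mvar [simp]: "peval v (mvar i) = v $ i"
  unfolding peval_def by (simp_all add: id_hom)

text \<open>Induction on the number of variables. f is sorted by powers of the last variable; with
  the other coordinates held fixed, a polynomial in t vanishes at every complex t, so each
  coefficient \<open>g k\<close> vanishes at every point.\<close>

lemma insertion_all_zero:
  "(\<And>x. insertion (\<lambda>c::complex. c) x f = 0) \<Longrightarrow> f \<in> mpolys n \<Longrightarrow> f = 0"
proof (induction n arbitrary: f)
  case 0
  then have "Poly_Mapping.keys f \<subseteq> {0}" by (auto simp: mpolys_def)
  then have "f = mconst (Poly_Mapping.lookup f 0)"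
    by (intro poly_mapping_eqI) (auto simp: mconst_def lookup_single in_keys_iff subset_iff when_def)
  then show ?case using "0.prems"(1)[of "\<lambda>_. 0"] id_hom by (metis insertion_mconst mconst_def single_zero)
next
  case (Suc n)
  define K where "K = Poly_Mapping.lookup f"
  define A where "A k = {m \<in> Poly_Mapping.keys f. Poly_Mapping.lookup m n = k}" for k
  define g where "g k = (\<Sum>m\<in>A k. Poly_Mapping.single (m - Poly_Mapping.single n k) (K m))" for k
  have finA: "finite (A k)" for k unfolding A_def by auto
  have decomp: "m - Poly_Mapping.single n k + Poly_Mapping.single n k = m" if "m \<in> A k" for m k
    using that by (intro poly_mapping_eqI) (auto simp: A_def lookup_add lookup_minus lookup_single when_def)
  have gin: "g k \<in> mpolys n" for k
  proof -
    have "Poly_Mapping.single (m - Poly_Mapping.single n k) (K m) \<in> mpolys n" if "m \<in> A k" for m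
    proof -
      have "Poly_Mapping.keys m \<subseteq> {..<Suc n}" using Suc.prems(2) that by (auto simp: mpolys_def A_def)
      then have "Poly_Mapping.keys (m - Poly_Mapping.single n k) \<subseteq> {..<n}"
        using that by (auto simp: A_def in_keys_iff lookup_minus lookup_single when_def subset_iff less_Suc_eq)
      then show ?thesis by (auto simp: mpolys_def)
    qed
    then show ?thesis unfolding g_def by (rule sum_mpolys)
  qed
  \<comment> \<open>The inserted 0 covers f = 0, where the set of exponents is empty.\<close>
  define D where "D = Max (insert 0 ((\<lambda>m. Poly_Mapping.lookup m n) ` Poly_Mapping.keys f))"
  have fdec: "f = (\<Sum>k\<le>D. g k * mvar n ^ k)"
  proof -
    have "g k * mvar n ^ k = (\<Sum>m\<in>A k. Poly_Mapping.single m (K m))" for k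
      unfolding g_def sum_distrib_right mvar_power
      by (intro sum.cong refl) (simp add: mult_single decomp)
    moreover have "(\<Sum>k\<le>D. \<Sum>m\<in>A k. Poly_Mapping.single m (K m)) =
        (\<Sum>m\<in>(\<Union>k\<in>{..D}. A k). Poly_Mapping.single m (K m))"
      by (rule sum.UNION_disjoint[symmetric]) (auto simp: finA, auto simp: A_def)
    moreover have "(\<Union>k\<in>{..D}. A k) = Poly_Mapping.keys f"
      unfolding A_def D_def by (auto intro!: Max_ge)
    moreover have "(\<Sum>m\<in>Poly_Mapping.keys f. Poly_Mapping.single m (K m)) = f"
      using insertion_mvar_id[of f] unfolding insertion_def K_def
      by (simp add: monom_eval_mvar mconst_def mult_single)
    ultimately show ?thesis by simp
  qed
  have "g k = 0" for k
  proof (cases "k \<le> D")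
    case False
    have "Poly_Mapping.lookup m n \<le> D" if "m \<in> Poly_Mapping.keys f" for m
      unfolding D_def using that by (intro Max_ge) auto
    then have "A k = {}" using False unfolding A_def by auto
    then show ?thesis by (simp add: g_def)
  next
    case True
    have "insertion (\<lambda>c. c) x (g k) = 0" for x
    proof -
      let ?c = "\<lambda>k. insertion (\<lambda>c. c) x (g k)"
      interpret h: comm_ring_hom "insertion (\<lambda>c::complex. c) y" for y by (rule insertion_hom[OF id_hom])
      have "(\<Sum>k\<le>D. ?c k * t ^ k) = 0" for t
      proof -
        \<comment> \<open>\<open>g k\<close> does not involve the last variable, so only the powers
          of t change.\<close>
        have "insertion (\<lambda>c. c) (x(n := t)) (g k) = ?c k" for k
          by (rule insertion_cong[OF id_hom gin]) auto
        then show ?thesis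
          using Suc.prems(1)[of "x(n := t)"]
          by (subst (asm) fdec) (simp add: h.hom_sum h.hom_power id_hom)
      qed
      then have "(\<Sum>k\<le>D. ?c k * t ^ k) = 0" if "t \<in> UNIV" for t by simp
      then have "\<forall>k\<le>D. ?c k = 0"
        using polyfun_eq_0[of ?c D] by blast
      then show ?thesis using True by auto
    qed
    then show ?thesis using Suc.IH gin by auto
  qed
  then show ?case using fdec by simp
qed

lemma peval_all_zero:
  assumes "f \<in> mpolys n" "\<And>v. v \<in> carrier_vec n \<Longrightarrow> peval v f = 0"
  shows "f = 0"
proof (rule insertion_all_zero[OF _ assms(1)])
  fix x
  have "insertion (\<lambda>c. c) x f = peval (vec n x) f"
    unfolding peval_def by (rule insertion_cong[OF id_hom assms(1)]) auto
  then show "insertion (\<lambda>c. c) x f = 0" using assms(2) by simp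
qed

lemma peval_eqI:
  assumes "f \<in> mpolys n" "g \<in> mpolys n" "\<And>v. v \<in> carrier_vec n \<Longrightarrow> peval v f = peval v g"
  shows "f = g"
  using peval_all_zero[of "f - g" n] assms by (simp add: peval.hom_minus)

section \<open>Derivatives\<close>

lemma mderiv_superset:
  assumes "finite A" "Poly_Mapping.keys f \<subseteq> A"
  shows "mderiv j f = (\<Sum>m \<in> A. Poly_Mapping.single (m - Poly_Mapping.single j 1)
       (of_nat (Poly_Mapping.lookup m j) * Poly_Mapping.lookup f m))"
  unfolding mderiv_def
  by (rule sum.mono_neutral_left) (use assms in \<open>auto simp: in_keys_iff\<close>)

lemma mderiv_single:
  "mderiv j (Poly_Mapping.single m c) =
    Poly_Mapping.single (m - Poly_Mapping.single j 1) (of_nat (Poly_Mapping.lookup m j) * c)"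
  by (subst mderiv_superset[of "{m}"]) auto

lemma mderiv_zero [simp]: "mderiv j 0 = 0"
  by (simp add: mderiv_def)

lemma mderiv_add [simp]: "mderiv j (f + g) = mderiv j f + mderiv j g"
proof -
  let ?A = "Poly_Mapping.keys f \<union> Poly_Mapping.keys g"
  show ?thesis
    using mderiv_superset[of ?A f j] mderiv_superset[of ?A g j] mderiv_superset[of ?A "f + g" j]
    by (simp add: keys_add lookup_add algebra_simps single_add sum.distrib)
qed

lemma mderiv_mult: "mderiv j (f * g) = mderiv j f * g + f * mderiv j g"
proof (induction f rule: single_induct)
  case (single_add m c f)
  have "mderiv j (Poly_Mapping.single m c * g) =
      mderiv j (Poly_Mapping.single m c) * g + Poly_Mapping.single m c * mderiv j g"
  proof (induction g rule: single_induct)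
    case (single_add m' c' g)
    let ?e = "Poly_Mapping.single j (1::nat)"
    let ?l = "\<lambda>m. (of_nat (Poly_Mapping.lookup m j) :: complex)"
    \<comment> \<open>The truncated \<open>k - ?e\<close> fails to be the intended monomial only if
      the exponent of index j in k is 0, and then the coefficient \<open>?l k\<close> is 0.\<close>
    have sh: "Poly_Mapping.single (k - ?e + k') (?l k * d) = Poly_Mapping.single (k + k' - ?e) (?l k * d)" for k k' d
    proof (cases "Poly_Mapping.lookup k j = 0")
      case False
      then have "k - ?e + k' = k + k' - ?e"
        by (intro poly_mapping_eqI) (auto simp: lookup_add lookup_minus lookup_single when_def)
      then show ?thesis by simp
    qed simp
    have "mderiv j (Poly_Mapping.single m c * Poly_Mapping.single m' c') =
        Poly_Mapping.single (m + m' - ?e) (?l m * (c * c')) + Poly_Mapping.single (m' + m - ?e) (?l m' * (c * c'))"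
      by (simp add: mult_single mderiv_single lookup_add distrib_right Poly_Mapping.single_add add.commute)
    also have "\<dots> = Poly_Mapping.single (m - ?e + m') (?l m * (c * c')) +
        Poly_Mapping.single (m' - ?e + m) (?l m' * (c * c'))"
      by (simp only: sh)
    also have "\<dots> = mderiv j (Poly_Mapping.single m c) * Poly_Mapping.single m' c' +
        Poly_Mapping.single m c * mderiv j (Poly_Mapping.single m' c')"
      by (simp add: mderiv_single mult_single mult_ac add.commute)
    finally show ?case using single_add by (simp add: algebra_simps)
  qed simp
  then show ?case using single_add by (simp add: algebra_simps)
qed simp

lemma mderiv_mconst [simp]: "mderiv j (mconst c) = 0"
  by (simp add: mconst_def mderiv_single)

lemma mderiv_mvar: "mderiv j (mvar i) = (if i = j then 1 else 0)"
  by (auto simp: mvar_def mderiv_single lookup_single)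

lemma mderiv_sum: "mderiv j (sum f A) = (\<Sum>a\<in>A. mderiv j (f a))"
  by (induction A rule: infinite_finite_induct) auto

lemma mderiv_commute: "mderiv i (mderiv j f) = mderiv j (mderiv i f)"
proof (induction f rule: single_induct)
  case (single_add m c f)
  show ?case
  proof (cases "i = j")
    case False
    then have "m - Poly_Mapping.single j (1::nat) - Poly_Mapping.single i 1 =
        m - Poly_Mapping.single i 1 - Poly_Mapping.single j 1"
      by (intro poly_mapping_eqI) (auto simp: lookup_minus)
    then show ?thesis
      using single_add False by (simp add: mderiv_single lookup_minus lookup_single mult_ac)
  qed simp
qed simp

lemma mderiv_mpolys [simp]: "f \<in> mpolys n \<Longrightarrow> mderiv j f \<in> mpolys n"
  by (induction f rule: mpolys_induct) (auto simp: mderiv_mvar mderiv_mult)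

text \<open>The chain rule. It turns statements about an invariant f(p) into statements about the
  rows of the Jacobian matrix of p.\<close>

lemma mderiv_insertion:
  assumes "f \<in> mpolys n"
  shows "mderiv j (insertion mconst p f) =
    (\<Sum>i<n. insertion mconst p (mderiv i f) * mderiv j (p i))"
  using assms
proof (induction f rule: mpolys_induct)
  case (const c)
  then show ?case by (simp add: mconst_hom)
next
  case (var k)
  interpret p: comm_ring_hom "insertion mconst p" by (rule insertion_hom[OF mconst_hom])
  have "(\<Sum>i<n. insertion mconst p (mderiv i (mvar k)) * mderiv j (p i)) =
      (\<Sum>i<n. if i = k then mderiv j (p i) else 0)"
    by (intro sum.cong refl) (auto simp: mderiv_mvar)
  then show ?case using var by (simp add: mconst_hom)
next
  case (add f g)
  then show ?case by (simp add: mconst_hom distrib_right sum.distrib)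
next
  case (mult f g)
  then show ?case
    by (simp add: mconst_hom mderiv_mult distrib_right distrib_left sum.distrib sum_distrib_left
        sum_distrib_right mult_ac)
qed

section \<open>Directional derivatives\<close>

definition dderiv :: "nat \<Rightarrow> complex vec \<Rightarrow> mpoly \<Rightarrow> mpoly" where
  "dderiv n b f = (\<Sum>j<n. mconst (b $ j) * mderiv j f)"

lemma dderiv_mpolys [simp]: "f \<in> mpolys n \<Longrightarrow> dderiv n b f \<in> mpolys n"
  unfolding dderiv_def by auto

lemma dderiv_add [simp]: "dderiv n b (f + g) = dderiv n b f + dderiv n b g"
  by (simp add: dderiv_def distrib_left sum.distrib)

lemma dderiv_mult: "dderiv n b (f * g) = dderiv n b f * g + f * dderiv n b g"
  by (simp add: dderiv_def mderiv_mult sum_distrib_left sum_distrib_right distrib_left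
      sum.distrib mult_ac)

lemma dderiv_mconst [simp]: "dderiv n b (mconst c) = 0"
  by (simp add: dderiv_def)

lemma dderiv_sum: "dderiv n b (sum f A) = (\<Sum>a\<in>A. dderiv n b (f a))"
  unfolding dderiv_def mderiv_sum sum_distrib_left by (rule sum.swap)

lemma dderiv_mvar: "i < n \<Longrightarrow> dderiv n b (mvar i) = mconst (b $ i)"
proof -
  assume "i < n"
  have "dderiv n b (mvar i) = (\<Sum>j<n. if j = i then mconst (b $ i) else 0)"
    unfolding dderiv_def by (intro sum.cong) (auto simp: mderiv_mvar)
  then show ?thesis using \<open>i < n\<close> by simp
qed

lemma dderiv_commute: "dderiv n b (dderiv n c f) = dderiv n c (dderiv n b f)"
proof -
  have e: "dderiv n b (dderiv n c f) =
      (\<Sum>j<n. \<Sum>i<n. mconst (c $ j) * (mconst (b $ i) * mderiv i (mderiv j f)))" for b c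
    unfolding dderiv_def mderiv_sum mderiv_mult mderiv_mconst sum_distrib_left
    by (subst sum.swap) (simp add: mult_ac)
  show ?thesis
    unfolding e[of b c] e[of c b]
    by (subst sum.swap) (simp add: mderiv_commute mult_ac)
qed

lemma mconst_add: "mconst (a + b) = mconst a + mconst b"
  and mconst_mult: "mconst (a * b) = mconst a * mconst b"
  and mconst_zero [simp]: "mconst 0 = 0"
  and mconst_one [simp]: "mconst 1 = 1"
  and mconst_uminus: "mconst (- a) = - mconst a"
  by (simp_all add: mconst_def single_add mult_single single_uminus)

lemma mconst_sum: "mconst (sum f A) = (\<Sum>a\<in>A. mconst (f a))"
  by (induction A rule: infinite_finite_induct) (auto simp: mconst_add)

lemma mconst_eq_0_iff [simp]: "mconst c = 0 \<longleftrightarrow> c = 0"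
  by (metis mconst_zero peval_mconst)

lemma dderiv_insertion:
  assumes "f \<in> mpolys n"
  shows "dderiv m b (insertion mconst p f) =
    (\<Sum>i<n. insertion mconst p (mderiv i f) * dderiv m b (p i))"
  unfolding dderiv_def mderiv_insertion[OF assms] sum_distrib_left
  by (subst sum.swap) (simp add: mult_ac)

lemma dderiv_add_vec:
  assumes "b \<in> carrier_vec n" "c \<in> carrier_vec n"
  shows "dderiv n (b + c) f = dderiv n b f + dderiv n c f"
  using assms unfolding dderiv_def sum.distrib[symmetric]
  by (intro sum.cong) (auto simp: mconst_add distrib_right)

lemma dderiv_smult_vec:
  assumes "b \<in> carrier_vec n"
  shows "dderiv n (k \<cdot>\<^sub>v b) f = mconst k * dderiv n b f"
  using assms unfolding dderiv_def sum_distrib_left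
  by (intro sum.cong) (auto simp: mconst_mult mult_ac)

section \<open>Restriction to lines\<close>

text \<open>This is f(v + t y) as a polynomial in t: its coefficients of degree 0, 1, 2 are the
  value, the derivative along y and half the second derivative along y of f at v.\<close>

definition line :: "complex vec \<Rightarrow> complex vec \<Rightarrow> mpoly \<Rightarrow> complex poly" where
  "line v y = insertion (\<lambda>c. [:c:]) (\<lambda>i. [:v $ i, y $ i:])"

lemma poly_const_hom: "comm_ring_hom (\<lambda>c::complex. [:c:])"
  by unfold_locales (auto simp: one_pCons)

lemma line_hom: "comm_ring_hom (line v y)"
  unfolding line_def by (rule insertion_hom[OF poly_const_hom])

interpretation line: comm_ring_hom "line v y" for v y by (rule line_hom)

lemma line_mconst [simp]: "line v y (mconst c) = [:c:]"
  and line_mvar [simp]: "line v y (mvar i) = [:v $ i, y $ i:]"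
  unfolding line_def by (simp_all add: poly_const_hom)

lemma poly_eval_hom: "comm_ring_hom (\<lambda>p::complex poly. poly p t)"
  by unfold_locales auto

lemma poly_line:
  assumes "f \<in> mpolys n" "v \<in> carrier_vec n" "y \<in> carrier_vec n"
  shows "poly (line v y f) t = peval (v + t \<cdot>\<^sub>v y) f"
  using assms(1)
  by (induction f rule: mpolys_induct)
    (use assms(2,3) in \<open>auto simp: peval.hom_add peval.hom_mult line.hom_add line.hom_mult\<close>)

lemma poly_line_0 [simp]: "poly (line v y f) 0 = peval v f"
  unfolding line_def insertion_comp[OF poly_const_hom poly_eval_hom] peval_def
  by (simp add: o_def)

lemma coeff_line_0 [simp]: "coeff (line v y f) 0 = peval v f"
  using poly_line_0 by (simp add: poly_0_coeff_0)

lemma pderiv_line: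
  assumes "f \<in> mpolys n"
  shows "pderiv (line v y f) = line v y (dderiv n y f)"
  using assms
  by (induction f rule: mpolys_induct)
    (auto simp: line.hom_add line.hom_mult pderiv_add pderiv_mult dderiv_mult dderiv_mvar pderiv_pCons)

lemma coeff_line_1:
  assumes "f \<in> mpolys n"
  shows "coeff (line v y f) 1 = peval v (dderiv n y f)"
  using arg_cong[OF pderiv_line[OF assms, of v y], of "\<lambda>q. coeff q 0"]
  by (simp add: coeff_pderiv)

lemma coeff_line_2:
  assumes "f \<in> mpolys n"
  shows "2 * coeff (line v y f) 2 = peval v (dderiv n y (dderiv n y f))"
  using arg_cong[OF pderiv_line[OF assms, of v y], of "\<lambda>q. coeff q 1"]
    coeff_line_1[of "dderiv n y f" n v y] assms
  by (simp add: coeff_pderiv numeral_2_eq_2)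

section \<open>Linear forms\<close>

definition linform :: "nat \<Rightarrow> complex vec \<Rightarrow> mpoly" where
  "linform n a = (\<Sum>j<n. mconst (a $ j) * mvar j)"

lemma linform_mpolys [simp]: "linform n a \<in> mpolys n"
  unfolding linform_def by auto

lemma peval_linform [simp]: "v \<in> carrier_vec n \<Longrightarrow> peval v (linform n a) = a \<bullet> v"
  by (simp add: linform_def peval.hom_sum peval.hom_mult scalar_prod_def atLeast0LessThan)

lemma dderiv_linform:
  assumes "b \<in> carrier_vec n"
  shows "dderiv n b (linform n a) = mconst (a \<bullet> b)"
proof -
  have "dderiv n b (linform n a) = (\<Sum>j<n. mconst (a $ j) * mconst (b $ j))"
    unfolding linform_def dderiv_sum by (intro sum.cong) (auto simp: dderiv_mult dderiv_mvar)
  then show ?thesis using assms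
    by (simp add: scalar_prod_def atLeast0LessThan mconst_sum mconst_mult)
qed

lemma line_linform:
  assumes "v \<in> carrier_vec n" "y \<in> carrier_vec n"
  shows "line v y (linform n a) = [:a \<bullet> v, a \<bullet> y:]"
proof (rule poly_eqI)
  fix k
  have "poly (line v y (linform n a)) t = poly [:a \<bullet> v, a \<bullet> y:] t" for t
    using assms
    by (subst poly_line[of _ n])
      (auto simp: scalar_prod_def sum.distrib algebra_simps sum_distrib_left)
  then show "coeff (line v y (linform n a)) k = coeff [:a \<bullet> v, a \<bullet> y:] k"
    by (metis poly_eq_poly_eq_iff ext)
qed

lemma linform_add:
  "a \<in> carrier_vec n \<Longrightarrow> b \<in> carrier_vec n \<Longrightarrow> linform n (a + b) = linform n a + linform n b"
  unfolding linform_def sum.distrib[symmetric]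
  by (intro sum.cong) (auto simp: mconst_add distrib_right)

lemma linform_smult: "a \<in> carrier_vec n \<Longrightarrow> linform n (c \<cdot>\<^sub>v a) = mconst c * linform n a"
  unfolding linform_def sum_distrib_left
  by (intro sum.cong) (auto simp: mconst_mult mult_ac)

lemma exists_scalar_prod_one:
  assumes "a \<in> carrier_vec n" "a \<noteq> 0\<^sub>v n"
  obtains u :: "complex vec" where "u \<in> carrier_vec n" "a \<bullet> u = 1"
proof -
  obtain i where i: "i < n" "a $ i \<noteq> 0" using assms by (metis carrier_vecD eq_vecI index_zero_vec)
  have "a \<bullet> (inverse (a $ i) \<cdot>\<^sub>v unit_vec n i) = 1"
    using assms i by (simp add: scalar_prod_smult_distrib[of _ n])
  then show ?thesis using that[of "inverse (a $ i) \<cdot>\<^sub>v unit_vec n i"] by auto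
qed

text \<open>Composition with the projection onto the hyperplane \<open>a = 0\<close> along \<open>u\<close>, where
  \<open>a \<bullet> u = 1\<close>: a ring endomorphism of \<open>S\<close> with kernel generated by the linear form \<open>a\<close>.\<close>

definition proj_along :: "nat \<Rightarrow> complex vec \<Rightarrow> complex vec \<Rightarrow> mpoly \<Rightarrow> mpoly" where
  "proj_along n a u = insertion mconst (\<lambda>i. mvar i - mconst (u $ i) * linform n a)"

lemma proj_along_hom: "comm_ring_hom (proj_along n a u)"
  unfolding proj_along_def by (rule insertion_hom[OF mconst_hom])

interpretation proj: comm_ring_hom "proj_along n a u" for n a u by (rule proj_along_hom)

lemma proj_along_mconst [simp]: "proj_along n a u (mconst c) = mconst c"
  and proj_along_mvar: "proj_along n a u (mvar i) = mvar i - mconst (u $ i) * linform n a"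
  unfolding proj_along_def by (simp_all add: mconst_hom)

lemma proj_along_mpolys [simp]: "f \<in> mpolys n \<Longrightarrow> proj_along n a u f \<in> mpolys n"
  unfolding proj_along_def by (rule insertion_mpolys) auto

lemma peval_proj_along:
  assumes "f \<in> mpolys n" "v \<in> carrier_vec n" "u \<in> carrier_vec n"
  shows "peval v (proj_along n a u f) = peval (v - (a \<bullet> v) \<cdot>\<^sub>v u) f"
  using assms(1)
  by (induction f rule: mpolys_induct)
    (use assms in \<open>auto simp: proj_along_mvar peval.hom_minus peval.hom_mult peval.hom_add
        proj.hom_add proj.hom_mult\<close>)

text \<open>The substitution is the identity modulo the form a. This is visible on variables;
  products follow from f g - f' g' = f (g - g') + g' (f - f').\<close>

lemma linform_dvd_diff_proj:
  assumes "f \<in> mpolys n"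
  shows "linform n a dvd f - proj_along n a u f"
  using assms
proof (induction f rule: mpolys_induct)
  case (add f g)
  then show ?case using dvd_add[OF add(3,4)] by (simp add: proj.hom_add algebra_simps)
next
  case (mult f g)
  have "f * g - proj_along n a u (f * g) =
      f * (g - proj_along n a u g) + proj_along n a u g * (f - proj_along n a u f)"
    by (simp add: proj.hom_mult algebra_simps)
  then show ?case using mult by simp
qed (auto simp: proj_along_mvar)

context
  fixes n :: nat and a u :: "complex vec"
  assumes a: "a \<in> carrier_vec n" and u: "u \<in> carrier_vec n" and au: "a \<bullet> u = 1"
begin

lemma proj_along_linform: "proj_along n a u (linform n a) = 0"
  by (rule peval_all_zero[of _ n])
    (use a u au in \<open>auto simp: peval_proj_along scalar_prod_minus_distrib[of _ n]\<close>)

lemma proj_along_eq_0_iff: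
  assumes "f \<in> mpolys n"
  shows "proj_along n a u f = 0 \<longleftrightarrow> linform n a dvd f"
proof
  assume "proj_along n a u f = 0"
  then show "linform n a dvd f" using linform_dvd_diff_proj[OF assms, of a u] by simp
next
  assume "linform n a dvd f"
  then show "proj_along n a u f = 0"
    using proj_along_linform by (auto simp: proj.hom_mult elim!: dvdE)
qed

lemma proj_along_idem:
  assumes "f \<in> mpolys n"
  shows "proj_along n a u (proj_along n a u f) = proj_along n a u f"
proof -
  have "proj_along n a u (f - proj_along n a u f) = 0"
    using assms linform_dvd_diff_proj[OF assms, of a u] by (subst proj_along_eq_0_iff) auto
  then show ?thesis by (simp add: proj.hom_minus)
qed

end

lemma linform_dvd_iff:
  assumes "a \<in> carrier_vec n" "a \<noteq> 0\<^sub>v n" "f \<in> mpolys n"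
  shows "linform n a dvd f \<longleftrightarrow> (\<forall>v \<in> carrier_vec n. a \<bullet> v = 0 \<longrightarrow> peval v f = 0)"
proof
  assume "linform n a dvd f"
  then show "\<forall>v \<in> carrier_vec n. a \<bullet> v = 0 \<longrightarrow> peval v f = 0"
    by (auto simp: peval.hom_mult elim!: dvdE)
next
  assume vanish: "\<forall>v \<in> carrier_vec n. a \<bullet> v = 0 \<longrightarrow> peval v f = 0"
  obtain u where u: "u \<in> carrier_vec n" "a \<bullet> u = 1"
    using exists_scalar_prod_one assms by blast
  have "proj_along n a u f = 0"
    by (rule peval_all_zero[of _ n])
      (use assms u vanish in \<open>auto simp: peval_proj_along scalar_prod_minus_distrib[of _ n]\<close>)
  then show "linform n a dvd f" using proj_along_eq_0_iff assms u by blast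
qed

text \<open>The form generates the kernel of a homomorphism into an integral domain, hence is
  prime.\<close>

lemma linform_dvd_mult:
  assumes "a \<in> carrier_vec n" "a \<noteq> 0\<^sub>v n" "f \<in> mpolys n" "g \<in> mpolys n"
    and "linform n a dvd f * g"
  shows "linform n a dvd f \<or> linform n a dvd g"
proof -
  obtain u where u: "u \<in> carrier_vec n" "a \<bullet> u = 1"
    using exists_scalar_prod_one assms by blast
  have "proj_along n a u f * proj_along n a u g = 0"
    using assms u proj_along_eq_0_iff[of a n u "f * g"] by (simp add: proj.hom_mult)
  then show ?thesis using assms u proj_along_eq_0_iff by auto
qed

text \<open>Two rounds of division. Modulo the form a, f is replaced by its projection, which is
  constant along u and vanishes wherever the projected form of b does.\<close>

lemma vanish_codim2:
  assumes a: "a \<in> carrier_vec n" "a \<noteq> 0\<^sub>v n" and b: "b \<in> carrier_vec n"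
    and indep: "\<And>c. b \<noteq> c \<cdot>\<^sub>v a"
    and f: "f \<in> mpolys n"
    and vanish: "\<And>v. v \<in> carrier_vec n \<Longrightarrow> a \<bullet> v = 0 \<Longrightarrow> b \<bullet> v = 0 \<Longrightarrow> peval v f = 0"
  obtains g h where "g \<in> mpolys n" "h \<in> mpolys n" "f = linform n a * g + linform n b * h"
proof -
  obtain u where u: "u \<in> carrier_vec n" "a \<bullet> u = 1"
    using exists_scalar_prod_one a by blast
  obtain g where g: "g \<in> mpolys n" "f - proj_along n a u f = linform n a * g"
    using dvd_mpolys[OF _ _ linform_dvd_diff_proj[OF f, of a u]] f
    by (metis diff_mpolys linform_mpolys proj_along_mpolys)
  \<comment> \<open>\<open>b'\<close> is b composed with the projection along u: it agrees with b on
    the hyperplane of a and kills u.\<close>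
  define b' where "b' = b - (b \<bullet> u) \<cdot>\<^sub>v a"
  have b': "b' \<in> carrier_vec n" unfolding b'_def using a b by simp
  have "b' \<noteq> 0\<^sub>v n"
  proof
    assume *: "b' = 0\<^sub>v n"
    have "b = (b \<bullet> u) \<cdot>\<^sub>v a"
    proof (rule eq_vecI)
      fix i assume "i < dim_vec ((b \<bullet> u) \<cdot>\<^sub>v a)"
      then have i: "i < n" using a by simp
      have "b' $ i = 0" using * i by simp
      then show "b $ i = ((b \<bullet> u) \<cdot>\<^sub>v a) $ i" using a b i by (simp add: b'_def)
    qed (use a b in auto)
    then show False using indep by blast
  qed
  moreover have "peval v (proj_along n a u f) = 0" if v: "v \<in> carrier_vec n" "b' \<bullet> v = 0" for v
  proof -
    have "b \<bullet> v = (b \<bullet> u) * (a \<bullet> v)"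
      using v a b u by (simp add: b'_def minus_scalar_prod_distrib[of _ n])
    then show ?thesis
      using a b u v by (subst peval_proj_along)
        (auto intro!: vanish simp: f scalar_prod_minus_distrib[of _ n])
  qed
  ultimately have "linform n b' dvd proj_along n a u f"
    using linform_dvd_iff b' f by auto
  then obtain h where h: "h \<in> mpolys n" "proj_along n a u f = linform n b' * h"
    using dvd_mpolys[of "linform n b'" n "proj_along n a u f"] f by auto
  have "linform n b = linform n b' + mconst (b \<bullet> u) * linform n a"
    by (rule peval_eqI[of _ n]) (use a b u in \<open>auto simp: b'_def peval.hom_add peval.hom_mult
        minus_scalar_prod_distrib[of _ n]\<close>)
  then have "f = linform n a * (g - mconst (b \<bullet> u) * h) + linform n b * h"
    using g h by (simp add: algebra_simps)
  then show ?thesis using that[of "g - mconst (b \<bullet> u) * h" h] g h by simp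
qed

section \<open>Finite reflection groups\<close>

lemma GL_simps:
  "mult (GL n) = (*)" "one (GL n) = 1\<^sub>m n" "carrier (GL n) = Units (ring_mat TYPE(complex) n ())"
  by (simp_all add: GL_def units_of_def ring_mat_simps)

lemma GL_group: "group (GL n)"
  unfolding GL_def
  by (rule monoid.units_group)
    (use ring_mat[where 'a = complex, of n "()"] in \<open>simp add: ring_def\<close>)

lemma GL_carrierD: "w \<in> carrier (GL n) \<Longrightarrow> w \<in> carrier_mat n n"
  by (auto simp: GL_simps Units_def ring_mat_simps)

lemma involution_GL:
  assumes "r \<in> carrier_mat n n" "r * r = 1\<^sub>m n"
  shows "r \<in> carrier (GL n)" "inv\<^bsub>GL n\<^esub> r = r"
proof -
  show r: "r \<in> carrier (GL n)"
    using assms by (auto simp: GL_simps Units_def ring_mat_simps)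
  show "inv\<^bsub>GL n\<^esub> r = r"
    by (rule group.inv_equality[OF GL_group]) (use assms r in \<open>auto simp: GL_simps\<close>)
qed

text \<open>The generators are involutions, so each is its own inverse and the inverse rule of
  \<open>generate\<close> adds no case.\<close>

lemma generate_GL_induct [consumes 1, case_names involution one mult]:
  assumes "w \<in> generate (GL n) R"
    and inv: "\<And>r. r \<in> R \<Longrightarrow> r \<in> carrier_mat n n \<and> r * r = 1\<^sub>m n \<and> P r"
    and one: "P (1\<^sub>m n)"
    and mult: "\<And>u v. u \<in> carrier_mat n n \<Longrightarrow> v \<in> carrier_mat n n \<Longrightarrow> P u \<Longrightarrow> P v \<Longrightarrow> P (u * v)"
  shows "P w"
proof -
  have "w \<in> carrier_mat n n \<and> P w"
    using assms(1)
  proof (induction rule: generate.induct)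
    case one
    then show ?case using \<open>P (1\<^sub>m n)\<close> by (simp add: GL_simps)
  next
    case (incl h)
    then show ?case using inv by blast
  next
    case (inv h)
    then show ?case using assms(2)[of h] involution_GL[of h n] by simp
  next
    case (eng h1 h2)
    then show ?case using mult by (auto simp: GL_simps intro: mult_carrier_mat)
  qed
  then show ?thesis by simp
qed

lemma mat_eq_by_vec:
  fixes A B :: "'a::comm_ring_1 mat"
  assumes "A \<in> carrier_mat n n" "B \<in> carrier_mat n n"
    and "\<And>v. v \<in> carrier_vec n \<Longrightarrow> A *\<^sub>v v = B *\<^sub>v v"
  shows "A = B"
proof (rule eq_matI)
  fix i j assume ij: "i < dim_row B" "j < dim_col B"
  then have "A $$ (i, j) = (A *\<^sub>v unit_vec n j) $ i" "B $$ (i, j) = (B *\<^sub>v unit_vec n j) $ i"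
    using assms(1,2) by auto
  then show "A $$ (i, j) = B $$ (i, j)" using assms(3)[of "unit_vec n j"] by simp
qed (use assms in auto)

section \<open>Generic points of a subspace\<close>

lemma mult_mat_vec_affine:
  fixes A :: "complex mat"
  assumes "A \<in> carrier_mat n n" "x \<in> carrier_vec n" "z \<in> carrier_vec n"
  shows "A *\<^sub>v (x + t \<cdot>\<^sub>v z) = A *\<^sub>v x + t \<cdot>\<^sub>v (A *\<^sub>v z)"
  using assms by (simp add: mult_add_distrib_mat_vec[of _ n n] mult_mat_vec[of _ n n])

text \<open>A complex vector space is not a finite union of proper subspaces. The induction moves
  the current point x in a direction z that the new matrix w does not fix; each matrix acting
  nontrivially on X fixes at most one point of the line x + t z, so all but finitely many t work.
  Applied to W this gives a point of X whose stabilizer fixes X pointwise.\<close>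

lemma exists_generic:
  fixes X :: "complex vec set"
  assumes "finite I" "I \<subseteq> carrier_mat n n" "X \<subseteq> carrier_vec n" "X \<noteq> {}"
    and closed: "\<And>x z t. x \<in> X \<Longrightarrow> z \<in> X \<Longrightarrow> x + t \<cdot>\<^sub>v z \<in> X"
  shows "\<exists>x\<in>X. \<forall>w\<in>I. w *\<^sub>v x = x \<longrightarrow> (\<forall>z\<in>X. w *\<^sub>v z = z)"
  using assms(1,2)
proof (induction I rule: finite_induct)
  case empty
  then show ?case using assms(4) by blast
next
  case (insert w I)
  then obtain x where x: "x \<in> X" "\<forall>w\<in>I. w *\<^sub>v x = x \<longrightarrow> (\<forall>z\<in>X. w *\<^sub>v z = z)" by auto
  show ?case
  proof (cases "\<forall>z\<in>X. w *\<^sub>v z = z")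
    case True
    then show ?thesis using x by blast
  next
    case False
    then obtain z where z: "z \<in> X" "w *\<^sub>v z \<noteq> z" by blast
    \<comment> \<open>A matrix that fixes two points of the line fixes z, by subtraction, and then
      x.\<close>
    have two: "u *\<^sub>v z = z \<and> u *\<^sub>v x = x"
      if u: "u \<in> carrier_mat n n" and t: "t \<noteq> t'"
        and fix2: "u *\<^sub>v (x + t \<cdot>\<^sub>v z) = x + t \<cdot>\<^sub>v z" "u *\<^sub>v (x + t' \<cdot>\<^sub>v z) = x + t' \<cdot>\<^sub>v z" for u t t'
    proof -
      have xz: "x \<in> carrier_vec n" "z \<in> carrier_vec n" using x z assms(3) by auto
      have eq: "(u *\<^sub>v x) $ i + s * (u *\<^sub>v z) $ i = x $ i + s * z $ i"
        if "u *\<^sub>v (x + s \<cdot>\<^sub>v z) = x + s \<cdot>\<^sub>v z" "i < n" for s i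
        using that(2) arg_cong[OF that(1), of "\<lambda>v. v $ i"] u xz mult_mat_vec_affine[OF u xz, of s]
        by (simp del: index_mult_mat_vec)
      have comp: "(u *\<^sub>v z) $ i = z $ i \<and> (u *\<^sub>v x) $ i = x $ i" if "i < n" for i
      proof -
        have e: "(u *\<^sub>v x) $ i + t * (u *\<^sub>v z) $ i = x $ i + t * z $ i"
          "(u *\<^sub>v x) $ i + t' * (u *\<^sub>v z) $ i = x $ i + t' * z $ i"
          using eq fix2 \<open>i < n\<close> by blast+
        have "(t - t') * ((u *\<^sub>v z) $ i - z $ i) =
            (((u *\<^sub>v x) $ i + t * (u *\<^sub>v z) $ i) - ((u *\<^sub>v x) $ i + t' * (u *\<^sub>v z) $ i)) -
            ((x $ i + t * z $ i) - (x $ i + t' * z $ i))"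
          by (simp only: algebra_simps)
        also have "\<dots> = 0" unfolding e by simp
        finally have "(t - t') * ((u *\<^sub>v z) $ i - z $ i) = 0" .
        then show ?thesis
          using t e(1) by simp
      qed
      show ?thesis
        by (intro conjI eq_vecI) (use comp u xz in \<open>auto simp del: index_mult_mat_vec\<close>)
    qed
    define N where "N = {u \<in> insert w I. \<exists>z\<in>X. u *\<^sub>v z \<noteq> z}"
    define T where "T u = {t. u *\<^sub>v (x + t \<cdot>\<^sub>v z) = x + t \<cdot>\<^sub>v z}" for u
    have "finite (T u)" if "u \<in> N" for u
    proof -
      have "t = t'" if "t \<in> T u" "t' \<in> T u" for t t'
      proof (rule ccontr)
        assume "t \<noteq> t'"
        then have "u *\<^sub>v z = z \<and> u *\<^sub>v x = x"
          using two[of u t t'] that \<open>u \<in> N\<close> insert.prems by (auto simp: T_def N_def)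
        \<comment> \<open>A matrix of I that fixes x acts trivially on X, and w does not fix z;
          neither fits membership in N.\<close>
        then show False using \<open>u \<in> N\<close> x z by (auto simp: N_def)
      qed
      then have "T u \<subseteq> {SOME t. t \<in> T u}" by (metis singletonI someI subsetI)
      then show ?thesis by (rule finite_subset) simp
    qed
    then have "finite (\<Union>u\<in>N. T u)" using insert.hyps by (auto simp: N_def)
    then obtain t where "t \<notin> (\<Union>u\<in>N. T u)"
      using infinite_UNIV_char_0 by (metis UNIV_eq_I)
    then have "\<forall>u\<in>insert w I. u *\<^sub>v (x + t \<cdot>\<^sub>v z) = x + t \<cdot>\<^sub>v z \<longrightarrow> (\<forall>z\<in>X. u *\<^sub>v z = z)"
      by (auto simp: N_def T_def)
    then show ?thesis using closed[OF x(1) z(1), of t] by blast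
  qed
qed

section \<open>A finite real reflection group acting on vectors\<close>

locale coxeter =
  fixes n :: nat and W :: "complex mat set"
  assumes coxeter: "coxeter_group n W"
begin

lemma finite_W [simp]: "finite W"
  and W_subgroup: "subgroup W (GL n)"
  and W_generated: "generate (GL n) (reflections n W) = W"
  and W_fixed: "v \<in> carrier_vec n \<Longrightarrow> (\<And>w. w \<in> W \<Longrightarrow> w *\<^sub>v v = v) \<Longrightarrow> v = 0\<^sub>v n"
  using coxeter by (auto simp: coxeter_group_def)

lemma W_carrier [simp]: "w \<in> W \<Longrightarrow> w \<in> carrier_mat n n"
  using W_subgroup GL_carrierD by (auto simp: subgroup_def)

lemma W_dim [simp]: "w \<in> W \<Longrightarrow> dim_row w = n" "w \<in> W \<Longrightarrow> dim_col w = n"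
  using W_carrier by blast+

lemma one_W [simp]: "1\<^sub>m n \<in> W"
  using subgroup.one_closed[OF W_subgroup] by (simp add: GL_simps)

lemma mult_W [simp]: "u \<in> W \<Longrightarrow> v \<in> W \<Longrightarrow> u * v \<in> W"
  using subgroup.m_closed[OF W_subgroup] by (simp add: GL_simps)

lemma inverse_W:
  assumes "w \<in> W"
  obtains w' where "w' \<in> W" "w * w' = 1\<^sub>m n" "w' * w = 1\<^sub>m n"
proof -
  interpret G: group "GL n" by (rule GL_group)
  have w: "w \<in> carrier (GL n)" using W_subgroup assms by (auto simp: subgroup_def)
  show ?thesis
    using that[of "inv\<^bsub>GL n\<^esub> w"] subgroup.m_inv_closed[OF W_subgroup assms]
      G.r_inv[OF w] G.l_inv[OF w] by (simp add: GL_simps)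
qed

lemma W_vec [simp]: "w \<in> W \<Longrightarrow> v \<in> carrier_vec n \<Longrightarrow> w *\<^sub>v v \<in> carrier_vec n"
  using mult_mat_vec_carrier W_carrier by blast

lemma W_mult_vec:
  "u \<in> W \<Longrightarrow> w \<in> W \<Longrightarrow> v \<in> carrier_vec n \<Longrightarrow> (u * w) *\<^sub>v v = u *\<^sub>v (w *\<^sub>v v)"
  by (rule assoc_mult_mat_vec[of _ n n _ n]) auto

lemma W_add: "w \<in> W \<Longrightarrow> u \<in> carrier_vec n \<Longrightarrow> v \<in> carrier_vec n \<Longrightarrow> w *\<^sub>v (u + v) = w *\<^sub>v u + w *\<^sub>v v"
  and W_smult: "w \<in> W \<Longrightarrow> u \<in> carrier_vec n \<Longrightarrow> w *\<^sub>v (c \<cdot>\<^sub>v u) = c \<cdot>\<^sub>v (w *\<^sub>v u)"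
  and W_minus: "w \<in> W \<Longrightarrow> u \<in> carrier_vec n \<Longrightarrow> v \<in> carrier_vec n \<Longrightarrow> w *\<^sub>v (u - v) = w *\<^sub>v u - w *\<^sub>v v"
  by (simp_all add: mult_add_distrib_mat_vec[of _ n n] mult_mat_vec[of _ n n]
      mult_minus_distrib_mat_vec[of _ n n])

lemma reflectionsD:
  assumes "s \<in> reflections n W"
  shows "s \<in> W" "s \<in> carrier_mat n n" "s * s = 1\<^sub>m n" "\<And>i j. i < n \<Longrightarrow> j < n \<Longrightarrow> s $$ (i, j) \<in> \<real>"
  using assms by (auto simp: reflections_def is_reflection_def)

lemma W_induct [consumes 1, case_names reflection one mult]:
  assumes "w \<in> W"
    and "\<And>s. s \<in> reflections n W \<Longrightarrow> P s"
    and "P (1\<^sub>m n)"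
    and "\<And>u v. u \<in> carrier_mat n n \<Longrightarrow> v \<in> carrier_mat n n \<Longrightarrow> P u \<Longrightarrow> P v \<Longrightarrow> P (u * v)"
  shows "P w"
proof -
  have "w \<in> generate (GL n) (reflections n W)" using assms(1) W_generated by simp
  then show ?thesis
    by (induction rule: generate_GL_induct) (use assms reflectionsD in blast)+
qed

lemma W_real: "w \<in> W \<Longrightarrow> i < n \<Longrightarrow> j < n \<Longrightarrow> w $$ (i, j) \<in> \<real>"
proof -
  assume w: "w \<in> W" and ij: "i < n" "j < n"
  have "\<forall>i<n. \<forall>j<n. w $$ (i, j) \<in> \<real>"
    using w
  proof (induction rule: W_induct)
    case (mult u v)
    then show ?case by (auto simp: scalar_prod_def intro!: sum_in_Reals Reals_mult)
  qed (auto simp: reflectionsD)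
  then show ?thesis using ij by blast
qed

lemma W_conjugate:
  assumes "w \<in> W" "v \<in> carrier_vec n"
  shows "conjugate (w *\<^sub>v v) = w *\<^sub>v conjugate v"
proof -
  have dim: "dim_row w = n" "dim_col w = n" using carrier_matD[OF W_carrier[OF assms(1)]] by auto
  show ?thesis
  proof (rule eq_vecI)
  fix i assume "i < dim_vec (w *\<^sub>v conjugate v)"
  then have i: "i < n" using dim by simp
  have "cnj (w $$ (i, j)) = w $$ (i, j)" if "j < n" for j
    using W_real[OF assms(1) i that] by (simp add: Reals_cnj_iff)
  then show "conjugate (w *\<^sub>v v) $ i = (w *\<^sub>v conjugate v) $ i"
    using assms(2) dim i by (auto simp: scalar_prod_def)
qed (use assms dim in auto)
qed

section \<open>The invariant symmetric form\<close>

text \<open>The standard dot product summed over W. It is bilinear and not Hermitian, so that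
  \<open>form a v\<close> is a polynomial in v; the price is isotropic complex vectors, which are
  handled by pairing with conjugates.\<close>

definition form :: "complex vec \<Rightarrow> complex vec \<Rightarrow> complex" where
  "form u v = (\<Sum>w\<in>W. (w *\<^sub>v u) \<bullet> (w *\<^sub>v v))"

lemma form_comm: "u \<in> carrier_vec n \<Longrightarrow> v \<in> carrier_vec n \<Longrightarrow> form u v = form v u"
  unfolding form_def by (intro sum.cong refl) (metis W_vec comm_scalar_prod)

lemma form_add_right:
  "u \<in> carrier_vec n \<Longrightarrow> v \<in> carrier_vec n \<Longrightarrow> v' \<in> carrier_vec n \<Longrightarrow> form u (v + v') = form u v + form u v'"
  unfolding form_def sum.distrib[symmetric]
  by (intro sum.cong refl) (simp add: W_add scalar_prod_add_distrib[of _ n])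

lemma form_smult_right:
  "u \<in> carrier_vec n \<Longrightarrow> v \<in> carrier_vec n \<Longrightarrow> form u (c \<cdot>\<^sub>v v) = c * form u v"
  unfolding form_def sum_distrib_left
  by (intro sum.cong refl) (simp add: W_smult scalar_prod_smult_distrib[of _ n])

lemma form_minus_right:
  "u \<in> carrier_vec n \<Longrightarrow> v \<in> carrier_vec n \<Longrightarrow> v' \<in> carrier_vec n \<Longrightarrow> form u (v - v') = form u v - form u v'"
  unfolding form_def sum_subtractf[symmetric]
  by (intro sum.cong refl) (simp add: W_minus scalar_prod_minus_distrib[of _ n])

lemma form_add_left:
  "u \<in> carrier_vec n \<Longrightarrow> u' \<in> carrier_vec n \<Longrightarrow> v \<in> carrier_vec n \<Longrightarrow> form (u + u') v = form u v + form u' v"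
  using form_add_right form_comm by simp

lemma form_smult_left:
  "u \<in> carrier_vec n \<Longrightarrow> v \<in> carrier_vec n \<Longrightarrow> form (c \<cdot>\<^sub>v u) v = c * form u v"
  using form_smult_right form_comm by simp

lemma form_minus_left:
  "u \<in> carrier_vec n \<Longrightarrow> u' \<in> carrier_vec n \<Longrightarrow> v \<in> carrier_vec n \<Longrightarrow> form (u - u') v = form u v - form u' v"
  using form_minus_right form_comm by simp

lemmas form_linear = form_add_left form_add_right form_smult_left form_smult_right
  form_minus_left form_minus_right

lemma sum_W_translate:
  assumes "w \<in> W"
  shows "(\<Sum>u\<in>W. f (u * w)) = (\<Sum>u\<in>W. f u)"
proof -
  obtain w' where w': "w' \<in> W" "w * w' = 1\<^sub>m n" "w' * w = 1\<^sub>m n" using inverse_W assms by blast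
  have c: "w \<in> carrier_mat n n" "w' \<in> carrier_mat n n" using assms w' by auto
  have "bij_betw (\<lambda>u. u * w) W W"
    by (rule bij_betw_byWitness[where f' = "\<lambda>u. u * w'"])
      (use assms w' c W_carrier in \<open>auto simp: assoc_mult_mat[of _ n n _ n _ n] right_mult_one_mat[of _ n n]\<close>)
  then show ?thesis by (rule sum.reindex_bij_betw)
qed

lemma form_invariant:
  assumes "w \<in> W" "u \<in> carrier_vec n" "v \<in> carrier_vec n"
  shows "form (w *\<^sub>v u) (w *\<^sub>v v) = form u v"
proof -
  have "form (w *\<^sub>v u) (w *\<^sub>v v) = (\<Sum>x\<in>W. ((x * w) *\<^sub>v u) \<bullet> ((x * w) *\<^sub>v v))"
    unfolding form_def using assms by (intro sum.cong refl) (simp add: W_mult_vec)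
  also have "\<dots> = form u v" unfolding form_def by (rule sum_W_translate[OF assms(1)])
  finally show ?thesis .
qed

lemma form_conjugate:
  assumes "u \<in> carrier_vec n" "v \<in> carrier_vec n"
  shows "form (conjugate u) (conjugate v) = cnj (form u v)"
  unfolding form_def cnj_sum using assms
  by (intro sum.cong refl)
    (simp add: W_conjugate[symmetric] conjugate_sprod_vec[of _ n, symmetric])

text \<open>W is real, so each summand is the Hermitian square norm of w v, and the identity
  contributes a positive one.\<close>

lemma form_conjugate_pos:
  assumes "v \<in> carrier_vec n" "v \<noteq> 0\<^sub>v n"
  shows "form v (conjugate v) \<noteq> 0"
proof -
  have "form v (conjugate v) = (\<Sum>w\<in>W. (w *\<^sub>v v) \<bullet>c (w *\<^sub>v v))"
    unfolding form_def using assms by (intro sum.cong refl) (simp add: W_conjugate)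
  also have "\<dots> > 0"
    by (rule sum_pos2[of _ "1\<^sub>m n"]) (use assms in \<open>auto simp: conjugate_square_ge_0_vec\<close>)
  finally show ?thesis by simp
qed

lemma form_nondegenerate:
  assumes "v \<in> carrier_vec n" "\<And>x. x \<in> carrier_vec n \<Longrightarrow> form v x = 0"
  shows "v = 0\<^sub>v n"
  using form_conjugate_pos[OF assms(1)] assms by auto

lemma form_real_pos:
  assumes "v \<in> carrier_vec n" "v \<noteq> 0\<^sub>v n" "conjugate v = v"
  shows "form v v \<noteq> 0"
  using form_conjugate_pos assms by metis

text \<open>The coefficient vector of the linear functional \<open>form a\<close>; hyperplanes are
  given by dot products, so the form has to be translated into them.\<close>

definition dual :: "complex vec \<Rightarrow> complex vec" where
  "dual a = vec n (\<lambda>j. \<Sum>w\<in>W. (transpose_mat w *\<^sub>v (w *\<^sub>v a)) $ j)"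

lemma dual_carrier [simp]: "dual a \<in> carrier_vec n"
  by (simp add: dual_def)

lemma dual_scalar_prod:
  assumes "a \<in> carrier_vec n" "v \<in> carrier_vec n"
  shows "dual a \<bullet> v = form a v"
proof -
  have "form a v = (\<Sum>w\<in>W. (transpose_mat w *\<^sub>v (w *\<^sub>v a)) \<bullet> v)"
    unfolding form_def using assms
    by (intro sum.cong refl) (simp add: transpose_vec_mult_scalar[of _ n n])
  also have "\<dots> = (\<Sum>w\<in>W. \<Sum>j<n. (transpose_mat w *\<^sub>v (w *\<^sub>v a)) $ j * v $ j)"
    using assms by (simp add: scalar_prod_def[of _ v] atLeast0LessThan)
  also have "\<dots> = dual a \<bullet> v"
    using assms by (simp add: dual_def scalar_prod_def[of _ v] atLeast0LessThan sum_distrib_right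
        sum.swap[of _ W] del: index_mult_mat_vec)
  finally show ?thesis by simp
qed

end

section \<open>Roots\<close>

lemma vec_minus_eq_zeroD:
  fixes u v :: "'a::group_add vec"
  assumes "u \<in> carrier_vec n" "v \<in> carrier_vec n" "u - v = 0\<^sub>v n"
  shows "u = v"
proof (rule eq_vecI)
  fix i assume "i < dim_vec v"
  then have i: "i < dim_vec v" "i < n" using assms(2) by auto
  have "u $ i - v $ i = (u - v) $ i" using i by simp
  also have "\<dots> = 0" using assms(3) i by simp
  finally show "u $ i = v $ i" by simp
qed (use assms in auto)

lemma conjugate_fixed_iff:
  assumes "u \<in> carrier_vec n"
  shows "conjugate u = (u :: complex vec) \<longleftrightarrow> (\<forall>i<n. cnj (u $ i) = u $ i)"
proof
  assume "conjugate u = u"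
  then show "\<forall>i<n. cnj (u $ i) = u $ i"
    using assms by (metis carrier_vecD vec_index_conjugate conjugate_complex_def)
next
  assume "\<forall>i<n. cnj (u $ i) = u $ i"
  then show "conjugate u = u" using assms by (intro eq_vecI) auto
qed

context coxeter
begin

text \<open>A normal vector of the reflecting hyperplane, of arbitrary length. Reality is included
  because it makes \<open>form a a\<close> nonzero.\<close>

definition is_root :: "complex vec \<Rightarrow> complex mat \<Rightarrow> bool" where
  "is_root a s \<longleftrightarrow> a \<in> carrier_vec n \<and> a \<noteq> 0\<^sub>v n \<and> conjugate a = a \<and>
    (\<forall>v \<in> carrier_vec n. s *\<^sub>v v = v - (2 * form a v / form a a) \<cdot>\<^sub>v a)"

lemma is_rootD:
  assumes "is_root a s"
  shows "a \<in> carrier_vec n" "a \<noteq> 0\<^sub>v n" "conjugate a = a" "form a a \<noteq> 0"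
    "\<And>v. v \<in> carrier_vec n \<Longrightarrow> s *\<^sub>v v = v - (2 * form a v / form a a) \<cdot>\<^sub>v a"
  using assms form_real_pos by (auto simp: is_root_def)

text \<open>The root is e - s e for a basis vector e that s moves: it is real because e and s are,
  and s negates it because s is an involution. Invariance of the form then makes it orthogonal to
  the hyperplane.\<close>

lemma exists_root:
  assumes s: "s \<in> reflections n W"
  obtains a where "is_root a s"
proof -
  note sD = reflectionsD[OF s]
  obtain \<alpha> where \<alpha>: "\<alpha> \<in> carrier_vec n" "\<alpha> \<noteq> 0\<^sub>v n" "fixed_space n s = hyperplane n \<alpha>"
    using s by (auto simp: reflections_def is_reflection_def)
  obtain u where u: "u \<in> carrier_vec n" "\<alpha> \<bullet> u = 1" using exists_scalar_prod_one \<alpha> by blast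
  \<comment> \<open>Otherwise s is the identity and fixes u, which lies off the hyperplane.\<close>
  have "\<exists>j<n. s *\<^sub>v unit_vec n j \<noteq> unit_vec n j"
  proof (rule ccontr)
    assume "\<not> ?thesis"
    then have *: "s *\<^sub>v unit_vec n j = unit_vec n j" if "j < n" for j using that by blast
    have "s = 1\<^sub>m n"
    proof (rule eq_matI)
      fix i j assume "i < dim_row (1\<^sub>m n)" "j < dim_col (1\<^sub>m n)"
      then have ij: "i < n" "j < n" by auto
      have "s $$ (i, j) = (s *\<^sub>v unit_vec n j) $ i" using sD(2) ij by auto
      then show "s $$ (i, j) = 1\<^sub>m n $$ (i, j)" using * ij by (simp add: unit_vec_def)
    qed (use sD in auto)
    then have "u \<in> fixed_space n s" using u by (simp add: fixed_space_def)
    then show False using \<alpha> u by (simp add: hyperplane_def)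
  qed
  then obtain j where j: "j < n" "s *\<^sub>v unit_vec n j \<noteq> unit_vec n j" by blast
  define e where "e = (unit_vec n j :: complex vec)"
  define a where "a = e - s *\<^sub>v e"
  have e: "e \<in> carrier_vec n" "conjugate e = e"
    using j unfolding e_def by (auto intro!: eq_vecI simp: unit_vec_def)
  have se: "s *\<^sub>v e \<in> carrier_vec n" "conjugate (s *\<^sub>v e) = s *\<^sub>v e" "s *\<^sub>v (s *\<^sub>v e) = e"
    using e sD W_conjugate[OF sD(1) e(1)] by (auto simp: W_mult_vec[symmetric])
  have a: "a \<in> carrier_vec n" unfolding a_def using e se by simp
  have "a \<noteq> 0\<^sub>v n"
  proof
    assume a0: "a = 0\<^sub>v n"
    have "e = s *\<^sub>v e" using vec_minus_eq_zeroD[OF e(1) se(1)] a0 by (simp add: a_def)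
    then show False using j by (metis e_def)
  qed
  have "conjugate a = a"
    unfolding conjugate_fixed_iff[OF a]
  proof (intro allI impI)
    fix i assume i: "i < n"
    have "a $ i = e $ i - (s *\<^sub>v e) $ i" unfolding a_def
      by (rule index_minus_vec(1)) (use i carrier_vecD[OF se(1)] in metis)
    then show "cnj (a $ i) = a $ i"
      using i e se conjugate_fixed_iff by (metis complex_cnj_diff)
  qed
  have sa: "s *\<^sub>v a = - a"
    unfolding a_def using sD(1) e(1) se by (auto simp: W_minus)
  \<comment> \<open>A root on the hyperplane would be both fixed and negated.\<close>
  have "\<alpha> \<bullet> a \<noteq> 0"
  proof
    assume "\<alpha> \<bullet> a = 0"
    then have "s *\<^sub>v a = a" using \<alpha> a by (auto simp: fixed_space_def hyperplane_def)
    then have neg: "- a = a" using sa by simp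
    have "a = 0\<^sub>v n"
    proof (rule eq_vecI)
      fix i assume "i < dim_vec (0\<^sub>v n)"
      then have "- (a $ i) = a $ i" using arg_cong[OF neg, of "\<lambda>v. v $ i"] a by simp
      then show "a $ i = 0\<^sub>v n $ i" using \<open>i < dim_vec (0\<^sub>v n)\<close> by simp
    qed (use a in simp)
    then show False using \<open>a \<noteq> 0\<^sub>v n\<close> by contradiction
  qed
  have "s *\<^sub>v v = v - (2 * form a v / form a a) \<cdot>\<^sub>v a" if v: "v \<in> carrier_vec n" for v
  proof -
    \<comment> \<open>The coefficient for which the remainder h lies on the hyperplane.\<close>
    define \<xi> where "\<xi> = (\<alpha> \<bullet> v) / (\<alpha> \<bullet> a)"
    define h where "h = v - \<xi> \<cdot>\<^sub>v a"
    have h: "h \<in> carrier_vec n" unfolding h_def using a v by simp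
    have "\<alpha> \<bullet> h = 0"
      unfolding h_def \<xi>_def using \<open>\<alpha> \<bullet> a \<noteq> 0\<close> a v \<alpha>
      by (simp add: scalar_prod_minus_distrib[of _ n])
    then have sh: "s *\<^sub>v h = h" using \<alpha> h by (auto simp: fixed_space_def hyperplane_def)
    have "form a h = form (s *\<^sub>v a) (s *\<^sub>v h)" using sD(1) a h by (simp add: form_invariant)
    also have "\<dots> = form ((-1) \<cdot>\<^sub>v a) h" unfolding sa sh by (rule arg_cong2[of _ _ _ _ form]) auto
    also have "\<dots> = - form a h" using a h by (simp add: form_linear)
    finally have "form a h = 0" by simp
    then have "form a v = \<xi> * form a a" using a v by (simp add: h_def form_linear)
    then have \<xi>: "\<xi> = form a v / form a a"
      using form_real_pos[OF a \<open>a \<noteq> 0\<^sub>v n\<close> \<open>conjugate a = a\<close>] by simp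
    have "v = h + \<xi> \<cdot>\<^sub>v a" unfolding h_def using a v by auto
    then have "s *\<^sub>v v = s *\<^sub>v (h + \<xi> \<cdot>\<^sub>v a)" by simp
    also have "\<dots> = h + \<xi> \<cdot>\<^sub>v (- a)"
      using sD(1) a h by (simp add: W_add W_smult sa sh)
    also have "\<dots> = v - (2 * \<xi>) \<cdot>\<^sub>v a"
      unfolding h_def using a v by (auto simp: algebra_simps)
    finally show ?thesis by (simp add: \<xi>)
  qed
  then have "is_root a s"
    unfolding is_root_def using a \<open>a \<noteq> 0\<^sub>v n\<close> \<open>conjugate a = a\<close> by blast
  then show ?thesis by (rule that)
qed

lemma root_fixed_iff:
  assumes "is_root a s" "v \<in> carrier_vec n"
  shows "s *\<^sub>v v = v \<longleftrightarrow> form a v = 0"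
proof
  note aD = is_rootD[OF assms(1)]
  assume "s *\<^sub>v v = v"
  then have "v - (2 * form a v / form a a) \<cdot>\<^sub>v a = v" using aD(5)[OF assms(2)] by simp
  then have "form a (v - (2 * form a v / form a a) \<cdot>\<^sub>v a) = form a v" by simp
  then show "form a v = 0" using aD assms(2) by (simp add: form_linear)
next
  note aD = is_rootD[OF assms(1)]
  assume "form a v = 0"
  then show "s *\<^sub>v v = v" using aD(1) aD(5)[OF assms(2)] assms(2) by (auto intro!: eq_vecI)
qed

lemma root_fixed_space:
  assumes "is_root a s"
  shows "fixed_space n s = hyperplane n (dual a)"
  using root_fixed_iff[OF assms] dual_scalar_prod is_rootD(1)[OF assms]
  by (auto simp: fixed_space_def hyperplane_def)

lemma root_negated: "is_root a s \<Longrightarrow> s *\<^sub>v a = - a"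
proof -
  assume a: "is_root a s"
  show ?thesis using is_rootD(4,5)[OF a] is_rootD(1)[OF a] by (auto intro!: eq_vecI)
qed

lemma dual_nonzero:
  assumes "is_root a s"
  shows "dual a \<noteq> 0\<^sub>v n"
proof
  assume "dual a = 0\<^sub>v n"
  then have "form a a = 0" using dual_scalar_prod[of a a] is_rootD[OF assms] by simp
  then show False using is_rootD[OF assms] by simp
qed

lemma root_unique:
  assumes "is_root a s" "is_root a' s'" "s \<in> carrier_mat n n" "s' \<in> carrier_mat n n" "a' = k \<cdot>\<^sub>v a"
  shows "s = s'"
proof (rule mat_eq_by_vec[OF assms(3,4)])
  fix v :: "complex vec" assume v: "v \<in> carrier_vec n"
  note a = is_rootD[OF assms(1)] and a' = is_rootD[OF assms(2)]
  have "k \<noteq> 0" using a' a assms(5) by (auto intro!: eq_vecI)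
  have "form a' v = k * form a v" "form a' a' = k * (k * form a a)"
    using assms(5) a(1) v by (simp_all add: form_linear)
  then have "(2 * form a' v / form a' a') \<cdot>\<^sub>v a' = (2 * form a v / form a a) \<cdot>\<^sub>v a"
    using assms(5) a(4) \<open>k \<noteq> 0\<close> by (simp add: smult_smult_assoc)
  then show "s *\<^sub>v v = s' *\<^sub>v v" using a(5) a'(5) v by simp
qed

text \<open>The equality case of Cauchy-Schwarz: the vector v is real with \<open>form v v\<close> =
  0, hence zero, and the two roots are proportional.\<close>

lemma root_gram:
  assumes "is_root a s" "is_root a' s'" "s \<in> carrier_mat n n" "s' \<in> carrier_mat n n"
    and "form a a * form a' a' = form a a' * form a a'"
  shows "s = s'"
proof -
  note a = is_rootD[OF assms(1)] and a' = is_rootD[OF assms(2)]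
  define v where "v = form a a \<cdot>\<^sub>v a' - form a a' \<cdot>\<^sub>v a"
  have v: "v \<in> carrier_vec n" unfolding v_def using a a' by simp
  have real: "cnj (form x y) = form x y"
    if "x \<in> carrier_vec n" "y \<in> carrier_vec n" "conjugate x = x" "conjugate y = y" for x y
    using form_conjugate[OF that(1,2)] that by simp
  have ci: "cnj (a $ i) = a $ i" "cnj (a' $ i) = a' $ i" if "i < n" for i
    using that a(1,3) a'(1,3) conjugate_fixed_iff by blast+
  have "conjugate v = v"
    unfolding conjugate_fixed_iff[OF v] unfolding v_def
    using a(1) a'(1) real[OF a(1) a(1) a(3) a(3)] real[OF a(1) a'(1) a(3) a'(3)] by (simp add: ci)
  moreover have "form v v = 0"
    unfolding v_def using a(1) a'(1) assms(5) form_comm[of a a']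
    by (simp add: form_linear algebra_simps)
  ultimately have "v = 0\<^sub>v n" using form_real_pos[OF v] by blast
  have "a' = (form a a' / form a a) \<cdot>\<^sub>v a"
  proof (rule eq_vecI)
    fix i assume "i < dim_vec ((form a a' / form a a) \<cdot>\<^sub>v a)"
    then have i: "i < n" using a(1) by simp
    have "v $ i = 0" using \<open>v = 0\<^sub>v n\<close> i by simp
    then show "a' $ i = ((form a a' / form a a) \<cdot>\<^sub>v a) $ i"
      using a a' i by (simp add: v_def field_simps)
  qed (use a a' in auto)
  then show ?thesis using root_unique assms(1-4) by blast
qed

text \<open>The component of \<open>a'\<close> orthogonal to a (up to scaling) is fixed by s, hence
  by \<open>s'\<close>, hence orthogonal to \<open>a'\<close> as well. This is the vanishing of the
  Gram determinant.\<close>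

lemma reflection_eq_iff:
  assumes "s \<in> reflections n W" "s' \<in> reflections n W" "fixed_space n s = fixed_space n s'"
  shows "s = s'"
proof -
  obtain a a' where a: "is_root a s" and a': "is_root a' s'"
    using exists_root assms by metis
  note aD = is_rootD[OF a] and aD' = is_rootD[OF a']
  let ?v = "form a a \<cdot>\<^sub>v a' - form a a' \<cdot>\<^sub>v a"
  have v: "?v \<in> carrier_vec n" using aD aD' by simp
  have "form a ?v = 0" using aD aD' by (simp add: form_linear)
  then have "?v \<in> fixed_space n s'"
    using root_fixed_iff[OF a v] v assms(3) by (auto simp: fixed_space_def)
  then have "form a' ?v = 0" using root_fixed_iff[OF a' v] by (simp add: fixed_space_def)
  then show ?thesis
    using root_gram[OF a a'] assms reflectionsD aD aD' form_comm[of a a'] by (simp add: form_linear)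
qed

lemma root_reflection:
  assumes "t \<in> W" "is_root a t"
  shows "t \<in> reflections n W"
proof -
  note a = is_rootD[OF assms(2)]
  have "t * t = 1\<^sub>m n"
  proof (rule mat_eq_by_vec)
    fix v :: "complex vec" assume v: "v \<in> carrier_vec n"
    have "(t * t) *\<^sub>v v = t *\<^sub>v (v - (2 * form a v / form a a) \<cdot>\<^sub>v a)"
      using assms v a(5)[OF v] by (simp add: W_mult_vec)
    also have "\<dots> = t *\<^sub>v v + (2 * form a v / form a a) \<cdot>\<^sub>v a"
      using assms a(1) v root_negated[OF assms(2)]
      by (auto simp: W_minus W_smult)
    also have "\<dots> = v" using a(1) v a(5)[OF v] by auto
    finally show "(t * t) *\<^sub>v v = 1\<^sub>m n *\<^sub>v v" using v by simp
  qed (use assms in \<open>auto intro: mult_carrier_mat\<close>)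
  moreover have "fixed_space n t = hyperplane n (dual a)" by (rule root_fixed_space[OF assms(2)])
  ultimately show ?thesis
    using assms W_carrier[OF assms(1)] W_real[OF assms(1)] dual_nonzero[OF assms(2)] dual_carrier
    unfolding reflections_def is_reflection_def by blast
qed

text \<open>The third reflection is the conjugate r s r. Its root r b differs from b by a multiple
  of a, so its hyperplane contains the intersection of the other two. If t were r or s, then r and s
  would commute.\<close>

lemma noncommuting_third:
  assumes r: "r \<in> reflections n W" "is_root a r" and s: "s \<in> reflections n W" "is_root b s"
    and "r * s \<noteq> s * r"
  obtains t c where "t \<in> reflections n W" "t \<noteq> r" "t \<noteq> s" "is_root (b + c \<cdot>\<^sub>v a) t"
proof -
  note rD = reflectionsD[OF r(1)] and sD = reflectionsD[OF s(1)]
  note a = is_rootD[OF r(2)] and b = is_rootD[OF s(2)]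
  define t where "t = r * s * r"
  define c where "c = - (2 * form a b / form a a)"
  have t: "t \<in> W" unfolding t_def using rD sD by simp
  have rb: "r *\<^sub>v b = b + c \<cdot>\<^sub>v a"
    unfolding c_def a(5)[OF b(1)] using a(1) b(1) by auto
  have rbc: "r *\<^sub>v b \<in> carrier_vec n" using rD b by simp
  have rr: "r *\<^sub>v (r *\<^sub>v v) = v" if "v \<in> carrier_vec n" for v
    using that rD by (simp add: W_mult_vec[symmetric])
  have inv: "form (r *\<^sub>v b) v = form b (r *\<^sub>v v)" if v: "v \<in> carrier_vec n" for v
    using form_invariant[OF rD(1) b(1), of "r *\<^sub>v v"] v rD by (simp add: rr)
  have "is_root (r *\<^sub>v b) t"
    unfolding is_root_def
  proof (intro conjI ballI)
    show "r *\<^sub>v b \<noteq> 0\<^sub>v n"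
    proof
      assume "r *\<^sub>v b = 0\<^sub>v n"
      then have "r *\<^sub>v (r *\<^sub>v b) = 0\<^sub>v n" using rD(1) by (auto intro!: eq_vecI)
      then show False using rr b by simp
    qed
    show "conjugate (r *\<^sub>v b) = r *\<^sub>v b" using W_conjugate[OF rD(1) b(1)] b(3) by simp
    fix v :: "complex vec" assume v: "v \<in> carrier_vec n"
    have "t *\<^sub>v v = r *\<^sub>v (s *\<^sub>v (r *\<^sub>v v))"
      unfolding t_def using rD sD v by (simp add: W_mult_vec)
    also have "\<dots> = r *\<^sub>v (r *\<^sub>v v - (2 * form b (r *\<^sub>v v) / form b b) \<cdot>\<^sub>v b)"
      using rD v by (simp add: b(5))
    also have "\<dots> = v - (2 * form b (r *\<^sub>v v) / form b b) \<cdot>\<^sub>v (r *\<^sub>v b)"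
      using rD v b(1) by (simp add: W_minus W_smult rr)
    finally show "t *\<^sub>v v = v - (2 * form (r *\<^sub>v b) v / form (r *\<^sub>v b) (r *\<^sub>v b)) \<cdot>\<^sub>v (r *\<^sub>v b)"
      using inv[OF v] form_invariant[OF rD(1) b(1) b(1)] by simp
  qed (rule rbc)
  moreover have "t \<noteq> r"
  proof
    assume "t = r"
    then have "t * r = 1\<^sub>m n" using rD by simp
    then have "r * s = 1\<^sub>m n"
      unfolding t_def using rD(2,3) sD(2) by (simp add: assoc_mult_mat[of _ n n _ n _ n])
    then have "r * (r * s) = r" using rD by simp
    then have "s = r" using rD(2,3) sD(2) by (simp add: assoc_mult_mat[of _ n n _ n _ n, symmetric])
    then show False using assms(5) by simp
  qed
  moreover have "t \<noteq> s"
  proof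
    assume "t = s"
    then have "t * r = s * r" by simp
    then have "r * s = s * r"
      unfolding t_def using rD(2,3) sD(2) by (simp add: assoc_mult_mat[of _ n n _ n _ n])
    then show False using assms(5) by simp
  qed
  moreover have "t \<in> reflections n W" using root_reflection t calculation(1) by blast
  ultimately show ?thesis using that[of t c] rb by simp
qed

text \<open>Orthogonal projection onto the plane of a and b. The remainder x is orthogonal to both
  roots, and so is its conjugate because the roots are real. The hypothesis is applied to the
  conjugate, since x itself might be isotropic.\<close>

lemma plane_perp:
  assumes "is_root a s" "is_root b t" "s \<in> carrier_mat n n" "t \<in> carrier_mat n n" "s \<noteq> t"
    and v: "v \<in> carrier_vec n"
    and perp: "\<And>x. x \<in> carrier_vec n \<Longrightarrow> form a x = 0 \<Longrightarrow> form b x = 0 \<Longrightarrow> form v x = 0"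
  obtains \<beta> \<gamma> where "v = \<beta> \<cdot>\<^sub>v a + \<gamma> \<cdot>\<^sub>v b"
proof -
  note a = is_rootD[OF assms(1)] and b = is_rootD[OF assms(2)]
  define D where "D = form a a * form b b - form a b * form a b"
  have D: "D \<noteq> 0" using root_gram[OF assms(1-4)] assms(5) by (auto simp: D_def)
  \<comment> \<open>Cramer's rule for the Gram system with right-hand side (\<open>form a v\<close>,
    \<open>form b v\<close>).\<close>
  define \<beta> where "\<beta> = (form b b * form a v - form a b * form b v) / D"
  define \<gamma> where "\<gamma> = (form a a * form b v - form a b * form a v) / D"
  define u where "u = \<beta> \<cdot>\<^sub>v a + \<gamma> \<cdot>\<^sub>v b"
  define x where "x = v - u"
  have u: "u \<in> carrier_vec n" unfolding u_def using a b by simp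
  have x: "x \<in> carrier_vec n" unfolding x_def using u v by simp
  have cx: "conjugate x \<in> carrier_vec n" using x by simp
  have \<beta>: "D * \<beta> = form b b * form a v - form a b * form b v"
    and \<gamma>: "D * \<gamma> = form a a * form b v - form a b * form a v"
    using D by (simp_all add: \<beta>_def \<gamma>_def)
  have "D * (\<beta> * form a a + \<gamma> * form a b) = D * form a v"
    "D * (\<beta> * form a b + \<gamma> * form b b) = D * form b v"
    unfolding distrib_left mult.assoc[symmetric] \<beta> \<gamma> by (simp_all add: D_def algebra_simps)
  then have sol: "\<beta> * form a a + \<gamma> * form a b = form a v" "\<beta> * form a b + \<gamma> * form b b = form b v"
    using D by simp_all
  have ax: "form a x = 0" and bx: "form b x = 0"
    unfolding x_def u_def using a(1) b(1) v sol form_comm[OF b(1) a(1)]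
    by (simp_all add: form_linear)
  have acx: "form a (conjugate x) = 0"
    using form_conjugate[OF a(1) x] ax a(3) by simp
  have bcx: "form b (conjugate x) = 0"
    using form_conjugate[OF b(1) x] bx b(3) by simp
  have "form v (conjugate x) = 0" using perp[OF cx acx bcx] .
  have "form x (conjugate x) = 0"
  proof -
    have "form u (conjugate x) = 0"
      unfolding u_def using acx bcx a(1) b(1) cx by (simp add: form_linear)
    moreover have "form x (conjugate x) = form v (conjugate x) - form u (conjugate x)"
      unfolding x_def by (rule form_minus_left[OF v u]) (use u v in simp)
    ultimately show ?thesis using \<open>form v (conjugate x) = 0\<close> by simp
  qed
  then have "x = 0\<^sub>v n" using form_conjugate_pos[OF x] by blast
  then have "v = u" using vec_minus_eq_zeroD[OF v u] unfolding x_def by simp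
  then show ?thesis using that u_def by blast
qed

lemma form_zero_right: "u \<in> carrier_vec n \<Longrightarrow> form u (0\<^sub>v n) = 0"
proof -
  assume u: "u \<in> carrier_vec n"
  have "0\<^sub>v n = 0 \<cdot>\<^sub>v u" using u by auto
  then have "form u (0\<^sub>v n) = form u (0 \<cdot>\<^sub>v u)" by simp
  then show ?thesis using form_smult_right[OF u u, of 0] by simp
qed

lemma roots_independent:
  assumes "is_root a s" "is_root b t" "s \<in> W" "t \<in> W" "s \<noteq> t"
    and "\<beta> \<cdot>\<^sub>v a + \<gamma> \<cdot>\<^sub>v b = 0\<^sub>v n"
  shows "\<beta> = 0 \<and> \<gamma> = 0"
proof -
  note a = is_rootD[OF assms(1)] and b = is_rootD[OF assms(2)]
  have "form a (\<beta> \<cdot>\<^sub>v a + \<gamma> \<cdot>\<^sub>v b) = 0" "form b (\<beta> \<cdot>\<^sub>v a + \<gamma> \<cdot>\<^sub>v b) = 0"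
    unfolding assms(6) using a(1) b(1) by (simp_all add: form_zero_right)
  then have e: "\<beta> * form a a + \<gamma> * form a b = 0" "\<beta> * form a b + \<gamma> * form b b = 0"
    using a(1) b(1) form_comm[OF b(1) a(1)] by (simp_all add: form_linear)
  define D where "D = form a a * form b b - form a b * form a b"
  have "D \<noteq> 0"
    using root_gram[OF assms(1,2)] assms(3-5) by (auto simp: D_def)
  moreover have "\<beta> * D = (\<beta> * form a a + \<gamma> * form a b) * form b b - (\<beta> * form a b + \<gamma> * form b b) * form a b"
    "\<gamma> * D = (\<beta> * form a b + \<gamma> * form b b) * form a a - (\<beta> * form a a + \<gamma> * form a b) * form a b"
    unfolding D_def by (simp_all add: algebra_simps)
  ultimately show ?thesis unfolding e by simp
qed

end

section \<open>Jets of invariant polynomials\<close>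

lemma coeff_mult_lowest:
  fixes a b :: "'a::comm_ring_1 poly"
  assumes "\<And>i. i < j \<Longrightarrow> coeff a i = 0"
  shows "coeff (a * b) j = coeff a j * coeff b 0"
proof -
  have "coeff (a * b) j = (\<Sum>i\<le>j. coeff a i * coeff b (j - i))" by (rule coeff_mult)
  also have "\<dots> = (\<Sum>i\<in>{j}. coeff a i * coeff b (j - i))"
    by (rule sum.mono_neutral_right) (use assms in \<open>auto simp: order_le_less\<close>)
  finally show ?thesis by simp
qed

text \<open>A cube of a function vanishing at a point has zero 2-jet there, whatever the other
  factor; hence the exponent 3 when 2-jets of invariants are prescribed.\<close>

lemma coeff_cube_zero:
  fixes h :: "'a::comm_ring_1 poly"
  assumes "coeff h 0 = 0" "j \<le> 2"
  shows "coeff (g * h ^ 3) j = 0"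
proof -
  obtain q where q: "h = pCons 0 q" using assms(1) by (cases h) auto
  have "g * h ^ 3 = monom 1 3 * (g * q ^ 3)"
    by (simp add: q power3_eq_cube monom_altdef)
  then show ?thesis using assms(2) by (simp add: coeff_monom_mult)
qed

locale coxeter_invariants = coxeter +
  fixes p :: "nat \<Rightarrow> mpoly"
  assumes basic: "basic_invariants n W p"
begin

lemma insertion_bij: "bij_betw (insertion mconst p) (mpolys n) (invariants n W)"
  using basic by (simp add: basic_invariants_def msubst_eq_insertion)

lemma peval_mlin_comp:
  assumes "f \<in> mpolys n" "w \<in> W" "v \<in> carrier_vec n"
  shows "peval v (mlin_comp n f w) = peval (w *\<^sub>v v) f"
  using assms(1)
proof (induction f rule: mpolys_induct)
  case (var i)
  then show ?case
    using assms(2,3) mconst_hom W_dim[OF assms(2)]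
    by (auto simp: mlin_comp_def msubst_eq_insertion peval.hom_sum peval.hom_mult
        scalar_prod_def atLeast0LessThan)
next
  case (add f g)
  then show ?case using mconst_hom by (simp add: mlin_comp_def msubst_eq_insertion peval.hom_add)
next
  case (mult f g)
  then show ?case using mconst_hom by (simp add: mlin_comp_def msubst_eq_insertion peval.hom_mult)
qed (use mconst_hom in \<open>simp add: mlin_comp_def msubst_eq_insertion\<close>)

lemma mlin_comp_mpolys [simp]: "f \<in> mpolys n \<Longrightarrow> mlin_comp n f w \<in> mpolys n"
  unfolding mlin_comp_def msubst_eq_insertion by (rule insertion_mpolys) auto

lemma line_mlin_comp:
  assumes "f \<in> mpolys n" "w \<in> W" "v \<in> carrier_vec n" "y \<in> carrier_vec n"
  shows "line v y (mlin_comp n f w) = line (w *\<^sub>v v) (w *\<^sub>v y) f"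
proof -
  have "poly (line v y (mlin_comp n f w)) t = poly (line (w *\<^sub>v v) (w *\<^sub>v y) f) t" for t
    using assms by (simp add: poly_line[of _ n] peval_mlin_comp W_add W_smult)
  then show ?thesis by (metis poly_eq_poly_eq_iff ext)
qed

lemma invariants_iff:
  "f \<in> invariants n W \<longleftrightarrow>
    f \<in> mpolys n \<and> (\<forall>w\<in>W. \<forall>v\<in>carrier_vec n. peval (w *\<^sub>v v) f = peval v f)"
proof
  assume "f \<in> invariants n W"
  then show "f \<in> mpolys n \<and> (\<forall>w\<in>W. \<forall>v\<in>carrier_vec n. peval (w *\<^sub>v v) f = peval v f)"
    by (auto simp: invariants_def peval_mlin_comp[symmetric])
next
  assume f: "f \<in> mpolys n \<and> (\<forall>w\<in>W. \<forall>v\<in>carrier_vec n. peval (w *\<^sub>v v) f = peval v f)"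
  then show "f \<in> invariants n W"
    by (auto simp: invariants_def peval_mlin_comp intro!: peval_eqI)
qed

lemma p_invariant: "i < n \<Longrightarrow> p i \<in> invariants n W"
  using bij_betwE[OF insertion_bij] mconst_hom by (metis insertion_mvar mvar_mpolys)

lemma p_mpolys [simp]: "i < n \<Longrightarrow> p i \<in> mpolys n"
  using p_invariant invariants_iff by blast

lemma invariant_obtain:
  assumes "F \<in> invariants n W"
  obtains f where "f \<in> mpolys n" "F = insertion mconst p f"
  using insertion_bij assms unfolding bij_betw_def by blast

text \<open>s fixes v and reverses the line v + t a, so F is an even function of t. Thus a lies in
  the kernel of the Jacobian matrix at every point of its hyperplane.\<close>

lemma reflection_derivative_zero:
  assumes "is_root a s" "s \<in> W" "v \<in> carrier_vec n" "form a v = 0" "F \<in> invariants n W"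
  shows "peval v (dderiv n a F) = 0"
proof -
  note a = is_rootD[OF assms(1)]
  have F: "F \<in> mpolys n" using assms(5) invariants_iff by blast
  have "line v a F = line v a (mlin_comp n F s)"
    using assms(2,5) by (simp add: invariants_def)
  also have "\<dots> = line v (- a) F"
    using line_mlin_comp[OF F assms(2,3) a(1)] root_fixed_iff[OF assms(1,3)] assms(4)
      root_negated[OF assms(1)] by simp
  also have "- a = (-1) \<cdot>\<^sub>v a" by auto
  finally have "line v a F = line v ((-1) \<cdot>\<^sub>v a) F" .
  then have "peval v (dderiv n a F) = peval v (dderiv n ((-1) \<cdot>\<^sub>v a) F)"
    using coeff_line_1[OF F] by metis
  also have "\<dots> = - peval v (dderiv n a F)"
    using a(1) by (simp add: dderiv_smult_vec peval.hom_mult)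
  finally show ?thesis by simp
qed

text \<open>For each w that moves x, some coordinate separates w x from x; the product of the
  corresponding affine functions vanishes on the rest of the orbit but not at x.\<close>

lemma exists_bump:
  assumes "x \<in> carrier_vec n"
  obtains h where "h \<in> mpolys n" "peval x h \<noteq> 0"
    "\<And>w. w \<in> W \<Longrightarrow> w *\<^sub>v x \<noteq> x \<Longrightarrow> peval (w *\<^sub>v x) h = 0"
proof -
  define N where "N = {w \<in> W. w *\<^sub>v x \<noteq> x}"
  have "\<exists>k<n. (w *\<^sub>v x) $ k \<noteq> x $ k" if "w \<in> N" for w
    using that assms W_vec unfolding N_def
    by (metis (mono_tags, lifting) carrier_vecD eq_vecI mem_Collect_eq)
  then obtain k where k: "\<And>w. w \<in> N \<Longrightarrow> k w < n \<and> (w *\<^sub>v x) $ k w \<noteq> x $ k w" by metis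
  define h where "h = (\<Prod>w\<in>N. mvar (k w) - mconst ((w *\<^sub>v x) $ k w))"
  have fin: "finite N" by (simp add: N_def)
  have "h \<in> mpolys n" unfolding h_def using k by auto
  moreover have "peval x h \<noteq> 0"
    unfolding h_def using k fin by (fastforce simp: peval.hom_prod peval.hom_minus)
  moreover have "peval (w *\<^sub>v x) h = 0" if "w \<in> W" "w *\<^sub>v x \<noteq> x" for w
    unfolding h_def using fin that
    by (auto simp: peval.hom_prod peval.hom_minus N_def intro!: prod_zero bexI[of _ w])
  ultimately show ?thesis using that by blast
qed

text \<open>Any jet of order at most two at \<open>x\<close> can be realized, after averaging over the stabilizer
  of \<open>x\<close>, by an invariant: multiply by a function vanishing to third order at the other points
  of the orbit of \<open>x\<close>, and average over \<open>W\<close>.\<close>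

lemma invariant_jet:
  assumes x: "x \<in> carrier_vec n" and G: "G \<in> mpolys n"
  obtains f \<kappa> where "f \<in> mpolys n" "\<kappa> \<noteq> 0" "insertion mconst p f \<in> mpolys n"
    "\<And>y j. y \<in> carrier_vec n \<Longrightarrow> j \<le> 2 \<Longrightarrow>
       (\<And>z i. z \<in> carrier_vec n \<Longrightarrow> i < j \<Longrightarrow> coeff (line x z G) i = 0) \<Longrightarrow>
       coeff (line x y (insertion mconst p f)) j =
         \<kappa> * (\<Sum>w\<in>{w\<in>W. w *\<^sub>v x = x}. coeff (line x (w *\<^sub>v y) G) j)"
proof -
  obtain h where h: "h \<in> mpolys n" "peval x h \<noteq> 0"
    "\<And>w. w \<in> W \<Longrightarrow> w *\<^sub>v x \<noteq> x \<Longrightarrow> peval (w *\<^sub>v x) h = 0"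
    using exists_bump[OF x] by blast
  define g where "g = G * h ^ 3"
  have g: "g \<in> mpolys n" unfolding g_def using G h by simp
  define F where "F = (\<Sum>w\<in>W. mlin_comp n g w)"
  have F: "F \<in> mpolys n" unfolding F_def using g by auto
  have "F \<in> invariants n W"
    unfolding invariants_iff
  proof (intro conjI ballI F)
    fix w and v :: "complex vec" assume w: "w \<in> W" and v: "v \<in> carrier_vec n"
    have "peval (w *\<^sub>v v) F = (\<Sum>u\<in>W. peval ((u * w) *\<^sub>v v) g)"
      unfolding F_def peval.hom_sum using w v g by (intro sum.cong) (auto simp: peval_mlin_comp W_mult_vec)
    also have "\<dots> = (\<Sum>u\<in>W. peval (u *\<^sub>v v) g)" by (rule sum_W_translate[OF w])
    also have "\<dots> = peval v F"
      unfolding F_def peval.hom_sum using v g by (intro sum.cong) (auto simp: peval_mlin_comp)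
    finally show "peval (w *\<^sub>v v) F = peval v F" .
  qed
  then obtain f where f: "f \<in> mpolys n" "F = insertion mconst p f" using invariant_obtain by blast
  have key: "coeff (line x y F) j =
      peval x h ^ 3 * (\<Sum>w\<in>{w\<in>W. w *\<^sub>v x = x}. coeff (line x (w *\<^sub>v y) G) j)"
    if y: "y \<in> carrier_vec n" and j: "j \<le> 2"
      and low: "\<And>z i. z \<in> carrier_vec n \<Longrightarrow> i < j \<Longrightarrow> coeff (line x z G) i = 0" for y j
  proof -
    have *: "line x y F = (\<Sum>w\<in>W. line (w *\<^sub>v x) (w *\<^sub>v y) g)"
      unfolding F_def line.hom_sum using g x y by (intro sum.cong) (auto simp: line_mlin_comp)
    have "coeff (line x y F) j = (\<Sum>w\<in>W. coeff (line (w *\<^sub>v x) (w *\<^sub>v y) g) j)"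
      unfolding * by (rule coeff_sum)
    also have "\<dots> = (\<Sum>w\<in>W. if w *\<^sub>v x = x then peval x h ^ 3 * coeff (line x (w *\<^sub>v y) G) j else 0)"
    proof (rule sum.cong[OF refl])
      fix w assume w: "w \<in> W"
      show "coeff (line (w *\<^sub>v x) (w *\<^sub>v y) g) j =
          (if w *\<^sub>v x = x then peval x h ^ 3 * coeff (line x (w *\<^sub>v y) G) j else 0)"
      proof (cases "w *\<^sub>v x = x")
        case True
        \<comment> \<open>Below degree j the factor from G has no coefficients, so the cube enters
          only through its value at x, which becomes the constant \<kappa>.\<close>
        have "coeff (line x (w *\<^sub>v y) G * line x (w *\<^sub>v y) h ^ 3) j =
            coeff (line x (w *\<^sub>v y) G) j * coeff (line x (w *\<^sub>v y) h ^ 3) 0"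
          by (rule coeff_mult_lowest) (use low w y in auto)
        then show ?thesis
          using True by (simp add: g_def line.hom_mult line.hom_power coeff_0_power mult.commute)
      next
        case False
        then have "coeff (line (w *\<^sub>v x) (w *\<^sub>v y) h) 0 = 0" using h(3)[OF w] by simp
        then have "coeff (line (w *\<^sub>v x) (w *\<^sub>v y) G * line (w *\<^sub>v x) (w *\<^sub>v y) h ^ 3) j = 0"
          using j by (rule coeff_cube_zero)
        then show ?thesis using False by (simp add: g_def line.hom_mult line.hom_power)
      qed
    qed
    also have "\<dots> = peval x h ^ 3 * (\<Sum>w\<in>{w\<in>W. w *\<^sub>v x = x}. coeff (line x (w *\<^sub>v y) G) j)"
      by (simp add: sum.If_cases sum_distrib_left Int_def)
    finally show ?thesis .
  qed
  show ?thesis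
  proof (rule that[OF f(1)])
    show "peval x h ^ 3 \<noteq> 0" using h(2) by simp
    show "insertion mconst p f \<in> mpolys n" using F f(2) by simp
  qed (rule key[unfolded f(2)])
qed

section \<open>Kernel and cokernel of the Jacobian matrix at a point\<close>

abbreviation J :: "mpoly mat" where "J \<equiv> jacobian n p"

lemma J_carrier [simp]: "J \<in> carrier_mat n n"
  by (simp add: jacobian_def)

lemma J_index [simp]: "i < n \<Longrightarrow> j < n \<Longrightarrow> J $$ (i, j) = mderiv j (p i)"
  by (simp add: jacobian_def)

lemma card_stabilizer: "card {w \<in> W. w *\<^sub>v x = x} \<noteq> 0" if "x \<in> carrier_vec n"
proof -
  have "1\<^sub>m n \<in> {w \<in> W. w *\<^sub>v x = x}" using that by simp
  then show ?thesis by (metis (no_types, lifting) card_0_eq emptyE finite_W finite_subset mem_Collect_eq subsetI)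
qed

text \<open>The function \<open>form x\<close> minus its value at \<open>x0\<close> is linear to
  first order, and averaging over the stabilizer of \<open>x0\<close> keeps it because that
  stabilizer fixes x. By the chain rule the derivative of the resulting invariant along v combines
  those of the \<open>p i\<close>, all of which are 0.\<close>

lemma jacobian_kernel_perp:
  assumes x0: "x0 \<in> carrier_vec n" and x: "x \<in> carrier_vec n"
    and stab: "\<And>w. w \<in> W \<Longrightarrow> w *\<^sub>v x0 = x0 \<Longrightarrow> w *\<^sub>v x = x"
    and v: "v \<in> carrier_vec n" and ker: "\<And>i. i < n \<Longrightarrow> peval x0 (dderiv n v (p i)) = 0"
  shows "form x v = 0"
proof -
  define G where "G = linform n (dual x) - mconst (form x x0)"
  have G: "G \<in> mpolys n" by (simp add: G_def)
  have lG: "line x0 z G = [:0, form x z:]" if "z \<in> carrier_vec n" for z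
    unfolding G_def line.hom_minus using that x x0 by (simp add: line_linform dual_scalar_prod)
  obtain f \<kappa> where f: "f \<in> mpolys n" "\<kappa> \<noteq> 0" "insertion mconst p f \<in> mpolys n"
    and jet: "\<And>y j. y \<in> carrier_vec n \<Longrightarrow> j \<le> 2 \<Longrightarrow>
       (\<And>z i. z \<in> carrier_vec n \<Longrightarrow> i < j \<Longrightarrow> coeff (line x0 z G) i = 0) \<Longrightarrow>
       coeff (line x0 y (insertion mconst p f)) j =
         \<kappa> * (\<Sum>w\<in>{w\<in>W. w *\<^sub>v x0 = x0}. coeff (line x0 (w *\<^sub>v y) G) j)"
    using invariant_jet[OF x0 G] by blast
  have "form x (w *\<^sub>v v) = form x v" if "w \<in> W" "w *\<^sub>v x0 = x0" for w
    using form_invariant[OF that(1) x v] stab[OF that] by simp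
  then have "coeff (line x0 v (insertion mconst p f)) 1 =
      \<kappa> * (of_nat (card {w \<in> W. w *\<^sub>v x0 = x0}) * form x v)"
    using jet[OF v, of 1] lG v by simp
  moreover have "coeff (line x0 v (insertion mconst p f)) 1 = 0"
    unfolding coeff_line_1[OF f(3)] dderiv_insertion[OF f(1)] peval.hom_sum peval.hom_mult
    using ker by simp
  ultimately show ?thesis using f(2) card_stabilizer[OF x0] by auto
qed

text \<open>An invariant F = f(p) is chosen whose 2-jet at \<open>x0\<close> is a nonzero multiple
  of the quadratic form, and \<open>c i\<close> is the i-th partial derivative of f at
  p(\<open>x0\<close>). The vanishing differential of F puts c in the left kernel; the Hessian of F
  against a kernel vector b involves only the Hessians of the \<open>p i\<close>, weighted with
  c.\<close>

lemma jacobian_cokernel: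
  assumes x0: "x0 \<in> carrier_vec n"
  shows "\<exists>\<kappa> c. \<kappa> \<noteq> 0 \<and>
    (\<forall>y\<in>carrier_vec n. (\<Sum>i<n. c i * peval x0 (dderiv n y (p i))) = 0) \<and>
    (\<forall>y\<in>carrier_vec n. \<forall>b\<in>carrier_vec n. (\<forall>i<n. peval x0 (dderiv n b (p i)) = 0) \<longrightarrow>
      (\<Sum>i<n. c i * peval x0 (dderiv n y (dderiv n b (p i)))) = \<kappa> * form y b)"
proof -
  \<comment> \<open>The function \<open>form (v - x0) (v - x0)\<close> of v, written as a sum of
    squares of the coordinates of w v - w x0.\<close>
  define G where "G = (\<Sum>w\<in>W. \<Sum>i<n. (linform n (row w i) - mconst ((w *\<^sub>v x0) $ i)) ^ 2)"
  have G: "G \<in> mpolys n" unfolding G_def by auto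
  have lG: "line x0 z G = [:0, 0, form z z:]" if z: "z \<in> carrier_vec n" for z
  proof -
    have "line x0 z G = (\<Sum>w\<in>W. \<Sum>i<n. [:0, (w *\<^sub>v z) $ i:] ^ 2)"
      unfolding G_def line.hom_sum line.hom_power line.hom_minus
    proof (intro sum.cong refl)
      fix w i assume "w \<in> W" "i \<in> {..<n}"
      then show "(line x0 z (linform n (row w i)) - line x0 z (mconst ((w *\<^sub>v x0) $ i)))\<^sup>2 =
          [:0, (w *\<^sub>v z) $ i:]\<^sup>2"
        using x0 z by (simp add: line_linform)
    qed
    also have "\<dots> = (\<Sum>w\<in>W. \<Sum>i<n. monom ((w *\<^sub>v z) $ i * (w *\<^sub>v z) $ i) 2)"
      by (intro sum.cong refl) (simp add: power2_eq_square monom_altdef)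
    also have "\<dots> = monom (form z z) 2"
      unfolding form_def using z
      by (auto simp: monom_sum scalar_prod_def atLeast0LessThan intro!: sum.cong)
    finally show ?thesis by (simp add: monom_altdef power2_eq_square)
  qed
  obtain f \<kappa> where f: "f \<in> mpolys n" "\<kappa> \<noteq> 0" "insertion mconst p f \<in> mpolys n"
    and jet: "\<And>y j. y \<in> carrier_vec n \<Longrightarrow> j \<le> 2 \<Longrightarrow>
       (\<And>z i. z \<in> carrier_vec n \<Longrightarrow> i < j \<Longrightarrow> coeff (line x0 z G) i = 0) \<Longrightarrow>
       coeff (line x0 y (insertion mconst p f)) j =
         \<kappa> * (\<Sum>w\<in>{w\<in>W. w *\<^sub>v x0 = x0}. coeff (line x0 (w *\<^sub>v y) G) j)"
    using invariant_jet[OF x0 G] by blast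
  define F where "F = insertion mconst p f"
  define c where "c i = peval x0 (insertion mconst p (mderiv i f))" for i
  define \<mu> where "\<mu> = \<kappa> * of_nat (card {w \<in> W. w *\<^sub>v x0 = x0})"
  have "\<mu> \<noteq> 0" unfolding \<mu>_def using f(2) card_stabilizer[OF x0] by simp
  have c1: "(\<Sum>i<n. c i * peval x0 (dderiv n y (p i))) = 0" if y: "y \<in> carrier_vec n" for y
  proof -
    have "coeff (line x0 y F) 1 = 0"
      unfolding F_def using jet[OF y, of 1] lG y by simp
    then show ?thesis
      unfolding F_def coeff_line_1[OF f(3)] dderiv_insertion[OF f(1)] peval.hom_sum peval.hom_mult c_def .
  qed
  define E where "E y b = peval x0 (dderiv n y (dderiv n b F))" for y b
  \<comment> \<open>The 2 is the Taylor factorial. Elements of the stabilizer preserve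
    \<open>form y y\<close>, so the average only contributes the order of the stabilizer.\<close>
  have diag: "E y y = 2 * \<mu> * form y y" if y: "y \<in> carrier_vec n" for y
  proof -
    have "coeff (line x0 y F) 2 =
        \<kappa> * (\<Sum>w\<in>{w\<in>W. w *\<^sub>v x0 = x0}. coeff (line x0 (w *\<^sub>v y) G) 2)"
      unfolding F_def
      by (rule jet[OF y]) (auto simp: lG less_Suc_eq numeral_2_eq_2)
    also have "(\<Sum>w\<in>{w\<in>W. w *\<^sub>v x0 = x0}. coeff (line x0 (w *\<^sub>v y) G) 2) =
        (\<Sum>w\<in>{w\<in>W. w *\<^sub>v x0 = x0}. form y y)"
      by (intro sum.cong refl) (use y in \<open>auto simp: lG form_invariant numeral_2_eq_2\<close>)
    finally have "coeff (line x0 y F) 2 = \<mu> * form y y" by (simp add: \<mu>_def)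
    then show ?thesis
      unfolding E_def using coeff_line_2[OF f(3), of x0 y, symmetric] by (simp add: F_def)
  qed
  have polar: "E y b = 2 * \<mu> * form y b" if y: "y \<in> carrier_vec n" and b: "b \<in> carrier_vec n" for y b
  proof -
    have "E (y + b) (y + b) = E y y + 2 * E y b + E b b"
      unfolding E_def using y b
      by (simp add: dderiv_add_vec peval.hom_add dderiv_commute[of n b y])
        (simp only: mult_2 peval.hom_add)
    moreover have "form (y + b) (y + b) = form y y + 2 * form y b + form b b"
      using y b form_comm[OF b y] by (simp add: form_linear)
    ultimately have "2 * E y b = 2 * (2 * \<mu> * form y b)"
      using diag[of "y + b"] diag[OF y] diag[OF b] y b by (simp add: distrib_left)
    then show ?thesis by simp
  qed
  have c2: "(\<Sum>i<n. c i * peval x0 (dderiv n y (dderiv n b (p i)))) = 2 * \<mu> * form y b"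
    if y: "y \<in> carrier_vec n" and b: "b \<in> carrier_vec n"
      and kb: "\<And>i. i < n \<Longrightarrow> peval x0 (dderiv n b (p i)) = 0" for y b
  proof -
    \<comment> \<open>Terms in which a coefficient of the chain rule is differentiated carry the
      derivative of \<open>p i\<close> along b at \<open>x0\<close>, which is 0.\<close>
    have "E y b = (\<Sum>i<n. c i * peval x0 (dderiv n y (dderiv n b (p i))))"
      unfolding E_def F_def dderiv_insertion[OF f(1)] dderiv_sum dderiv_mult peval.hom_sum
        peval.hom_add peval.hom_mult c_def using kb by simp
    then show ?thesis using polar[OF y b] by simp
  qed
  have "2 * \<mu> \<noteq> 0" using \<open>\<mu> \<noteq> 0\<close> by simp
  then show ?thesis using c1 c2 by (intro exI[of _ "2 * \<mu>"] exI[of _ c]) simp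
qed

lemma peval_dderiv:
  assumes "y \<in> carrier_vec n"
  shows "peval v (dderiv n y f) = vec n (\<lambda>j. peval v (mderiv j f)) \<bullet> y"
  using assms unfolding dderiv_def peval.hom_sum
  by (simp add: scalar_prod_def atLeast0LessThan peval.hom_mult mult.commute)

lemma peval_J_mult:
  assumes "v \<in> carrier_vec n" "y \<in> carrier_vec n"
  shows "map_mat (peval v) J *\<^sub>v y = vec n (\<lambda>i. peval v (dderiv n y (p i)))"
proof (rule eq_vecI)
  fix i assume "i < dim_vec (vec n (\<lambda>i. peval v (dderiv n y (p i))))"
  then have i: "i < n" by simp
  have "row (map_mat (peval v) J) i = vec n (\<lambda>j. peval v (mderiv j (p i)))"
    using i by (intro eq_vecI) (auto simp: jacobian_def)
  then show "(map_mat (peval v) J *\<^sub>v y) $ i = vec n (\<lambda>i. peval v (dderiv n y (p i))) $ i"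
    using i peval_dderiv[OF assms(2)] by (simp add: jacobian_def)
qed (simp add: jacobian_def)

text \<open>The retraction onto S fixes every entry and commutes with determinants.\<close>

lemma det_mpolys: "A \<in> carrier_mat k k \<Longrightarrow> (\<And>i j. i < k \<Longrightarrow> j < k \<Longrightarrow> A $$ (i, j) \<in> mpolys n) \<Longrightarrow> det A \<in> mpolys n"
proof -
  assume A: "A \<in> carrier_mat k k" "\<And>i j. i < k \<Longrightarrow> j < k \<Longrightarrow> A $$ (i, j) \<in> mpolys n"
  interpret r: comm_ring_hom "mpolys_retract n" by (rule mpolys_retract_hom)
  have "map_mat (mpolys_retract n) A = A"
    using A by (intro eq_matI) (auto simp: mpolys_retract_id)
  then have "mpolys_retract n (det A) = det A" using r.hom_det[of A] by simp
  then show "det A \<in> mpolys n" using mpolys_retract_in by metis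
qed

lemma Delta_mpolys [simp]: "det J \<in> mpolys n"
  by (rule det_mpolys[OF J_carrier]) simp

lemma peval_Delta: "peval v (det J) = det (map_mat (peval v) J)"
  by simp

text \<open>At a generic point of V the stabilizer acts trivially, so a kernel vector of the
  Jacobian matrix there is orthogonal to all of V.\<close>

lemma Delta_nonzero: "det J \<noteq> 0"
proof
  assume "det J = 0"
  have "W \<subseteq> carrier_mat n n" using W_carrier by blast
  moreover have "carrier_vec n \<noteq> ({} :: complex vec set)" using zero_carrier_vec[of n] by blast
  ultimately have "\<exists>x\<in>carrier_vec n. \<forall>w\<in>W. w *\<^sub>v x = x \<longrightarrow> (\<forall>z\<in>carrier_vec n. w *\<^sub>v z = z)"
    by (intro exists_generic[OF finite_W, of n]) auto
  then obtain x0 where x0: "x0 \<in> carrier_vec n"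
    "\<forall>w\<in>W. w *\<^sub>v x0 = x0 \<longrightarrow> (\<forall>z\<in>carrier_vec n. w *\<^sub>v z = z)"
    by blast
  have "det (map_mat (peval x0) J) = 0" using \<open>det J = 0\<close> peval_Delta[of x0] by simp
  then obtain v where v: "v \<in> carrier_vec n" "v \<noteq> 0\<^sub>v n" "map_mat (peval x0) J *\<^sub>v v = 0\<^sub>v n"
    using det_0_iff_vec_prod_zero[of "map_mat (peval x0) J" n] by auto
  have "peval x0 (dderiv n v (p i)) = 0" if "i < n" for i
    using arg_cong[OF v(3), of "\<lambda>u. u $ i"] that peval_J_mult[OF x0(1) v(1)] by simp
  then have "form v x = 0" if "x \<in> carrier_vec n" for x
    using jacobian_kernel_perp[OF x0(1) that _ v(1)] x0(2) that form_comm[OF v(1) that] by simp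
  then show False using form_nondegenerate v by blast
qed

lemma Delta_vanish:
  assumes "is_root a s" "s \<in> W" "v \<in> carrier_vec n" "form a v = 0"
  shows "peval v (det J) = 0"
proof -
  note a = is_rootD[OF assms(1)]
  have "map_mat (peval v) J *\<^sub>v a = 0\<^sub>v n"
    unfolding peval_J_mult[OF assms(3) a(1)]
    using reflection_derivative_zero[OF assms p_invariant] by auto
  then show ?thesis
    unfolding peval_Delta using a det_0_iff_vec_prod_zero[of "map_mat (peval v) J" n] by auto
qed

section \<open>Linear forms of the roots as prime divisors of the discriminant\<close>

definition rootform :: "complex vec \<Rightarrow> mpoly" where
  "rootform a = linform n (dual a)"

lemma rootform_mpolys [simp]: "rootform a \<in> mpolys n"
  by (simp add: rootform_def)

lemma peval_rootform [simp]:
  "a \<in> carrier_vec n \<Longrightarrow> v \<in> carrier_vec n \<Longrightarrow> peval v (rootform a) = form a v"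
  by (simp add: rootform_def dual_scalar_prod)

lemma rootform_dvd_iff:
  assumes "is_root a s" "f \<in> mpolys n"
  shows "rootform a dvd f \<longleftrightarrow> (\<forall>v \<in> carrier_vec n. form a v = 0 \<longrightarrow> peval v f = 0)"
  unfolding rootform_def
  using linform_dvd_iff[OF dual_carrier dual_nonzero[OF assms(1)] assms(2)]
    dual_scalar_prod is_rootD(1)[OF assms(1)] by simp

lemma rootform_prime:
  assumes "is_root a s" "f \<in> mpolys n" "g \<in> mpolys n" "rootform a dvd f * g"
  shows "rootform a dvd f \<or> rootform a dvd g"
  using linform_dvd_mult[OF dual_carrier dual_nonzero[OF assms(1)] assms(2,3)] assms(4)
  by (simp add: rootform_def)

lemma rootform_not_dvd:
  assumes "is_root a s" "is_root b t" "s \<in> carrier_mat n n" "t \<in> carrier_mat n n" "s \<noteq> t"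
  shows "\<not> rootform a dvd rootform b"
proof
  note a = is_rootD[OF assms(1)] and b = is_rootD[OF assms(2)]
  assume dvd: "rootform a dvd rootform b"
  let ?v = "form a a \<cdot>\<^sub>v b - form a b \<cdot>\<^sub>v a"
  have "form a ?v = 0" using a(1) b(1) by (simp add: form_linear)
  then have "form b ?v = 0"
    using dvd rootform_dvd_iff[OF assms(1), of "rootform b"] a(1) b(1) by simp
  then show False
    using root_gram[OF assms(1-4)] assms(5) a(1) b(1) form_comm[OF b(1) a(1)]
    by (simp add: form_linear)
qed

lemma rootform_dvd_Delta:
  assumes "is_root a s" "s \<in> W"
  shows "rootform a dvd det J"
  using rootform_dvd_iff[OF assms(1)] Delta_vanish[OF assms] by simp

end

section \<open>Submaximal minors\<close>

text \<open>A combination of the cofactors of one row is the determinant with that row replaced.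
  Information on many minors is thereby packed into one determinant.\<close>

definition replace_row :: "nat \<Rightarrow> (nat \<Rightarrow> 'a) \<Rightarrow> 'a mat \<Rightarrow> 'a mat" where
  "replace_row i f A = mat (dim_row A) (dim_col A) (\<lambda>(k, m). if k = i then f m else A $$ (k, m))"

lemma replace_row_carrier [simp]: "A \<in> carrier_mat k m \<Longrightarrow> replace_row i f A \<in> carrier_mat k m"
  by (auto simp: replace_row_def)

lemma replace_row_index [simp]:
  "k < dim_row A \<Longrightarrow> m < dim_col A \<Longrightarrow> replace_row i f A $$ (k, m) = (if k = i then f m else A $$ (k, m))"
  by (simp add: replace_row_def)

lemma mat_delete_replace_row: "mat_delete (replace_row i f A) i j = mat_delete A i j"
  by (rule eq_matI) (auto simp: mat_delete_def replace_row_def)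

lemma det_replace_row:
  fixes A :: "'a::comm_ring_1 mat"
  assumes "A \<in> carrier_mat n n" "i < n"
  shows "det (replace_row i f A) = (\<Sum>m<n. f m * cofactor A i m)"
  using laplace_expansion_row[OF replace_row_carrier[OF assms(1)] assms(2), of i f] assms
  by (auto simp: cofactor_def mat_delete_replace_row intro!: sum.cong)

lemma cofactor_orthogonal:
  fixes A :: "'a::comm_ring_1 mat"
  assumes A: "A \<in> carrier_mat n n" and "k < n" "j < n"
  shows "(\<Sum>m<n. A $$ (k, m) * cofactor A j m) = (if k = j then det A else 0)"
proof -
  have "(A * adj_mat A) $$ (k, j) = (det A \<cdot>\<^sub>m 1\<^sub>m n) $$ (k, j)"
    using adj_mat[OF A] by simp
  then show ?thesis
    using A assms(2,3) adj_mat(1)[OF A]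
    by (auto simp: adj_mat_def scalar_prod_def atLeast0LessThan)
qed

text \<open>The cofactor is the determinant of A with row i replaced by the j-th unit covector, and
  that matrix still kills v because \<open>v $ j\<close> is 0.\<close>

lemma cofactor_zero:
  fixes A :: "complex mat"
  assumes A: "A \<in> carrier_mat n n" and v: "v \<in> carrier_vec n" "v \<noteq> 0\<^sub>v n" "A *\<^sub>v v = 0\<^sub>v n"
    and vj: "v $ j = 0" and ij: "i < n" "j < n"
  shows "cofactor A i j = 0"
proof -
  define f where "f m = (if m = j then 1 else 0 :: complex)" for m
  have "replace_row i f A *\<^sub>v v = 0\<^sub>v n"
  proof (rule eq_vecI)
    fix k assume "k < dim_vec (0\<^sub>v n)"
    then have k: "k < n" by simp
    have "(replace_row i f A *\<^sub>v v) $ k = (\<Sum>m<n. (if k = i then f m else A $$ (k, m)) * v $ m)"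
      using k carrier_matD[OF A] carrier_matD[OF replace_row_carrier[OF A]] carrier_vecD[OF v(1)]
      by (simp add: scalar_prod_def atLeast0LessThan)
    also have "\<dots> = 0"
    proof (cases "k = i")
      case True
      then have "(\<Sum>m<n. (if k = i then f m else A $$ (k, m)) * v $ m) = (\<Sum>m<n. if m = j then v $ j else 0)"
        by (intro sum.cong) (auto simp: f_def)
      then show ?thesis using vj ij by simp
    next
      case False
      then show ?thesis
        using arg_cong[OF v(3), of "\<lambda>u. u $ k"] k A v(1) by (simp add: scalar_prod_def atLeast0LessThan)
    qed
    finally show "(replace_row i f A *\<^sub>v v) $ k = 0\<^sub>v n $ k" using k by simp
  qed (use replace_row_carrier[OF A, of i f] in auto)
  then have "det (replace_row i f A) = 0"
    using det_0_iff_vec_prod_zero[OF replace_row_carrier[OF A]] v by blast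
  then have "(\<Sum>m<n. f m * cofactor A i m) = 0"
    using det_replace_row[OF A ij(1)] by simp
  moreover have "(\<Sum>m<n. f m * cofactor A i m) = (\<Sum>m<n. if m = j then cofactor A i j else 0)"
    by (intro sum.cong) (auto simp: f_def)
  ultimately show ?thesis using ij by simp
qed

lemma map_mat_delete: "map_mat h (mat_delete A i j) = mat_delete (map_mat h A) i j"
  by (rule eq_matI) (auto simp: mat_delete_def)

lemma exists_left_kernel:
  fixes A :: "complex mat"
  assumes A: "A \<in> carrier_mat n n" and v: "v \<in> carrier_vec n" "v \<noteq> 0\<^sub>v n" "A *\<^sub>v v = 0\<^sub>v n"
  obtains d where "d \<in> carrier_vec n" "d \<noteq> 0\<^sub>v n" "\<And>j. j < n \<Longrightarrow> (\<Sum>k<n. d $ k * A $$ (k, j)) = 0"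
proof -
  have "det A = 0" using det_0_iff_vec_prod_zero[OF A] v by blast
  then have "det (transpose_mat A) = 0" using A det_transpose by metis
  then obtain d where d: "d \<in> carrier_vec n" "d \<noteq> 0\<^sub>v n" "transpose_mat A *\<^sub>v d = 0\<^sub>v n"
    using det_0_iff_vec_prod_zero[of "transpose_mat A" n] A by auto
  have "(\<Sum>k<n. d $ k * A $$ (k, j)) = 0" if "j < n" for j
    using arg_cong[OF d(3), of "\<lambda>v. v $ j"] A d(1) that
    by (simp add: scalar_prod_def atLeast0LessThan mult.commute)
  then show ?thesis using that d by blast
qed

text \<open>Let \<open>T(t)\<close> be a polynomial family of matrices such that \<open>T(0)\<close> has a two-dimensional
  kernel, spanned by \<open>b\<close> and \<open>b'\<close>.  If the first order term is nonzero as a map from \<open>b\<close> to the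
  cokernel of \<open>T(0)\<close>, then some submaximal minor vanishes to order at most one.  The vector \<open>\<epsilon>\<close>
  separates \<open>b'\<close> from \<open>b\<close>.\<close>

lemma minor_order_one:
  fixes T :: "complex poly mat" and n :: nat
  defines "t0 \<equiv> \<lambda>k j. coeff (T $$ (k, j)) 0" and "t1 \<equiv> \<lambda>k j. coeff (T $$ (k, j)) 1"
  assumes T: "T \<in> carrier_mat n n"
    and b: "b \<in> carrier_vec n" "b \<noteq> 0\<^sub>v n" and b': "b' \<in> carrier_vec n" and \<epsilon>: "\<epsilon> \<in> carrier_vec n"
    and kb: "\<And>k. k < n \<Longrightarrow> (\<Sum>j<n. t0 k j * b $ j) = 0"
    and kb2: "\<And>k. k < n \<Longrightarrow> (\<Sum>j<n. t0 k j * b' $ j) = 0"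
    and \<epsilon>b: "\<epsilon> \<bullet> b = 0" "\<epsilon> \<bullet> b' \<noteq> 0"
    and ker: "\<And>v. v \<in> carrier_vec n \<Longrightarrow> (\<And>k. k < n \<Longrightarrow> (\<Sum>j<n. t0 k j * v $ j) = 0) \<Longrightarrow> \<epsilon> \<bullet> v = 0 \<Longrightarrow>
      \<exists>\<beta>. v = \<beta> \<cdot>\<^sub>v b"
    and c: "\<And>j. j < n \<Longrightarrow> (\<Sum>k<n. c k * t0 k j) = 0"
    and cb: "(\<Sum>k<n. c k * (\<Sum>j<n. t1 k j * b $ j)) \<noteq> 0"
  shows "\<exists>i<n. \<exists>j<n. coeff (det (mat_delete T i j)) 0 \<noteq> 0 \<or> coeff (det (mat_delete T i j)) 1 \<noteq> 0"
proof (rule ccontr)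
  assume contra: "\<not> ?thesis"
  \<comment> \<open>\<beta> pairs a covector with the first-order image of b. The argument assumes
    that all submaximal minors have zero constant and linear terms and produces a vector that
    contradicts \<open>cb\<close>.\<close>
  define \<beta> where "\<beta> e = (\<Sum>k<n. e k * (\<Sum>j<n. t1 k j * b $ j))" for e
  define r0 where "r0 k v = (\<Sum>j<n. t0 k j * v $ j)" for k and v :: "complex vec"
  have swap: "(\<Sum>k<n. e k * r0 k v) = 0"
    if "\<And>j. j < n \<Longrightarrow> (\<Sum>k<n. e k * t0 k j) = 0" for e v
  proof -
    have "(\<Sum>k<n. e k * r0 k v) = (\<Sum>j<n. (\<Sum>k<n. e k * t0 k j) * v $ j)"
      unfolding r0_def sum_distrib_left sum_distrib_right by (subst sum.swap) (simp add: mult_ac)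
    then show ?thesis using that by simp
  qed
  \<comment> \<open>If e annihilates T(0) from the left and \<open>e i\<close> is nonzero, row i of
    T(0) depends on the rows weighted by e.\<close>
  have dep: "r0 i v = 0"
    if "\<And>j. j < n \<Longrightarrow> (\<Sum>k<n. e k * t0 k j) = 0" "i < n" "e i \<noteq> 0"
      "\<And>k. k < n \<Longrightarrow> k \<noteq> i \<Longrightarrow> e k * r0 k v = 0" for e i v
  proof -
    have "(\<Sum>k<n. e k * r0 k v) = (\<Sum>k\<in>{i}. e k * r0 k v)"
      by (rule sum.mono_neutral_right) (use that in auto)
    then show ?thesis using swap[OF that(1)] that(3) by simp
  qed
  obtain i0 where i0: "i0 < n" "c i0 \<noteq> 0"
    using cb by (metis (no_types, lifting) lessThan_iff mult_zero_left sum.neutral)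
  \<comment> \<open>Row \<open>i0\<close> of T(0) is redundant and gives way to \<epsilon>. The new
    matrix still kills b, so it has a left kernel vector d.\<close>
  define M1 where "M1 = replace_row i0 (\<lambda>j. \<epsilon> $ j) (mat n n (\<lambda>(k, j). t0 k j))"
  have M1: "M1 \<in> carrier_mat n n" unfolding M1_def by simp
  have M1_index: "M1 $$ (k, j) = (if k = i0 then \<epsilon> $ j else t0 k j)" if "k < n" "j < n" for k j
    using that by (simp add: M1_def)
  have M1v: "(\<Sum>j<n. M1 $$ (k, j) * v $ j) = (if k = i0 then \<epsilon> \<bullet> v else r0 k v)"
    if "k < n" "v \<in> carrier_vec n" for k v
    using that by (simp add: M1_index r0_def scalar_prod_def atLeast0LessThan)
  have "M1 *\<^sub>v b = 0\<^sub>v n"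
  proof (rule eq_vecI)
    fix k assume "k < dim_vec (0\<^sub>v n)"
    then have k: "k < n" by simp
    have "(M1 *\<^sub>v b) $ k = (\<Sum>j<n. M1 $$ (k, j) * b $ j)"
      using k M1 b by (simp add: scalar_prod_def atLeast0LessThan)
    then show "(M1 *\<^sub>v b) $ k = 0\<^sub>v n $ k"
      using M1v[OF k b(1)] \<epsilon>b(1) kb[OF k] k by (simp add: r0_def)
  qed (use M1 in simp)
  then obtain d where d: "d \<in> carrier_vec n" "d \<noteq> 0\<^sub>v n"
    "\<And>j. j < n \<Longrightarrow> (\<Sum>k<n. d $ k * M1 $$ (k, j)) = 0"
    using exists_left_kernel[OF M1 b] by blast
  \<comment> \<open>Every row of \<open>M1\<close> except \<epsilon> kills \<open>b'\<close>, which
    isolates the entry of d at \<open>i0\<close>. That entry is 0, so d is a second left kernel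
    vector of T(0), independent of c.\<close>
  have "d $ i0 * (\<epsilon> \<bullet> b') = (\<Sum>k\<in>{i0}. d $ k * (\<Sum>j<n. M1 $$ (k, j) * b' $ j))"
    using M1v[OF i0(1) b'] by simp
  also have "\<dots> = (\<Sum>k<n. d $ k * (\<Sum>j<n. M1 $$ (k, j) * b' $ j))"
    by (rule sum.mono_neutral_left) (use M1v[OF _ b'] kb2 i0 in \<open>auto simp: r0_def\<close>)
  also have "\<dots> = (\<Sum>j<n. (\<Sum>k<n. d $ k * M1 $$ (k, j)) * b' $ j)"
    unfolding sum_distrib_left sum_distrib_right by (subst sum.swap) (simp add: mult_ac)
  also have "\<dots> = 0" using d(3) by simp
  finally have di0: "d $ i0 = 0" using \<epsilon>b(2) by simp
  have d0: "(\<Sum>k<n. d $ k * t0 k j) = 0" if "j < n" for j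
  proof -
    have "(\<Sum>k<n. d $ k * t0 k j) = (\<Sum>k<n. d $ k * M1 $$ (k, j))"
      by (intro sum.cong refl) (use that di0 in \<open>auto simp: M1_index\<close>)
    then show ?thesis using d(3)[OF that] by simp
  qed
  \<comment> \<open>The two left kernel vectors give a vector e with nonzero \<beta> and a zero
    entry at a redundant row i: either d with the row \<open>i0\<close>, or c minus a multiple of d
    chosen to cancel one entry.\<close>
  have "\<exists>e i. i < n \<and> e i = 0 \<and> (\<forall>j<n. (\<Sum>k<n. e k * t0 k j) = 0) \<and> \<beta> e \<noteq> 0 \<and>
      (\<forall>v. (\<forall>k<n. k \<noteq> i \<longrightarrow> r0 k v = 0) \<longrightarrow> r0 i v = 0)"
  proof (cases "\<beta> (\<lambda>k. d $ k) = 0")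
    case False
    show ?thesis
      by (rule exI[of _ "\<lambda>k. d $ k"], rule exI[of _ i0]) (use False i0 di0 d0 dep[of c i0] c in auto)
  next
    case True
    obtain k0 where k0: "k0 < n" "d $ k0 \<noteq> 0"
      using d(1,2) by (metis carrier_vecD eq_vecI index_zero_vec)
    define e where "e k = c k - (c k0 / d $ k0) * d $ k" for k
    have "(\<Sum>k<n. e k * t0 k j) = 0" if "j < n" for j
    proof -
      have "(\<Sum>k<n. e k * t0 k j) = (\<Sum>k<n. c k * t0 k j) - (c k0 / d $ k0) * (\<Sum>k<n. d $ k * t0 k j)"
        by (simp add: e_def left_diff_distrib sum_subtractf sum_distrib_left mult.assoc)
      then show ?thesis using c[OF that] d0[OF that] by simp
    qed
    moreover have "\<beta> e = \<beta> c - (c k0 / d $ k0) * \<beta> (\<lambda>k. d $ k)"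
      by (simp add: \<beta>_def e_def left_diff_distrib sum_subtractf sum_distrib_left mult.assoc)
    then have "\<beta> e \<noteq> 0" using True cb by (simp add: \<beta>_def)
    moreover have "e k0 = 0" using k0 by (simp add: e_def)
    ultimately show ?thesis
      by (intro exI[of _ e] exI[of _ k0]) (use k0 d0 dep[of "\<lambda>k. d $ k" k0] in auto)
  qed
  then obtain e i where i: "i < n" "e i = 0" and e: "\<And>j. j < n \<Longrightarrow> (\<Sum>k<n. e k * t0 k j) = 0"
    and \<beta>e: "\<beta> e \<noteq> 0" and rowi: "\<And>v. (\<And>k. k < n \<Longrightarrow> k \<noteq> i \<Longrightarrow> r0 k v = 0) \<Longrightarrow> r0 i v = 0"
    by blast
  obtain j0 where j0: "j0 < n" "e j0 \<noteq> 0"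
    using \<beta>e unfolding \<beta>_def by (metis (no_types, lifting) lessThan_iff mult_zero_left sum.neutral)
  then have "j0 \<noteq> i" using i by auto
  \<comment> \<open>The redundant row i gives way to \<epsilon>. The determinant is a combination of
    submaximal minors of T, so its linear coefficient is 0.\<close>
  define T' where "T' = replace_row i (\<lambda>m. [:\<epsilon> $ m:]) T"
  have T': "T' \<in> carrier_mat n n" unfolding T'_def using T by simp
  have T'_index: "T' $$ (k, m) = (if k = i then [:\<epsilon> $ m:] else T $$ (k, m))" if "k < n" "m < n" for k m
    using that T by (simp add: T'_def)
  have low: "coeff (det T') 1 = 0"
  proof -
    have z: "coeff ([:\<epsilon> $ m:] * cofactor T i m) 1 = 0" if "m < n" for m
    proof -
      have "coeff (cofactor T i m) 1 = 0"
        using contra i(1) that by (cases "even (i + m)") (auto simp: cofactor_def)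
      then show ?thesis by simp
    qed
    show ?thesis
      unfolding T'_def det_replace_row[OF T i(1)] coeff_sum
      by (rule sum.neutral) (metis z lessThan_iff)
  qed
  \<comment> \<open>The combination of the rows of T with weights e has no constant term; r is q /
    t, and its constant term is the first-order part of that combination.\<close>
  define q where "q m = (\<Sum>k<n. [:e k:] * T $$ (k, m))" for m
  define r where "r m = (THE r. q m = pCons 0 r)" for m
  have q: "q m = pCons 0 (r m)" if "m < n" for m
  proof -
    have "coeff (q m) 0 = 0" using e[OF that] by (simp add: q_def coeff_sum t0_def)
    then obtain r' where "q m = pCons 0 r'" by (cases "q m") auto
    then show ?thesis unfolding r_def by simp
  qed
  have r0m: "coeff (r m) 0 = (\<Sum>k<n. e k * t1 k m)" if "m < n" for m
    using arg_cong[OF q[OF that], of "\<lambda>x. coeff x 1"] by (simp add: q_def coeff_sum t1_def)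
  define T'' where "T'' = replace_row j0 r T'"
  have T'': "T'' \<in> carrier_mat n n" unfolding T''_def using T' by simp
  have T''_index: "T'' $$ (k, m) = (if k = j0 then r m else T' $$ (k, m))" if "k < n" "m < n" for k m
    using that T' by (simp add: T''_def)
  \<comment> \<open>Replacing row \<open>j0\<close> by q multiplies the determinant by
    \<open>e j0\<close>: the rows entering q are rows of \<open>T'\<close>, since row i has weight
    0. This transfers the vanishing linear coefficient of \<open>det T'\<close> to
    \<open>det T''\<close> at t = 0.\<close>
  have "pCons 0 (det T'') = [:0, 1:] * (\<Sum>m<n. r m * cofactor T' j0 m)"
    by (simp add: T''_def det_replace_row[OF T' j0(1)])
  also have "\<dots> = (\<Sum>m<n. q m * cofactor T' j0 m)"
    unfolding sum_distrib_left by (intro sum.cong refl) (simp add: q)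
  also have "\<dots> = (\<Sum>k<n. [:e k:] * (\<Sum>m<n. T $$ (k, m) * cofactor T' j0 m))"
    unfolding q_def sum_distrib_left sum_distrib_right by (subst sum.swap) (simp only: mult_ac)
  also have "\<dots> = (\<Sum>k<n. [:e k:] * (\<Sum>m<n. T' $$ (k, m) * cofactor T' j0 m))"
  proof (intro sum.cong refl)
    fix k assume "k \<in> {..<n}"
    then show "[:e k:] * (\<Sum>m<n. T $$ (k, m) * cofactor T' j0 m) =
        [:e k:] * (\<Sum>m<n. T' $$ (k, m) * cofactor T' j0 m)"
      using i by (cases "k = i") (auto simp: T'_index)
  qed
  also have "\<dots> = (\<Sum>k<n. if k = j0 then [:e j0:] * det T' else 0)"
    by (intro sum.cong refl) (auto simp: cofactor_orthogonal[OF T' _ j0(1)])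
  also have "\<dots> = [:e j0:] * det T'" using j0 by simp
  finally have "coeff (pCons 0 (det T'')) 1 = coeff ([:e j0:] * det T') 1" by simp
  then have "coeff (det T'') 0 = 0" using low by simp
  interpret ev: comm_ring_hom "\<lambda>q::complex poly. poly q 0" by (rule poly_eval_hom)
  let ?N = "map_mat (\<lambda>q. poly q 0) T''"
  have N: "?N \<in> carrier_mat n n" using T'' by simp
  have "det ?N = 0" using \<open>coeff (det T'') 0 = 0\<close> ev.hom_det[of T''] by (simp add: poly_0_coeff_0)
  \<comment> \<open>A kernel vector of \<open>T''\<close> at t = 0. The rows lost to r and
    \<epsilon> are recovered from their dependencies, so v lies in the kernel of T(0) and is
    orthogonal to \<epsilon>, hence is a multiple of b; the row r then forces v = 0.\<close>
  then obtain v where v: "v \<in> carrier_vec n" "v \<noteq> 0\<^sub>v n" "?N *\<^sub>v v = 0\<^sub>v n"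
    using det_0_iff_vec_prod_zero[OF N] by blast
  have row: "(\<Sum>m<n. poly (T'' $$ (k, m)) 0 * v $ m) = 0" if "k < n" for k
    using arg_cong[OF v(3), of "\<lambda>u. u $ k"] that T'' v(1)
    by (simp add: scalar_prod_def atLeast0LessThan)
  have others: "r0 k v = 0" if "k < n" "k \<noteq> i" "k \<noteq> j0" for k
    using row[OF that(1)] that by (simp add: T''_index T'_index r0_def t0_def poly_0_coeff_0)
  have \<epsilon>v: "\<epsilon> \<bullet> v = 0"
    using row[OF i(1)] \<open>j0 \<noteq> i\<close> v(1) i(1)
    by (simp add: T''_index T'_index scalar_prod_def atLeast0LessThan)
  have j0v: "(\<Sum>m<n. (\<Sum>k<n. e k * t1 k m) * v $ m) = 0"
    using row[OF j0(1)] j0(1) by (simp add: T''_index poly_0_coeff_0 r0m)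
  have "r0 j0 v = 0"
    by (rule dep[of e]) (use e j0 others i in auto)
  then have "r0 i v = 0" using rowi others by blast
  then have "r0 k v = 0" if "k < n" for k using others \<open>r0 j0 v = 0\<close> that by metis
  then obtain \<gamma> where \<gamma>: "v = \<gamma> \<cdot>\<^sub>v b" using ker[OF v(1) _ \<epsilon>v] by (auto simp: r0_def)
  have "(\<Sum>m<n. (\<Sum>k<n. e k * t1 k m) * v $ m) = \<gamma> * \<beta> e"
    unfolding \<beta>_def sum_distrib_left sum_distrib_right using b(1)
    by (subst sum.swap) (simp add: \<gamma> mult_ac)
  then have "\<gamma> = 0" using j0v \<beta>e by simp
  then show False using v(2) \<gamma> b(1) by auto
qed

context coxeter_invariants
begin

section \<open>The ideal of submaximal minors of the Jacobian matrix\<close>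

definition minor :: "nat \<Rightarrow> nat \<Rightarrow> mpoly" where
  "minor i j = det (mat_delete J i j)"

lemma minor_mpolys [simp]: "i < n \<Longrightarrow> j < n \<Longrightarrow> minor i j \<in> mpolys n"
  unfolding minor_def
  by (rule det_mpolys[of _ "n - 1"])
    (auto simp: mat_delete_def jacobian_def)

text \<open>The ideal of minors lifted from the quotient to S. Explicit combinations make membership
  and evaluation at points direct.\<close>

definition minor_ideal :: "mpoly set" where
  "minor_ideal = {\<Sum>i<n. \<Sum>j<n. s i j * minor i j | s. \<forall>i j. s i j \<in> mpolys n}"

lemma minor_ideal_mpolys: "f \<in> minor_ideal \<Longrightarrow> f \<in> mpolys n"
  by (auto simp: minor_ideal_def intro!: sum_mpolys)

lemma zero_minor_ideal: "0 \<in> minor_ideal"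
  unfolding minor_ideal_def by (auto intro!: exI[of _ "\<lambda>_ _. 0"])

lemma minor_ideal_add: "f \<in> minor_ideal \<Longrightarrow> g \<in> minor_ideal \<Longrightarrow> f + g \<in> minor_ideal"
proof -
  assume "f \<in> minor_ideal" "g \<in> minor_ideal"
  then obtain s t where "f = (\<Sum>i<n. \<Sum>j<n. s i j * minor i j)" "g = (\<Sum>i<n. \<Sum>j<n. t i j * minor i j)"
    "\<forall>i j. s i j \<in> mpolys n" "\<forall>i j. t i j \<in> mpolys n"
    by (auto simp: minor_ideal_def)
  then show ?thesis
    unfolding minor_ideal_def
    by (auto intro!: exI[of _ "\<lambda>i j. s i j + t i j"] simp: distrib_right sum.distrib)
qed

lemma minor_ideal_mult: "f \<in> minor_ideal \<Longrightarrow> g \<in> mpolys n \<Longrightarrow> g * f \<in> minor_ideal"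
proof -
  assume f: "f \<in> minor_ideal" and g: "g \<in> mpolys n"
  then obtain s where "f = (\<Sum>i<n. \<Sum>j<n. s i j * minor i j)" "\<forall>i j. s i j \<in> mpolys n"
    by (auto simp: minor_ideal_def)
  then show ?thesis
    unfolding minor_ideal_def using g
    by (auto intro!: exI[of _ "\<lambda>i j. g * s i j"] simp: sum_distrib_left mult.assoc)
qed

lemma minor_in_ideal:
  assumes "i < n" "j < n"
  shows "minor i j \<in> minor_ideal"
proof -
  have "(\<Sum>m<n. (if k = i \<and> m = j then 1 else 0) * minor k m) = (if k = i then minor i j else 0)" for k
  proof -
    have "(\<Sum>m<n. (if k = i \<and> m = j then 1 else 0) * minor k m) =
        (\<Sum>m<n. if m = j then (if k = i then minor i j else 0) else 0)"
      by (intro sum.cong) auto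
    then show ?thesis using assms by simp
  qed
  then have "(\<Sum>k<n. \<Sum>m<n. (if k = i \<and> m = j then 1 else 0) * minor k m) =
      (\<Sum>k<n. if k = i then minor i j else 0)" by simp
  also have "\<dots> = minor i j" using assms by simp
  finally show ?thesis
    unfolding minor_ideal_def
    by (auto intro!: exI[of _ "\<lambda>k m. if k = i \<and> m = j then 1 else 0"])
qed

lemma minor_ideal_diff: "f \<in> minor_ideal \<Longrightarrow> g \<in> minor_ideal \<Longrightarrow> f - g \<in> minor_ideal"
  using minor_ideal_add[of f "- g"] minor_ideal_mult[of g "- 1"] by simp

lemma minor_ideal_sum: "(\<And>i. i \<in> A \<Longrightarrow> f i \<in> minor_ideal) \<Longrightarrow> sum f A \<in> minor_ideal"
  by (induction A rule: infinite_finite_induct) (auto simp: zero_minor_ideal minor_ideal_add)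

text \<open>At a point of both hyperplanes the Jacobian matrix kills a and b, hence a combination v
  of them with j-th entry 0. If this v is zero, then \<open>a $ j\<close> = 0 and a itself
  serves.\<close>

lemma minor_vanish:
  assumes "is_root a s" "is_root b t" "s \<in> W" "t \<in> W" "s \<noteq> t"
    and x: "x \<in> carrier_vec n" "form a x = 0" "form b x = 0" and ij: "i < n" "j < n"
  shows "peval x (minor i j) = 0"
proof -
  note a = is_rootD[OF assms(1)] and b = is_rootD[OF assms(2)]
  define A where "A = map_mat (peval x) J"
  have A: "A \<in> carrier_mat n n" unfolding A_def by simp
  define v where "v = (b $ j) \<cdot>\<^sub>v a + (- (a $ j)) \<cdot>\<^sub>v b"
  have v: "v \<in> carrier_vec n" unfolding v_def using a b by simp
  have "A *\<^sub>v a = 0\<^sub>v n" "A *\<^sub>v b = 0\<^sub>v n"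
    unfolding A_def peval_J_mult[OF x(1) a(1)] peval_J_mult[OF x(1) b(1)]
    using reflection_derivative_zero[OF assms(1,3) x(1,2) p_invariant]
      reflection_derivative_zero[OF assms(2,4) x(1,3) p_invariant] by auto
  then have Av: "A *\<^sub>v v = 0\<^sub>v n"
    unfolding v_def using A a b
    by (auto simp: mult_add_distrib_mat_vec[of _ n n] mult_mat_vec[of _ n n])
  have vj: "v $ j = 0" unfolding v_def using a(1) b(1) ij by simp
  have "cofactor A i j = 0"
  proof (cases "v = 0\<^sub>v n")
    case False
    then show ?thesis using cofactor_zero[OF A v _ Av vj] ij by blast
  next
    case True
    then have "a $ j = 0" using roots_independent[OF assms(1-5), of "b $ j" "- a $ j"] by (simp add: v_def)
    then show ?thesis using cofactor_zero[OF A a(1,2) \<open>A *\<^sub>v a = 0\<^sub>v n\<close>] ij by blast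
  qed
  then have "det (mat_delete A i j) = 0" by (simp add: cofactor_def)
  then show ?thesis
    unfolding minor_def A_def map_mat_delete[symmetric] by simp
qed


lemma minor_ideal_decomp:
  assumes "is_root a s" "is_root b t" "s \<in> W" "t \<in> W" "s \<noteq> t" "M \<in> minor_ideal"
  obtains g h where "g \<in> mpolys n" "h \<in> mpolys n" "M = rootform a * g + rootform b * h"
proof -
  note a = is_rootD[OF assms(1)] and b = is_rootD[OF assms(2)]
  have M: "M \<in> mpolys n" using assms(6) by (rule minor_ideal_mpolys)
  have nd: "dual b \<noteq> k \<cdot>\<^sub>v dual a" for k
  proof
    assume *: "dual b = k \<cdot>\<^sub>v dual a"
    have "rootform a dvd rootform b"
      unfolding rootform_def * by (simp add: linform_smult[of _ n])
    then show False using rootform_not_dvd[OF assms(1,2)] assms(3-5) by simp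
  qed
  have "peval v M = 0" if "v \<in> carrier_vec n" "dual a \<bullet> v = 0" "dual b \<bullet> v = 0" for v
  proof -
    have "form a v = 0" "form b v = 0" using that a(1) b(1) by (simp_all add: dual_scalar_prod)
    then have "peval v (minor i j) = 0" if "i < n" "j < n" for i j
      using minor_vanish[OF assms(1-5)] that \<open>v \<in> carrier_vec n\<close> by blast
    then show ?thesis
      using assms(6) by (auto simp: minor_ideal_def peval.hom_sum peval.hom_mult)
  qed
  then show ?thesis
    using vanish_codim2[OF dual_carrier dual_nonzero[OF assms(1)] dual_carrier nd M] that
    unfolding rootform_def by metis
qed

text \<open>Near a generic point of the intersection of two reflecting hyperplanes, the ideal of
  submaximal minors is the vanishing ideal of this intersection.\<close>

lemma minor_ideal_codim2:
  assumes ra: "is_root a s" and rb: "is_root b t" and st: "s \<in> W" "t \<in> W" "s \<noteq> t"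
  obtains f x where "f \<in> mpolys n" "x \<in> carrier_vec n" "form a x = 0" "form b x = 0" "peval x f \<noteq> 0"
    "f * rootform a \<in> minor_ideal" "f * rootform b \<in> minor_ideal"
proof -
  note a = is_rootD[OF ra] and b = is_rootD[OF rb]
  have sc: "s \<in> carrier_mat n n" "t \<in> carrier_mat n n" using st by auto
  define X where "X = {v \<in> carrier_vec n. form a v = 0 \<and> form b v = 0}"
  have "0\<^sub>v n \<in> X" unfolding X_def using a(1) b(1) by (simp add: form_zero_right)
  moreover have "x + k \<cdot>\<^sub>v z \<in> X" if "x \<in> X" "z \<in> X" for x z k
    using that a(1) b(1) unfolding X_def by (simp add: form_linear)
  moreover have "W \<subseteq> carrier_mat n n" using W_carrier by blast
  ultimately have "\<exists>x\<in>X. \<forall>w\<in>W. w *\<^sub>v x = x \<longrightarrow> (\<forall>z\<in>X. w *\<^sub>v z = z)"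
    by (intro exists_generic[OF finite_W, of n]) (auto simp: X_def)
  then obtain x0 where "x0 \<in> X" and generic: "\<forall>w\<in>W. w *\<^sub>v x0 = x0 \<longrightarrow> (\<forall>z\<in>X. w *\<^sub>v z = z)"
    by blast
  then have x0: "x0 \<in> carrier_vec n" "form a x0 = 0" "form b x0 = 0" by (auto simp: X_def)
  define D where "D y f = peval x0 (dderiv n y f)" for y f
  have Dcomb: "D (\<beta> \<cdot>\<^sub>v a + \<gamma> \<cdot>\<^sub>v b) f = \<beta> * D a f + \<gamma> * D b f" for \<beta> \<gamma> f
    unfolding D_def using a(1) b(1)
    by (simp add: dderiv_add_vec dderiv_smult_vec peval.hom_add peval.hom_mult)
  have kerN: "D (\<beta> \<cdot>\<^sub>v a + \<gamma> \<cdot>\<^sub>v b) (p i) = 0" if "i < n" for \<beta> \<gamma> i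
    unfolding Dcomb
    using reflection_derivative_zero[OF ra st(1) x0(1,2) p_invariant[OF that]]
      reflection_derivative_zero[OF rb st(2) x0(1,3) p_invariant[OF that]] by (simp add: D_def)
  \<comment> \<open>Since the stabilizer of \<open>x0\<close> fixes X pointwise, the kernel of
    \<open>J\<close> at \<open>x0\<close> is orthogonal to X, hence is the plane of a and b.\<close>
  have kerD: "\<exists>\<beta> \<gamma>. v = \<beta> \<cdot>\<^sub>v a + \<gamma> \<cdot>\<^sub>v b"
    if v: "v \<in> carrier_vec n" and k: "\<And>i. i < n \<Longrightarrow> D v (p i) = 0" for v
  proof -
    have "form v x = 0" if "x \<in> carrier_vec n" "form a x = 0" "form b x = 0" for x
    proof -
      have "form x v = 0"
        by (rule jacobian_kernel_perp[OF x0(1) that(1) _ v])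
          (use generic that k in \<open>auto simp: X_def D_def\<close>)
      then show ?thesis using form_comm[OF v that(1)] by simp
    qed
    then show ?thesis using plane_perp[OF ra rb sc st(3) v] by metis
  qed
  obtain \<kappa> c where \<kappa>: "\<kappa> \<noteq> 0"
    and c1': "\<forall>y\<in>carrier_vec n. (\<Sum>i<n. c i * D y (p i)) = 0"
    and c2': "\<forall>y\<in>carrier_vec n. \<forall>b\<in>carrier_vec n. (\<forall>i<n. D b (p i) = 0) \<longrightarrow>
      (\<Sum>i<n. c i * D y (dderiv n b (p i))) = \<kappa> * form y b"
    using jacobian_cokernel[OF x0(1)] unfolding D_def by (elim exE conjE) blast
  have c1: "(\<Sum>i<n. c i * D y (p i)) = 0" if "y \<in> carrier_vec n" for y
    using c1' that by blast
  have c2: "(\<Sum>i<n. c i * D y (dderiv n b (p i))) = \<kappa> * form y b"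
    if "y \<in> carrier_vec n" "b \<in> carrier_vec n" "\<And>i. i < n \<Longrightarrow> D b (p i) = 0" for y b
    using c2' that by blast
  have plane_carrier: "\<beta> \<cdot>\<^sub>v a + \<gamma> \<cdot>\<^sub>v b \<in> carrier_vec n" for \<beta> \<gamma> using a(1) b(1) by simp
  have conj_plane: "conjugate (\<beta> \<cdot>\<^sub>v a + \<gamma> \<cdot>\<^sub>v b) = cnj \<beta> \<cdot>\<^sub>v a + cnj \<gamma> \<cdot>\<^sub>v b" for \<beta> \<gamma>
    using a(1,3) b(1,3) by (simp add: conjugate_add_vec[of _ n] conjugate_smult_vec)
  \<comment> \<open>In every nonzero direction y of this plane some minor has a nonzero derivative
    at \<open>x0\<close>.\<close>
  have minor_D: "\<exists>i<n. \<exists>j<n. D y (minor i j) \<noteq> 0"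
    if y: "y = \<beta> \<cdot>\<^sub>v a + \<gamma> \<cdot>\<^sub>v b" "y \<noteq> 0\<^sub>v n" for y \<beta> \<gamma>
  proof -
    have yc: "y \<in> carrier_vec n" using y(1) plane_carrier by simp
    \<comment> \<open>The conjugate makes \<open>form y u\<close> nonzero, which is the first-order
      pairing that \<open>minor_order_one\<close> requires.\<close>
    define u where "u = conjugate y"
    have u: "u = cnj \<beta> \<cdot>\<^sub>v a + cnj \<gamma> \<cdot>\<^sub>v b" unfolding u_def y(1) by (rule conj_plane)
    have uc: "u \<in> carrier_vec n" "u \<noteq> 0\<^sub>v n" using y yc by (auto simp: u_def)
    \<comment> \<open>z lies in the plane and is orthogonal to u, so \<open>dual z\<close> kills u
      but not the conjugate \<open>z'\<close>. It is the separating vector of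
      \<open>minor_order_one\<close>.\<close>
    define z where "z = form b u \<cdot>\<^sub>v a + (- form a u) \<cdot>\<^sub>v b"
    define z' where "z' = conjugate z"
    have z': "z' = cnj (form b u) \<cdot>\<^sub>v a + cnj (- form a u) \<cdot>\<^sub>v b"
      unfolding z'_def z_def by (rule conj_plane)
    have zc: "z \<in> carrier_vec n" "z' \<in> carrier_vec n" using plane_carrier z' by (simp_all add: z_def)
    have "z \<noteq> 0\<^sub>v n"
    proof
      assume "z = 0\<^sub>v n"
      then have "form b u = 0" "form a u = 0"
        using roots_independent[OF ra rb st, of "form b u" "- form a u"] by (simp_all add: z_def)
      moreover have "form u (conjugate u) = \<beta> * form u a + \<gamma> * form u b"
        using uc(1) a(1) b(1) by (simp add: u_def y(1) form_linear)
      ultimately have "form u (conjugate u) = 0"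
        using form_comm[OF uc(1) a(1)] form_comm[OF uc(1) b(1)] by simp
      then show False using form_conjugate_pos uc by blast
    qed
    have zu: "form z u = 0"
      unfolding z_def using a(1) b(1) uc by (simp add: form_linear)
    have T_sum: "(\<Sum>j<n. coeff (map_mat (line x0 y) J $$ (k, j)) 0 * v $ j) = D v (p k)"
      if "k < n" for k and v
      using that by (simp add: D_def dderiv_def peval.hom_sum peval.hom_mult jacobian_def mult.commute)
    have T_sum1: "(\<Sum>j<n. coeff (map_mat (line x0 y) J $$ (k, j)) 1 * v $ j) = D y (dderiv n v (p k))"
      if "k < n" for k and v
    proof -
      have "dderiv n y (dderiv n v (p k)) = (\<Sum>j<n. mconst (v $ j) * dderiv n y (mderiv j (p k)))"
        unfolding dderiv_def[of n v] dderiv_sum by (simp add: dderiv_mult)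
      then show ?thesis
        using that coeff_line_1[of _ n x0 y]
        by (simp add: D_def peval.hom_sum peval.hom_mult jacobian_def mult.commute)
    qed
    have "\<exists>i<n. \<exists>j<n. coeff (det (mat_delete (map_mat (line x0 y) J) i j)) 0 \<noteq> 0 \<or>
        coeff (det (mat_delete (map_mat (line x0 y) J) i j)) 1 \<noteq> 0"
    proof (rule minor_order_one[where b = u and b' = z' and \<epsilon> = "dual z" and c = c])
      show "dual z \<bullet> u = 0" using zu zc uc by (simp add: dual_scalar_prod)
      show "dual z \<bullet> z' \<noteq> 0"
        using form_conjugate_pos[OF zc(1) \<open>z \<noteq> 0\<^sub>v n\<close>] zc by (simp add: dual_scalar_prod z'_def)
      show "(\<Sum>j<n. coeff (map_mat (line x0 y) J $$ (k, j)) 0 * u $ j) = 0" if "k < n" for k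
        unfolding T_sum[OF that] u by (rule kerN[OF that])
      show "(\<Sum>j<n. coeff (map_mat (line x0 y) J $$ (k, j)) 0 * z' $ j) = 0" if "k < n" for k
        unfolding T_sum[OF that] z' by (rule kerN[OF that])
      show "\<exists>\<delta>. v = \<delta> \<cdot>\<^sub>v u"
        if v: "v \<in> carrier_vec n" "\<And>k. k < n \<Longrightarrow> (\<Sum>j<n. coeff (map_mat (line x0 y) J $$ (k, j)) 0 * v $ j) = 0"
          "dual z \<bullet> v = 0" for v
      proof -
        obtain \<beta>1 \<gamma>1 where v1: "v = \<beta>1 \<cdot>\<^sub>v a + \<gamma>1 \<cdot>\<^sub>v b"
          using kerD[OF v(1)] v(2) T_sum by metis
        have e1: "\<beta>1 * form z a + \<gamma>1 * form z b = 0"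
          using v(3) zc a(1) b(1) v(1) by (simp add: dual_scalar_prod v1 form_linear)
        have e2: "cnj \<beta> * form z a + cnj \<gamma> * form z b = 0"
          using zu zc a(1) b(1) by (simp add: u form_linear)
        have nz: "form z a \<noteq> 0 \<or> form z b \<noteq> 0"
        proof (rule ccontr)
          assume "\<not> ?thesis"
          then have "form z z' = 0" using zc a(1) b(1) by (simp add: z' form_linear)
          then show False using form_conjugate_pos[OF zc(1) \<open>z \<noteq> 0\<^sub>v n\<close>] by (simp add: z'_def)
        qed
        \<comment> \<open>Both coefficient pairs solve one linear equation with coefficients
          \<open>form z a\<close> and \<open>form z b\<close>, not both 0.\<close>
        have proportional: "\<beta>1 * cnj \<gamma> = \<gamma>1 * cnj \<beta>"
        proof -
          have "(\<beta>1 * cnj \<gamma> - \<gamma>1 * cnj \<beta>) * form z a =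
              cnj \<gamma> * (\<beta>1 * form z a + \<gamma>1 * form z b) - \<gamma>1 * (cnj \<beta> * form z a + cnj \<gamma> * form z b)"
            "(\<beta>1 * cnj \<gamma> - \<gamma>1 * cnj \<beta>) * form z b =
              \<beta>1 * (cnj \<beta> * form z a + cnj \<gamma> * form z b) - cnj \<beta> * (\<beta>1 * form z a + \<gamma>1 * form z b)"
            by (simp_all add: algebra_simps)
          then have "(\<beta>1 * cnj \<gamma> - \<gamma>1 * cnj \<beta>) * form z a = 0" "(\<beta>1 * cnj \<gamma> - \<gamma>1 * cnj \<beta>) * form z b = 0"
            unfolding e1 e2 by simp_all
          then show ?thesis using nz by auto
        qed
        have "cnj \<beta> \<noteq> 0 \<or> cnj \<gamma> \<noteq> 0"
        proof (rule ccontr)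
          assume "\<not> ?thesis"
          then have "u = 0\<^sub>v n" using a(1) b(1) by (auto simp: u)
          then show False using uc by simp
        qed
        then show ?thesis
        proof
          assume "cnj \<beta> \<noteq> 0"
          then have "\<beta>1 = \<beta>1 / cnj \<beta> * cnj \<beta>" "\<gamma>1 = \<beta>1 / cnj \<beta> * cnj \<gamma>"
            using proportional by (simp_all add: field_simps)
          then have "v = (\<beta>1 / cnj \<beta>) \<cdot>\<^sub>v u"
            unfolding u v1 using a(1) b(1)
            by (metis smult_add_distrib_vec smult_carrier_vec smult_smult_assoc)
          then show ?thesis by blast
        next
          assume "cnj \<gamma> \<noteq> 0"
          then have "\<beta>1 = \<gamma>1 / cnj \<gamma> * cnj \<beta>" "\<gamma>1 = \<gamma>1 / cnj \<gamma> * cnj \<gamma>"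
            using proportional by (simp_all add: field_simps)
          then have "v = (\<gamma>1 / cnj \<gamma>) \<cdot>\<^sub>v u"
            unfolding u v1 using a(1) b(1)
            by (metis smult_add_distrib_vec smult_carrier_vec smult_smult_assoc)
          then show ?thesis by blast
        qed
      qed
      show "(\<Sum>k<n. c k * coeff (map_mat (line x0 y) J $$ (k, j)) 0) = 0" if "j < n" for j
      proof -
        have "D (unit_vec n j) (p k) = peval x0 (mderiv j (p k))" if "k < n" for k
          unfolding D_def peval_dderiv[OF unit_vec_carrier] using \<open>j < n\<close> by simp
        then have "(\<Sum>k<n. c k * D (unit_vec n j) (p k)) =
            (\<Sum>k<n. c k * coeff (map_mat (line x0 y) J $$ (k, j)) 0)"
          using that by (intro sum.cong) (auto simp: jacobian_def)
        then show ?thesis using c1[of "unit_vec n j"] by simp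
      qed
      have "(\<Sum>k<n. c k * (\<Sum>j<n. coeff (map_mat (line x0 y) J $$ (k, j)) 1 * u $ j)) =
          (\<Sum>k<n. c k * D y (dderiv n u (p k)))"
        by (intro sum.cong refl arg_cong2[of _ _ _ _ "(*)"] T_sum1) simp
      also have "\<dots> = \<kappa> * form y u"
        by (rule c2) (use yc uc kerN in \<open>auto simp: u y(1)\<close>)
      also have "\<dots> \<noteq> 0" using \<kappa> form_conjugate_pos[OF yc y(2)] by (simp add: u_def)
      finally show "(\<Sum>k<n. c k * (\<Sum>j<n. coeff (map_mat (line x0 y) J $$ (k, j)) 1 * u $ j)) \<noteq> 0" .
    qed (use uc zc in simp_all)
    then obtain i j where ij: "i < n" "j < n"
      "coeff (det (mat_delete (map_mat (line x0 y) J) i j)) 0 \<noteq> 0 \<or>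
        coeff (det (mat_delete (map_mat (line x0 y) J) i j)) 1 \<noteq> 0" by blast
    have "det (mat_delete (map_mat (line x0 y) J) i j) = line x0 y (minor i j)"
      unfolding minor_def map_mat_delete[symmetric] by simp
    moreover have "peval x0 (minor i j) = 0"
      by (rule minor_vanish[OF ra rb st x0 ij(1,2)])
    ultimately have "coeff (line x0 y (minor i j)) 1 \<noteq> 0" using ij(3) by simp
    then show ?thesis unfolding D_def using ij(1,2) coeff_line_1[of "minor i j" n x0 y] by auto
  qed
  obtain i1 j1 where ij1: "i1 < n" "j1 < n" "D a (minor i1 j1) \<noteq> 0"
  proof -
    have "a = 1 \<cdot>\<^sub>v a + 0 \<cdot>\<^sub>v b" using a(1) b(1) by auto
    then show ?thesis using minor_D[of a 1 0] a(2) that by blast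
  qed
  let ?M1 = "minor i1 j1"
  \<comment> \<open>The direction in the plane along which the first minor has derivative 0; a
    second minor with nonzero derivative along it has an independent differential.\<close>
  define y2 where "y2 = D b ?M1 \<cdot>\<^sub>v a + (- D a ?M1) \<cdot>\<^sub>v b"
  have y2c: "y2 \<in> carrier_vec n" unfolding y2_def by (rule plane_carrier)
  have "y2 \<noteq> 0\<^sub>v n"
    using roots_independent[OF ra rb st, of "D b ?M1" "- D a ?M1"] ij1(3) by (auto simp: y2_def)
  then obtain i2 j2 where ij2: "i2 < n" "j2 < n" "D y2 (minor i2 j2) \<noteq> 0"
    using minor_D[of y2] y2_def by blast
  let ?M2 = "minor i2 j2"
  obtain g1 h1 where gh1: "g1 \<in> mpolys n" "h1 \<in> mpolys n" "?M1 = rootform a * g1 + rootform b * h1"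
    using minor_ideal_decomp[OF ra rb st minor_in_ideal[OF ij1(1,2)]] by blast
  obtain g2 h2 where gh2: "g2 \<in> mpolys n" "h2 \<in> mpolys n" "?M2 = rootform a * g2 + rootform b * h2"
    using minor_ideal_decomp[OF ra rb st minor_in_ideal[OF ij2(1,2)]] by blast
  have DM: "D y (rootform a * g + rootform b * h) = form a y * peval x0 g + form b y * peval x0 h"
    if "y \<in> carrier_vec n" for y g h
    using that x0 a(1) b(1)
    by (simp add: D_def dderiv_mult peval.hom_add peval.hom_mult rootform_def dderiv_linform
        dual_scalar_prod)
  have "D y2 ?M1 = 0" unfolding y2_def Dcomb by simp
  then have y21: "form a y2 * peval x0 g1 + form b y2 * peval x0 h1 = 0"
    using DM[OF y2c] gh1(3) by simp
  have y22: "form a y2 * peval x0 g2 + form b y2 * peval x0 h2 \<noteq> 0"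
    using DM[OF y2c] gh2(3) ij2(3) by simp
  have a1: "form a a * peval x0 g1 + form b a * peval x0 h1 \<noteq> 0"
    using DM[OF a(1)] gh1(3) ij1(3) by simp
  \<comment> \<open>The determinant of the system expressing the two minors through the root forms.
    Cramer's rule inverts the system up to f, and independence of the differentials keeps f nonzero
    at \<open>x0\<close>.\<close>
  define f where "f = g1 * h2 - g2 * h1"
  have "peval x0 f \<noteq> 0"
  proof
    assume "peval x0 f = 0"
    then have f0: "peval x0 g1 * peval x0 h2 = peval x0 g2 * peval x0 h1"
      by (simp add: f_def peval.hom_minus peval.hom_mult)
    have "peval x0 h1 * (form a y2 * peval x0 g2 + form b y2 * peval x0 h2) =
        form a y2 * (peval x0 g2 * peval x0 h1) + form b y2 * peval x0 h1 * peval x0 h2"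
      by (simp add: algebra_simps)
    also have "\<dots> = peval x0 h2 * (form a y2 * peval x0 g1 + form b y2 * peval x0 h1)"
      unfolding f0[symmetric] by (simp add: algebra_simps)
    finally have h1: "peval x0 h1 = 0" using y21 y22 by simp
    have "peval x0 g1 * (form a y2 * peval x0 g2 + form b y2 * peval x0 h2) =
        form a y2 * peval x0 g1 * peval x0 g2 + form b y2 * (peval x0 g1 * peval x0 h2)"
      by (simp add: algebra_simps)
    also have "\<dots> = peval x0 g2 * (form a y2 * peval x0 g1 + form b y2 * peval x0 h1)"
      unfolding f0 by (simp add: algebra_simps)
    finally have "peval x0 g1 = 0" using y21 y22 by simp
    then show False using a1 h1 by simp
  qed
  moreover have "f * rootform a = h2 * ?M1 - h1 * ?M2" "f * rootform b = g1 * ?M2 - g2 * ?M1"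
    unfolding f_def gh1(3) gh2(3) by (simp_all add: algebra_simps)
  then have "f * rootform a \<in> minor_ideal" "f * rootform b \<in> minor_ideal"
    using gh1 gh2 minor_in_ideal[OF ij1(1,2)] minor_in_ideal[OF ij2(1,2)]
    by (simp_all add: minor_ideal_diff minor_ideal_mult)
  moreover have "f \<in> mpolys n" unfolding f_def using gh1 gh2 by simp
  ultimately show ?thesis using that x0 by blast
qed

end

section \<open>Fractions modulo the discriminant\<close>

context coxeter_invariants
begin

text \<open>A fraction of residue classes is represented by a numerator \<open>a\<close> and a denominator \<open>b\<close> in
  \<open>S\<close>.\<close>

definition regular :: "mpoly \<Rightarrow> bool" where
  "regular b \<longleftrightarrow> b \<in> mpolys n \<and> (\<forall>h\<in>mpolys n. det J dvd h * b \<longrightarrow> det J dvd h)"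

definition polynomial_fraction :: "mpoly \<Rightarrow> mpoly \<Rightarrow> bool" where
  "polynomial_fraction a b \<longleftrightarrow> (\<exists>c\<in>mpolys n. det J dvd a - b * c)"

definition multiplier_fraction :: "mpoly \<Rightarrow> mpoly \<Rightarrow> bool" where
  "multiplier_fraction a b \<longleftrightarrow> (\<forall>M\<in>minor_ideal. \<exists>m\<in>minor_ideal. det J dvd a * M - b * m)"

definition integral_fraction :: "mpoly \<Rightarrow> mpoly \<Rightarrow> bool" where
  "integral_fraction a b \<longleftrightarrow> (\<exists>(d::nat) c. (\<forall>i<d. c i \<in> mpolys n) \<and>
     det J dvd a ^ d + (\<Sum>i<d. c i * a ^ i * b ^ (d - i)))"

lemma rootform_nonzero:
  assumes "is_root a s"
  shows "rootform a \<noteq> 0"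
proof
  note a = is_rootD[OF assms]
  assume "rootform a = 0"
  then have "peval a (rootform a) = 0" by simp
  then show False using a by simp
qed

lemma exists_nonvanishing:
  obtains v where "v \<in> carrier_vec n" "peval v (det J) \<noteq> 0"
  using peval_all_zero[OF Delta_mpolys] Delta_nonzero by blast

lemma rootform_mult_dvd:
  assumes "is_root a s" "f \<in> mpolys n" "k \<in> mpolys n" "rootform a dvd f * k" "\<not> rootform a dvd f"
  shows "\<exists>k'\<in>mpolys n. k = rootform a * k'"
proof -
  have "rootform a dvd k" using rootform_prime[OF assms(1-4)] assms(5) by blast
  then show ?thesis using dvd_mpolys[OF rootform_mpolys assms(3)] by blast
qed

lemma rootform_product_dvd_Delta:
  assumes "is_root a s" "is_root b t" "s \<in> W" "t \<in> W" "s \<noteq> t"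
  obtains E where "E \<in> mpolys n" "det J = rootform a * rootform b * E"
proof -
  obtain k where k: "k \<in> mpolys n" "det J = rootform a * k"
    using dvd_mpolys[OF rootform_mpolys Delta_mpolys rootform_dvd_Delta[OF assms(1,3)]] by blast
  have "\<not> rootform b dvd rootform a"
    using rootform_not_dvd[OF assms(2,1)] assms(3-5) by auto
  moreover have "rootform b dvd rootform a * k" using rootform_dvd_Delta[OF assms(2,4)] k(2) by simp
  ultimately obtain E where "E \<in> mpolys n" "k = rootform b * E"
    using rootform_mult_dvd[OF assms(2) rootform_mpolys k(1)] by blast
  then show ?thesis using that k(2) by (simp add: mult.assoc)
qed

text \<open>Write the discriminant as \<open>\<alpha> \<beta> E\<close> and take a generic linear form \<open>b = \<alpha> + c \<beta>\<close>.  With \<open>f\<close> from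
  the lemma \<open>minor_ideal_codim2\<close>, the fraction \<open>f E \<alpha> / b\<close> multiplies the ideal of minors into itself.\<close>

lemma multiplier_not_polynomial:
  assumes r1: "is_root a1 s1" and r2: "is_root a2 s2" and s: "s1 \<in> W" "s2 \<in> W" "s1 \<noteq> s2"
  shows "\<exists>a b. a \<in> mpolys n \<and> regular b \<and> multiplier_fraction a b \<and> \<not> polynomial_fraction a b"
proof -
  note a1 = is_rootD[OF r1] and a2 = is_rootD[OF r2]
  have sc: "s1 \<in> carrier_mat n n" "s2 \<in> carrier_mat n n" using s by auto
  let ?\<alpha> = "rootform a1" and ?\<beta> = "rootform a2"
  obtain f x where f: "f \<in> mpolys n" and x: "x \<in> carrier_vec n" "form a1 x = 0" "form a2 x = 0"
    and fx: "peval x f \<noteq> 0" and f\<alpha>: "f * ?\<alpha> \<in> minor_ideal"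
    using minor_ideal_codim2[OF r1 r2 s] by metis
  obtain E where E: "E \<in> mpolys n" "det J = ?\<alpha> * ?\<beta> * E"
    using rootform_product_dvd_Delta[OF r1 r2 s] by blast
  obtain v where v: "v \<in> carrier_vec n" "peval v (det J) \<noteq> 0" using exists_nonvanishing by blast
  then have v\<alpha>\<beta>: "form a1 v \<noteq> 0" "form a2 v \<noteq> 0"
    using a1 a2 by (auto simp: E(2) peval.hom_mult)
  \<comment> \<open>Makes b vanish at v, where the discriminant does not, so that b does not divide
    the discriminant.\<close>
  define c where "c = - (form a1 v / form a2 v)"
  have "c \<noteq> 0" using v\<alpha>\<beta> by (simp add: c_def)
  define d where "d = dual a1 + c \<cdot>\<^sub>v dual a2"
  have d: "d \<in> carrier_vec n" by (simp add: d_def)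
  define b where "b = linform n d"
  have b: "b \<in> mpolys n" by (simp add: b_def)
  have b_eq: "b = ?\<alpha> + mconst c * ?\<beta>"
    by (simp add: b_def d_def rootform_def linform_add linform_smult)
  have "d \<noteq> 0\<^sub>v n"
  proof
    assume "d = 0\<^sub>v n"
    then have "b = 0" by (simp add: b_def linform_def)
    then have "?\<alpha> = ?\<beta> * mconst (- c)"
      using b_eq by (simp add: mconst_uminus eq_neg_iff_add_eq_0 mult.commute)
    then have "?\<beta> dvd ?\<alpha>" by (metis dvd_triv_left)
    then show False using rootform_not_dvd[OF r2 r1 sc(2,1)] s(3) by simp
  qed
  have prime: "b dvd g * h \<Longrightarrow> b dvd g \<or> b dvd h" if "g \<in> mpolys n" "h \<in> mpolys n" for g h
    unfolding b_def by (rule linform_dvd_mult[OF d \<open>d \<noteq> 0\<^sub>v n\<close> that])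
  have "peval v b = 0"
    using v a1 a2 v\<alpha>\<beta> by (simp add: b_eq peval.hom_add peval.hom_mult c_def)
  then have b_Delta: "\<not> b dvd det J" using v by (auto simp: peval.hom_mult simp del: peval.hom_det elim!: dvdE)
  have "b \<noteq> 0"
  proof
    assume "b = 0"
    obtain u where "u \<in> carrier_vec n" "d \<bullet> u = 1" using exists_scalar_prod_one[OF d \<open>d \<noteq> 0\<^sub>v n\<close>] .
    then have "peval u b = 1" by (simp add: b_def)
    then show False using \<open>b = 0\<close> by simp
  qed
  have "regular b"
    unfolding regular_def
  proof (intro conjI b ballI impI)
    fix h assume h: "h \<in> mpolys n" "det J dvd h * b"
    then obtain k where k: "k \<in> mpolys n" "h * b = det J * k"
      using dvd_mpolys[OF Delta_mpolys] b by (metis mult_mpolys)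
    then have "b dvd det J * k" by (metis dvd_triv_right)
    then have "b dvd k" using prime[OF Delta_mpolys k(1)] b_Delta by blast
    then obtain k' where "k = b * k'" by blast
    then have "h = det J * k'" using k(2) \<open>b \<noteq> 0\<close> by (simp add: mult_ac)
    then show "det J dvd h" by simp
  qed
  moreover define A where "A = f * E * ?\<alpha>"
  have A: "A \<in> mpolys n" unfolding A_def using f E by simp
  moreover have "multiplier_fraction A b"
    unfolding multiplier_fraction_def
  proof
    fix M assume "M \<in> minor_ideal"
    then obtain g h where gh: "g \<in> mpolys n" "h \<in> mpolys n" "M = ?\<alpha> * g + ?\<beta> * h"
      using minor_ideal_decomp[OF r1 r2 s] by blast
    \<comment> \<open>Modulo \<beta> the denominator is \<alpha> and M is \<alpha> g, which suggests
      f E \<alpha> g as the product; it lies in the ideal because f \<alpha> does.\<close>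
    have "E * g * (f * ?\<alpha>) \<in> minor_ideal" using f\<alpha> E gh by (simp add: minor_ideal_mult)
    moreover have "A * M - b * (E * g * (f * ?\<alpha>)) = det J * (f * (h - mconst c * g))"
      unfolding A_def gh(3) b_eq E(2) by (simp add: algebra_simps)
    ultimately show "\<exists>m\<in>minor_ideal. det J dvd A * M - b * m" by (metis dvd_triv_left)
  qed
  moreover have "\<not> polynomial_fraction A b"
  proof
    assume "polynomial_fraction A b"
    then obtain c' where c': "c' \<in> mpolys n" "det J dvd A - b * c'"
      by (auto simp: polynomial_fraction_def)
    then obtain k where k: "k \<in> mpolys n" "A - b * c' = det J * k"
      using dvd_mpolys[OF Delta_mpolys] A b by (metis diff_mpolys mult_mpolys)
    \<comment> \<open>The prime b does not divide \<alpha> E, so it divides f - \<beta> k. Then f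
      vanishes wherever b and \<beta> do, in particular at x.\<close>
    have "b * c' = ?\<alpha> * E * (f - ?\<beta> * k)"
    proof -
      have "b * c' = A - det J * k" unfolding k(2)[symmetric] by simp
      then show ?thesis unfolding A_def E(2) by (simp add: algebra_simps)
    qed
    then have "b dvd ?\<alpha> * E * (f - ?\<beta> * k)" by (metis dvd_triv_left)
    moreover have "\<not> b dvd ?\<alpha> * E"
    proof
      assume "b dvd ?\<alpha> * E"
      then have "b dvd ?\<beta> * (?\<alpha> * E)" by simp
      then show False using b_Delta by (simp add: E(2) mult_ac)
    qed
    ultimately have "b dvd f - ?\<beta> * k"
      using prime[of "?\<alpha> * E" "f - ?\<beta> * k"] E f k by simp
    then obtain k' where "f - ?\<beta> * k = b * k'" by blast
    then have "peval x (f - ?\<beta> * k) = peval x (b * k')" by simp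
    then have "peval x f = 0"
      using x a1 a2 by (simp add: peval.hom_minus peval.hom_mult peval.hom_add b_eq)
    then show False using fx by simp
  qed
  ultimately show ?thesis by blast
qed

text \<open>Coprimality of g to a power of the prime form, obtained by removing one prime factor at
  a time.\<close>

lemma rootform_power_coprime:
  assumes "is_root a s" "g \<in> mpolys n" "\<not> rootform a dvd g"
  shows "h \<in> mpolys n \<Longrightarrow> g dvd rootform a ^ r * h \<Longrightarrow> g dvd h"
proof (induction r arbitrary: h)
  case (Suc r)
  then have "g dvd rootform a ^ r * (rootform a * h)" by (simp only: power_Suc2 mult.assoc)
  then have "g dvd rootform a * h" using Suc.IH[of "rootform a * h"] Suc.prems by simp
  then obtain k where k: "k \<in> mpolys n" "rootform a * h = g * k"
    using dvd_mpolys[OF assms(2)] Suc.prems by (metis mult_mpolys rootform_mpolys)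
  then have "rootform a dvd g * k" by (metis dvd_triv_left)
  from rootform_mult_dvd[OF assms(1,2) k(1) this assms(3)]
  obtain k' where k': "k = rootform a * k'" by blast
  have "rootform a * h = rootform a * (g * k')" unfolding k(2) k' by (simp only: mult.left_commute)
  then have "h = g * k'" using rootform_nonzero[OF assms(1)] by simp
  then show ?case by simp
qed simp

lemma rootform_power_dvd:
  assumes "is_root a s" "g \<in> mpolys n" "\<not> rootform a dvd g"
  shows "h \<in> mpolys n \<Longrightarrow> rootform a ^ r dvd g * h \<Longrightarrow> rootform a ^ r dvd h"
proof (induction r arbitrary: h)
  case (Suc r)
  then have "rootform a dvd g * h" by (metis dvd_trans dvd_triv_left power_Suc)
  from rootform_mult_dvd[OF assms(1,2) Suc.prems(1) this assms(3)]
  obtain k where k: "k \<in> mpolys n" "h = rootform a * k" by blast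
  have "rootform a * rootform a ^ r dvd rootform a * (g * k)"
    using Suc.prems(2) unfolding k(2) power_Suc by (simp only: mult.left_commute)
  then have "rootform a ^ r dvd g * k" using rootform_nonzero[OF assms(1)] by simp
  then have "rootform a ^ r dvd k" using Suc.IH k(1) by blast
  then show ?case by (simp add: k(2))
qed simp

text \<open>The exponent is bounded: on the line through v in the direction of the root, the form
  becomes a polynomial of degree one and the discriminant a nonzero polynomial, whose degree is the
  bound.\<close>

lemma Delta_multiplicity:
  assumes "is_root a s" "s \<in> W"
  obtains r g where "r > 0" "g \<in> mpolys n" "det J = rootform a ^ r * g" "\<not> rootform a dvd g"
proof -
  note a = is_rootD[OF assms(1)]
  obtain v where v: "v \<in> carrier_vec n" "peval v (det J) \<noteq> 0" using exists_nonvanishing by blast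
  define D where "D = line v a (det J)"
  have "D \<noteq> 0" using v(2) coeff_line_0[of v a "det J"] by (auto simp: D_def simp del: line.hom_det coeff_line_0)
  have line_root: "line v a (rootform a) = [:form a v, form a a:]"
    unfolding rootform_def using a v by (simp add: line_linform dual_scalar_prod)
  have bound: "r \<le> degree D" if r: "rootform a ^ r dvd det J" for r
  proof -
    have "[:form a v, form a a:] ^ r dvd D"
      using r line_root unfolding D_def
      by (metis (no_types, lifting) dvd_def line.hom_mult line.hom_power)
    then have "degree ([:form a v, form a a:] ^ r) \<le> degree D" using \<open>D \<noteq> 0\<close> by (rule dvd_imp_degree_le)
    then show ?thesis using a by (simp add: degree_power_eq)
  qed
  define r where "r = (GREATEST r. rootform a ^ r dvd det J)"
  have ex: "rootform a ^ 1 dvd det J" using rootform_dvd_Delta[OF assms] by simp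
  have r: "rootform a ^ r dvd det J"
    unfolding r_def by (rule GreatestI_nat[where P = "\<lambda>r. rootform a ^ r dvd det J", OF ex bound])
  have max: "k \<le> r" if "rootform a ^ k dvd det J" for k
    unfolding r_def by (rule Greatest_le_nat[where P = "\<lambda>r. rootform a ^ r dvd det J", OF that bound])
  obtain g where g: "g \<in> mpolys n" "det J = rootform a ^ r * g"
    using dvd_mpolys[OF _ Delta_mpolys r] by auto
  have "\<not> rootform a dvd g"
  proof
    assume "rootform a dvd g"
    then have "rootform a ^ Suc r dvd det J" unfolding g(2) by (simp add: mult_dvd_mono mult.commute)
    then show False using max[of "Suc r"] by simp
  qed
  moreover have "r > 0" using max[OF ex] by simp
  ultimately show ?thesis using that g by blast
qed

text \<open>The fraction is the idempotent of the total ring of fractions supported on one of three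
  hyperplanes that contain a common subspace of codimension two.\<close>

lemma integral_not_multiplier:
  assumes r: "r \<in> reflections n W" and s: "s \<in> reflections n W" and nc: "r * s \<noteq> s * r"
  shows "\<exists>a b. a \<in> mpolys n \<and> regular b \<and> integral_fraction a b \<and> \<not> multiplier_fraction a b"
proof -
  obtain a1 where r1: "is_root a1 r" using exists_root[OF r] .
  obtain a2 where r2: "is_root a2 s" using exists_root[OF s] .
  obtain t c where t: "t \<in> reflections n W" "t \<noteq> r" "t \<noteq> s" and r3: "is_root (a2 + c \<cdot>\<^sub>v a1) t"
    using noncommuting_third[OF r r1 s r2 nc] .
  note a1 = is_rootD[OF r1] and a2 = is_rootD[OF r2] and a3 = is_rootD[OF r3]
  have W: "r \<in> W" "s \<in> W" "t \<in> W" using r s t reflectionsD by auto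
  then have car: "r \<in> carrier_mat n n" "s \<in> carrier_mat n n" "t \<in> carrier_mat n n" by auto
  have "r \<noteq> s" using nc by auto
  let ?\<alpha> = "rootform a1" and ?\<beta> = "rootform a2" and ?\<gamma> = "rootform (a2 + c \<cdot>\<^sub>v a1)"
  obtain m g where m: "m > 0" and g: "g \<in> mpolys n" "det J = ?\<alpha> ^ m * g" "\<not> ?\<alpha> dvd g"
    using Delta_multiplicity[OF r1 W(1)] .
  \<comment> \<open>Both other forms divide the cofactor g, so g is a multiple of \<beta>
    \<gamma>.\<close>
  have "?\<beta> dvd ?\<alpha> ^ m * g" using rootform_dvd_Delta[OF r2 W(2)] g(2) by simp
  then have "?\<beta> dvd g"
    using rootform_power_coprime[OF r1 rootform_mpolys _ g(1), of a2 m]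
      rootform_not_dvd[OF r1 r2 car(1,2) \<open>r \<noteq> s\<close>] by blast
  then obtain g' where g': "g' \<in> mpolys n" "g = ?\<beta> * g'"
    using dvd_mpolys[OF rootform_mpolys g(1)] by blast
  have "?\<gamma> dvd ?\<alpha> ^ m * g" using rootform_dvd_Delta[OF r3 W(3)] g(2) by simp
  then have "?\<gamma> dvd g"
    using rootform_power_coprime[OF r1 rootform_mpolys _ g(1), of "a2 + c \<cdot>\<^sub>v a1" m]
      rootform_not_dvd[OF r1 r3 car(1,3)] t(2) by blast
  then have "?\<gamma> dvd ?\<beta> * g'" using g'(2) by simp
  from rootform_mult_dvd[OF r3 rootform_mpolys g'(1) this rootform_not_dvd[OF r3 r2 car(3,2) t(3)]]
  obtain k where k: "k \<in> mpolys n" "g' = ?\<gamma> * k" by blast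
  \<comment> \<open>g / b is 1 modulo \<open>?\<alpha> ^ m\<close> and 0 modulo g, hence idempotent.
    The sum of the two coprime factors shares no prime with the discriminant, which makes b
    regular.\<close>
  define b where "b = g + ?\<alpha> ^ m"
  have b: "b \<in> mpolys n" unfolding b_def using g by simp
  have "regular b"
    unfolding regular_def
  proof (intro conjI b ballI impI)
    fix h assume h: "h \<in> mpolys n" "det J dvd h * b"
    have "?\<alpha> ^ m dvd h * b" "g dvd h * b" using h(2) g(2) by (metis dvd_mult_left dvd_mult_right)+
    then have "?\<alpha> ^ m dvd h * b - ?\<alpha> ^ m * h" "g dvd h * b - g * h"
      by (metis dvd_diff dvd_triv_left)+
    then have "?\<alpha> ^ m dvd g * h" "g dvd ?\<alpha> ^ m * h" by (simp_all add: b_def algebra_simps)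
    then have *: "?\<alpha> ^ m dvd h" "g dvd h"
      using rootform_power_dvd[OF r1 g(1,3) h(1)] rootform_power_coprime[OF r1 g(1,3) h(1)] by blast+
    then obtain k where k: "k \<in> mpolys n" "h = g * k" using dvd_mpolys[OF g(1) h(1)] by blast
    then have "?\<alpha> ^ m dvd k" using rootform_power_dvd[OF r1 g(1,3) k(1)] * by simp
    then show "det J dvd h" unfolding g(2) k(2) by (metis mult.commute mult_dvd_mono dvd_refl)
  qed
  moreover have "integral_fraction g b"
    unfolding integral_fraction_def
  proof (intro exI[of _ "2::nat"] exI[of _ "\<lambda>i. if i = 1 then -1 else 0"] conjI allI impI)
    \<comment> \<open>The equation q^2 - q = 0 with denominators cleared: g^2 - g b = - g
      \<alpha>^m.\<close>
    have "g ^ 2 + (\<Sum>i<2. (if i = 1 then -1 else 0) * g ^ i * b ^ (2 - i)) = - det J"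
      unfolding g(2) b_def by (simp add: numeral_2_eq_2 algebra_simps)
    then show "det J dvd g ^ 2 + (\<Sum>i<2. (if i = 1 then -1 else 0) * g ^ i * b ^ (2 - i))" by simp
  qed auto
  moreover have "\<not> multiplier_fraction g b"
  proof
    assume mult: "multiplier_fraction g b"
    obtain f x where f: "f \<in> mpolys n" and x: "x \<in> carrier_vec n" "form a1 x = 0" "form a2 x = 0"
      and fx: "peval x f \<noteq> 0" and f\<beta>: "f * ?\<beta> \<in> minor_ideal"
      using minor_ideal_codim2[OF r1 r2 W(1,2) \<open>r \<noteq> s\<close>] by metis
    obtain M where M: "M \<in> minor_ideal" "det J dvd g * (f * ?\<beta>) - b * M"
      using mult f\<beta> by (auto simp: multiplier_fraction_def)
    have Mp: "M \<in> mpolys n" using M(1) by (rule minor_ideal_mpolys)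
    have dv: "g dvd g * (f * ?\<beta>) - b * M" "?\<alpha> dvd g * (f * ?\<beta>) - b * M"
      using dvd_trans[OF _ M(2)] rootform_dvd_Delta[OF r1 W(1)] g(2) by simp_all
    \<comment> \<open>Modulo g, the relation says that g divides M.\<close>
    have "g dvd g * (f * ?\<beta> - M) - (g * (f * ?\<beta>) - b * M)"
      by (rule dvd_diff) (use dv in simp_all)
    also have "g * (f * ?\<beta> - M) - (g * (f * ?\<beta>) - b * M) = ?\<alpha> ^ m * M"
      by (simp add: b_def algebra_simps)
    finally have "g dvd M" using rootform_power_coprime[OF r1 g(1,3) Mp] by blast
    then obtain z where z: "z \<in> mpolys n" "M = g * z" using dvd_mpolys[OF g(1) Mp] by blast
    \<comment> \<open>Modulo \<alpha>, it says that f \<beta> and M agree.\<close>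
    have "?\<alpha> dvd (g * (f * ?\<beta>) - b * M) + ?\<alpha> ^ m * M"
      by (rule dvd_add) (use dv m in \<open>simp_all add: dvd_mult2 dvd_power\<close>)
    also have "(g * (f * ?\<beta>) - b * M) + ?\<alpha> ^ m * M = g * (f * ?\<beta> - M)"
      by (simp add: b_def algebra_simps)
    finally have "?\<alpha> dvd g * (f * ?\<beta> - M)" .
    from rootform_mult_dvd[OF r1 g(1) _ this g(3)]
    obtain w where w: "w \<in> mpolys n" "f * ?\<beta> - M = ?\<alpha> * w" using f Mp by auto
    \<comment> \<open>M is a multiple of \<beta> \<gamma>, so cancelling \<beta> leaves f in the
      ideal of \<alpha> and \<gamma>, both of which vanish at x.\<close>
    have wf: "?\<alpha> * w = ?\<beta> * (f - ?\<gamma> * k * z)"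
      unfolding w(2)[symmetric] z(2) g'(2) k(2) by (simp add: algebra_simps)
    then have "?\<beta> dvd ?\<alpha> * w" by (metis dvd_triv_left)
    from rootform_mult_dvd[OF r2 rootform_mpolys w(1) this rootform_not_dvd[OF r2 r1 car(2,1)]]
    obtain w' where w': "w = ?\<beta> * w'" using \<open>r \<noteq> s\<close> by auto
    have "?\<beta> * (f - ?\<gamma> * k * z) = ?\<beta> * (?\<alpha> * w')"
      unfolding wf[symmetric] w' by (simp only: mult.left_commute)
    then have "f - ?\<gamma> * k * z = ?\<alpha> * w'" using rootform_nonzero[OF r2] by simp
    then have "peval x (f - ?\<gamma> * k * z) = peval x (?\<alpha> * w')" by simp
    moreover have "form (a2 + c \<cdot>\<^sub>v a1) x = 0" using x a1(1) a2(1) by (simp add: form_linear)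
    ultimately have "peval x f = 0"
      using x a1(1) a3(1) by (simp add: peval.hom_minus peval.hom_mult)
    then show False using fx by simp
  qed
  ultimately show ?thesis using g(1) by blast
qed

text \<open>The only minor is the determinant of the empty matrix, so the ideal is the whole ring
  and a multiplier is its own value at 1.\<close>

lemma multiplier_iff_polynomial_one:
  assumes "n = 1" "a \<in> mpolys n" "b \<in> mpolys n"
  shows "multiplier_fraction a b \<longleftrightarrow> polynomial_fraction a b"
proof -
  have "minor 0 0 = 1"
    unfolding minor_def by (rule det_dim_zero) (use mat_delete_carrier[OF J_carrier, of 0 0] assms(1) in auto)
  then have one: "1 \<in> minor_ideal" using minor_in_ideal[of 0 0] assms(1) by simp
  show ?thesis
  proof
    assume "multiplier_fraction a b"
    then obtain m where "m \<in> minor_ideal" "det J dvd a * 1 - b * m"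
      using one unfolding multiplier_fraction_def by blast
    then show "polynomial_fraction a b"
      unfolding polynomial_fraction_def using minor_ideal_mpolys by auto
  next
    assume "polynomial_fraction a b"
    then obtain c where c: "c \<in> mpolys n" "det J dvd a - b * c" by (auto simp: polynomial_fraction_def)
    show "multiplier_fraction a b"
      unfolding multiplier_fraction_def
    proof
      fix M assume M: "M \<in> minor_ideal"
      have "det J dvd (a - b * c) * M" using c(2) by simp
      then have "det J dvd a * M - b * (c * M)" by (simp add: algebra_simps)
      then show "\<exists>m\<in>minor_ideal. det J dvd a * M - b * m" using minor_ideal_mult[OF M c(1)] by blast
    qed
  qed
qed

end

section \<open>The polynomial ring is integrally closed\<close>

text \<open>The rational root argument: after division by the gcd, the denominator divides a power
  of a numerator coprime to it and is a unit.\<close>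

lemma complex_poly_integrally_closed:
  fixes A B :: "complex poly"
  assumes "B \<noteq> 0" "A ^ d + (\<Sum>i<d. C i * A ^ i * B ^ (d - i)) = 0"
  shows "B dvd A"
proof -
  define g where "g = gcd A B"
  have g: "g \<noteq> 0" using assms(1) by (simp add: g_def)
  obtain A' B' where AB: "A = A' * g" "B = B' * g" "coprime A' B'"
    using gcd_coprime_exists[of A B] g unfolding g_def by blast
  have "C i * A ^ i * B ^ (d - i) = g ^ d * (C i * A' ^ i * B' ^ (d - i))" if "i < d" for i
  proof -
    have "g ^ d = g ^ i * g ^ (d - i)" using that by (simp flip: power_add)
    then show ?thesis unfolding AB power_mult_distrib by (simp only: mult_ac)
  qed
  then have "(\<Sum>i<d. C i * A ^ i * B ^ (d - i)) = (\<Sum>i<d. g ^ d * (C i * A' ^ i * B' ^ (d - i)))"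
    by (intro sum.cong) simp_all
  then have "A ^ d + (\<Sum>i<d. C i * A ^ i * B ^ (d - i)) =
      g ^ d * (A' ^ d + (\<Sum>i<d. C i * A' ^ i * B' ^ (d - i)))"
    by (simp only: AB(1) power_mult_distrib sum_distrib_left distrib_left mult.commute)
  then have "A' ^ d = - (\<Sum>i<d. C i * A' ^ i * B' ^ (d - i))"
    using assms(2) g by (simp add: eq_neg_iff_add_eq_0)
  moreover have "B' dvd (\<Sum>i<d. C i * A' ^ i * B' ^ (d - i))"
    by (rule dvd_sum) (auto intro!: dvd_mult dvd_power)
  ultimately have "B' dvd A' ^ d" by simp
  moreover have "coprime B' (A' ^ d)" using AB(3) by (simp add: coprime_commute)
  ultimately have "is_unit B'" by (meson coprime_common_divisor dvd_refl)
  then show ?thesis unfolding AB by (simp add: mult_dvd_mono unit_imp_dvd)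
qed

definition monom_degree :: "(nat \<Rightarrow>\<^sub>0 nat) \<Rightarrow> nat" where
  "monom_degree m = (\<Sum>i\<in>Poly_Mapping.keys m. Poly_Mapping.lookup m i)"

lemma monom_degree_superset:
  assumes "finite A" "Poly_Mapping.keys m \<subseteq> A"
  shows "monom_degree m = (\<Sum>i\<in>A. Poly_Mapping.lookup m i)"
  unfolding monom_degree_def
  by (rule sum.mono_neutral_left) (use assms in \<open>auto simp: in_keys_iff\<close>)

lemma monom_degree_add: "monom_degree (m + m') = monom_degree m + monom_degree m'"
proof -
  let ?A = "Poly_Mapping.keys m \<union> Poly_Mapping.keys m'"
  show ?thesis
    using monom_degree_superset[of ?A m] monom_degree_superset[of ?A m']
      monom_degree_superset[of ?A "m + m'"]
    by (simp add: keys_add lookup_add sum.distrib)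
qed

text \<open>\<open>f(x + t y)\<close> as a polynomial in \<open>t\<close> over the ring of polynomials in \<open>x\<close>.\<close>

definition shift :: "complex vec \<Rightarrow> mpoly \<Rightarrow> mpoly poly" where
  "shift y = insertion (\<lambda>c. [:mconst c:]) (\<lambda>i. [:mvar i, mconst (y $ i):])"

lemma mconst_poly_hom: "comm_ring_hom (\<lambda>c. [:mconst c:])"
  by unfold_locales (auto simp: mconst_add mconst_mult one_pCons)

interpretation shift: comm_ring_hom "shift y" for y
  unfolding shift_def by (rule insertion_hom[OF mconst_poly_hom])

lemma mpoly_poly_eval_hom: "comm_ring_hom (\<lambda>p::mpoly poly. poly p t)"
  by unfold_locales auto

lemma shift_at_0: "poly (shift y f) 0 = f"
proof -
  have "poly (shift y f) 0 = insertion mconst mvar f"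
    unfolding shift_def insertion_comp[OF mconst_poly_hom mpoly_poly_eval_hom]
    by (simp add: o_def)
  then show ?thesis by (simp add: insertion_mvar_id)
qed

lemma map_poly_peval_hom: "comm_ring_hom (map_poly (peval v))"
proof
  fix p q :: "mpoly poly"
  show "map_poly (peval v) (p + q) = map_poly (peval v) p + map_poly (peval v) q"
    by (rule poly_eqI) (simp add: coeff_map_poly peval.hom_add)
  show "map_poly (peval v) (p * q) = map_poly (peval v) p * map_poly (peval v) q"
    by (rule poly_eqI) (simp add: coeff_map_poly coeff_mult peval.hom_sum peval.hom_mult)
qed (auto simp: one_pCons map_poly_pCons)

lemma degree_map_poly_peval: "degree (map_poly (peval v) q) \<le> degree q"
  by (rule degree_le) (simp add: coeff_map_poly coeff_eq_0)

lemma map_poly_shift: "map_poly (peval v) (shift y f) = line v y f"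
  unfolding shift_def insertion_comp[OF mconst_poly_hom map_poly_peval_hom] line_def
  by (simp add: o_def map_poly_pCons)

text \<open>In (x + t y)^m the coefficient of the top power of t is y^m. It may be 0, so only a
  bound on the degree is claimed.\<close>

lemma monom_eval_shift:
  "degree (monom_eval (\<lambda>i. [:mvar i, mconst (y $ i):]) m) \<le> monom_degree m \<and>
   coeff (monom_eval (\<lambda>i. [:mvar i, mconst (y $ i):]) m) (monom_degree m) =
     mconst (monom_eval (\<lambda>i. y $ i) m)"
proof (induction m rule: single_induct)
  case zero
  then show ?case by (simp add: monom_degree_def)
next
  case (single_add i k m)
  let ?\<sigma> = "\<lambda>i. [:mvar i, mconst (y $ i):]"
  have deg1: "monom_degree (Poly_Mapping.single i k) = k"
    by (cases "k = 0") (auto simp: monom_degree_def)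
  have ev: "monom_eval \<tau> (Poly_Mapping.single i k) = \<tau> i ^ k" for \<tau> :: "nat \<Rightarrow> 'x::comm_ring_1"
    by (cases "k = 0") (auto simp: monom_eval_def)
  have pow: "degree (?\<sigma> i ^ k) \<le> k \<and> coeff (?\<sigma> i ^ k) k = mconst ((y $ i) ^ k)"
  proof (induction k)
    case (Suc k)
    have "degree (?\<sigma> i) \<le> 1" by simp
    then have "degree (?\<sigma> i * ?\<sigma> i ^ k) \<le> Suc k"
      using degree_mult_le[of "?\<sigma> i" "?\<sigma> i ^ k"] Suc by linarith
    moreover have "coeff (?\<sigma> i * ?\<sigma> i ^ k) (Suc k) = mconst ((y $ i) ^ Suc k)"
      using Suc coeff_eq_0[of "?\<sigma> i ^ k" "Suc k"] by (simp add: mconst_mult)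
    ultimately show ?case by simp
  qed simp
  have "degree (?\<sigma> i ^ k * monom_eval ?\<sigma> m) \<le> k + monom_degree m"
    using degree_mult_le[of "?\<sigma> i ^ k" "monom_eval ?\<sigma> m"] pow single_add by linarith
  moreover have "coeff (?\<sigma> i ^ k * monom_eval ?\<sigma> m) (k + monom_degree m) =
      coeff (?\<sigma> i ^ k) k * coeff (monom_eval ?\<sigma> m) (monom_degree m)"
  proof -
    have "coeff (?\<sigma> i ^ k) j * coeff (monom_eval ?\<sigma> m) (k + monom_degree m - j) = 0"
      if "j \<noteq> k" "j \<le> k + monom_degree m" for j
    proof (cases "j < k")
      case True
      then have "degree (monom_eval ?\<sigma> m) < k + monom_degree m - j"
        using conjunct1[OF single_add] by linarith
      then show ?thesis by (simp add: coeff_eq_0)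
    next
      case False
      then have "k < j" using that by simp
      then show ?thesis using pow by (simp add: coeff_eq_0)
    qed
    then have "(\<Sum>j\<le>k + monom_degree m. coeff (?\<sigma> i ^ k) j * coeff (monom_eval ?\<sigma> m) (k + monom_degree m - j)) =
        (\<Sum>j\<in>{k}. coeff (?\<sigma> i ^ k) j * coeff (monom_eval ?\<sigma> m) (k + monom_degree m - j))"
      by (intro sum.mono_neutral_right) auto
    then show ?thesis by (simp add: coeff_mult)
  qed
  ultimately show ?case
    using pow single_add by (simp add: monom_degree_add deg1 monom_eval_add ev mconst_mult)
qed

text \<open>The change of variables of Noether normalization: y avoids the zero set of the top
  homogeneous part of b, so b(x + t y) has a nonzero constant as leading coefficient in t.
  Specializing x then never lowers the degree.\<close>

lemma shift_lead_coeff: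
  assumes b: "b \<in> mpolys n" "b \<noteq> 0"
  obtains y c where "y \<in> carrier_vec n" "c \<noteq> 0" "lead_coeff (shift y b) = mconst c"
    "\<And>v. degree (line v y b) = degree (shift y b)"
proof -
  define D where "D = Max (monom_degree ` Poly_Mapping.keys b)"
  have ne: "Poly_Mapping.keys b \<noteq> {}" using b by simp
  have le: "monom_degree m \<le> D" if "m \<in> Poly_Mapping.keys b" for m
    unfolding D_def using that by (intro Max_ge) auto
  have "D \<in> monom_degree ` Poly_Mapping.keys b" unfolding D_def by (rule Max_in) (use ne in auto)
  then obtain m0 where m0: "m0 \<in> Poly_Mapping.keys b" "monom_degree m0 = D" by blast
  define T where "T = {m \<in> Poly_Mapping.keys b. monom_degree m = D}"
  define top where "top = (\<Sum>m\<in>T. Poly_Mapping.single m (Poly_Mapping.lookup b m))"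
  have look: "Poly_Mapping.lookup top m = (if m \<in> T then Poly_Mapping.lookup b m else 0)" for m
    unfolding top_def lookup_sum using finite_keys[of b]
    by (simp add: lookup_single when_def T_def sum.delta)
  have "top \<noteq> 0"
  proof
    assume "top = 0"
    then have "Poly_Mapping.lookup b m0 = 0" using look[of m0] m0 by (simp add: T_def)
    then show False using m0 by (simp add: in_keys_iff)
  qed
  moreover have "top \<in> mpolys n"
    unfolding top_def using b(1) by (intro sum_mpolys) (auto simp: mpolys_def T_def)
  ultimately obtain y where y: "y \<in> carrier_vec n" "peval y top \<noteq> 0"
    using peval_all_zero by blast
  let ?\<sigma> = "\<lambda>i. [:mvar i, mconst (y $ i):]"
  have sh: "shift y b = (\<Sum>m\<in>Poly_Mapping.keys b. [:mconst (Poly_Mapping.lookup b m):] * monom_eval ?\<sigma> m)"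
    by (simp add: shift_def insertion_def)
  have deg: "degree (shift y b) \<le> D"
    unfolding sh
  proof (rule degree_sum_le)
    fix m assume "m \<in> Poly_Mapping.keys b"
    then show "degree ([:mconst (Poly_Mapping.lookup b m):] * monom_eval ?\<sigma> m) \<le> D"
      using monom_eval_shift[of y m] le[of m] degree_smult_le by (simp add: order_trans)
  qed simp
  have cD: "coeff (shift y b) D = mconst (peval y top)"
  proof -
    have "coeff (shift y b) D =
        (\<Sum>m\<in>Poly_Mapping.keys b. mconst (Poly_Mapping.lookup b m) * coeff (monom_eval ?\<sigma> m) D)"
      unfolding sh coeff_sum by simp
    also have "\<dots> = (\<Sum>m\<in>T. mconst (Poly_Mapping.lookup b m) * mconst (monom_eval (\<lambda>i. y $ i) m))"
    proof (rule sum.mono_neutral_cong_right)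
      show "\<forall>m\<in>Poly_Mapping.keys b - T. mconst (Poly_Mapping.lookup b m) * coeff (monom_eval ?\<sigma> m) D = 0"
      proof
        fix m assume m: "m \<in> Poly_Mapping.keys b - T"
        then have "monom_degree m < D" using le[of m] by (auto simp: T_def)
        then show "mconst (Poly_Mapping.lookup b m) * coeff (monom_eval ?\<sigma> m) D = 0"
          using monom_eval_shift[of y m] by (simp add: coeff_eq_0)
      qed
    qed (use monom_eval_shift[of y] in \<open>auto simp: T_def\<close>)
    also have "\<dots> = mconst (peval y top)"
      unfolding top_def peval.hom_sum mconst_sum
      by (intro sum.cong refl) (simp add: peval_def insertion_single[OF id_hom] mconst_mult)
    finally show ?thesis .
  qed
  have dD: "degree (shift y b) = D"
    using deg cD y(2) le_degree[of "shift y b" D] by simp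
  have "degree (line v y b) = D" for v
  proof -
    have "coeff (line v y b) D = peval y top"
      unfolding map_poly_shift[symmetric] by (simp add: coeff_map_poly cD)
    moreover have "degree (line v y b) \<le> D"
      unfolding map_poly_shift[symmetric] using degree_map_poly_peval[of v "shift y b"] dD by simp
    ultimately show ?thesis using y(2) le_degree[of "line v y b" D] by simp
  qed
  then show ?thesis using that[OF y(1) y(2)] dD cD by simp
qed

text \<open>Serves the coefficients of a pseudo-remainder, which are only known to lie in the
  ambient ring.\<close>

lemma exists_mpolys: "\<exists>N. f \<in> mpolys N"
proof -
  define A where "A = (\<Union>m\<in>Poly_Mapping.keys f. Poly_Mapping.keys m)"
  have "finite A" by (simp add: A_def)
  then have "A \<subseteq> {..<Suc (Max A)}" by (auto simp: less_Suc_eq_le)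
  then have "f \<in> mpolys (Suc (Max A))" by (auto simp: mpolys_def A_def)
  then show ?thesis by blast
qed

text \<open>Reduction to one variable. Pseudo-division of a(x + t y) by b(x + t y) leaves a
  remainder of smaller degree in t. At each value v of x the one-variable case makes it divisible by
  the specialized b, whose degree is unchanged, so it is 0. Setting t = 0 gives the claim, because
  the multiplier \<open>mconst k ^ e\<close> is a unit.\<close>

lemma mpolys_integrally_closed:
  assumes a: "a \<in> mpolys n" and b: "b \<in> mpolys n" "b \<noteq> 0"
    and int: "a ^ d + (\<Sum>i<d. c i * a ^ i * b ^ (d - i)) = 0"
  shows "b dvd a"
proof -
  obtain y k where y: "y \<in> carrier_vec n" and k: "k \<noteq> 0" "lead_coeff (shift y b) = mconst k"
    and deg: "\<And>v. degree (line v y b) = degree (shift y b)"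
    using shift_lead_coeff[OF b] by metis
  have sb: "shift y b \<noteq> 0" using k by auto
  obtain q r where qr: "pseudo_divmod (shift y a) (shift y b) = (q, r)" by fastforce
  define e where "e = Suc (degree (shift y a)) - degree (shift y b)"
  have div: "smult (mconst k ^ e) (shift y a) = shift y b * q + r" "r = 0 \<or> degree r < degree (shift y b)"
    using pseudo_divmod[OF sb qr] k(2) by (simp_all add: e_def)
  have "map_poly (peval v) r = 0" for v
  proof -
    interpret h: comm_ring_hom "map_poly (peval v)" by (rule map_poly_peval_hom)
    have lb: "line v y b \<noteq> 0"
    proof
      assume "line v y b = 0"
      then have "coeff (map_poly (peval v) (shift y b)) (degree (shift y b)) = 0"
        by (simp add: map_poly_shift)
      then show False using k by (simp add: coeff_map_poly)
    qed
    have "line v y (a ^ d + (\<Sum>i<d. c i * a ^ i * b ^ (d - i))) = 0" unfolding int by simp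
    then have "(line v y a) ^ d + (\<Sum>i<d. line v y (c i) * (line v y a) ^ i * (line v y b) ^ (d - i)) = 0"
      by (simp add: line.hom_add line.hom_sum line.hom_mult line.hom_power)
    then have dvd: "line v y b dvd line v y a" by (rule complex_poly_integrally_closed[OF lb])
    have "smult (mconst k ^ e) (shift y a) = [:mconst k ^ e:] * shift y a" by simp
    then have "map_poly (peval v) [:mconst k ^ e:] * line v y a = line v y b * map_poly (peval v) q + map_poly (peval v) r"
      using arg_cong[OF div(1), of "map_poly (peval v)"] by (simp only: h.hom_mult h.hom_add map_poly_shift)
    then have "map_poly (peval v) r = map_poly (peval v) [:mconst k ^ e:] * line v y a - line v y b * map_poly (peval v) q"
      by simp
    then have dr: "line v y b dvd map_poly (peval v) r" using dvd by simp
    show ?thesis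
    proof (rule ccontr)
      assume nz: "map_poly (peval v) r \<noteq> 0"
      then have "r \<noteq> 0" by auto
      then have "degree r < degree (shift y b)" using div(2) by blast
      then have "degree (map_poly (peval v) r) < degree (line v y b)"
        using degree_map_poly_peval[of v r] deg[of v] by linarith
      then show False using dvd_imp_degree_le[OF dr nz] by simp
    qed
  qed
  then have "peval v (coeff r 0) = 0" for v
    by (metis coeff_map_poly coeff_0 peval.hom_zero)
  moreover obtain N where "coeff r 0 \<in> mpolys N" using exists_mpolys by blast
  ultimately have "coeff r 0 = 0" using peval_all_zero by blast
  then have "poly (smult (mconst k ^ e) (shift y a)) 0 = poly (shift y b * q) 0"
    unfolding div(1) by (simp add: poly_0_coeff_0)
  then have "mconst k ^ e * a = b * poly q 0" by (simp add: shift_at_0)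
  then have "mconst (inverse k) ^ e * (b * poly q 0) = mconst (inverse k) ^ e * (mconst k ^ e * a)" by simp
  also have "\<dots> = mconst (inverse k * k) ^ e * a"
    by (simp only: mconst_mult power_mult_distrib mult.assoc)
  also have "\<dots> = a" using k by simp
  finally show ?thesis by (metis dvd_triv_left mult.left_commute)
qed

section \<open>Groups generated by commuting reflections\<close>

context coxeter
begin

lemma dual_dim [simp]: "dim_vec (dual a) = n"
  by (simp add: dual_def)

definition commuting_reflections :: bool where
  "commuting_reflections \<longleftrightarrow> (\<forall>r\<in>reflections n W. \<forall>s\<in>reflections n W. r * s = s * r)"

lemma finite_reflections [simp]: "finite (reflections n W)"
  by (simp add: reflections_def)

lemma card_arrangement: "card (arrangement n W) = card (reflections n W)"
  unfolding arrangement_def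
  by (rule card_image) (auto intro!: inj_onI reflection_eq_iff)

lemma fixed_by_reflections:
  assumes "v \<in> carrier_vec n" "\<And>s. s \<in> reflections n W \<Longrightarrow> s *\<^sub>v v = v"
  shows "v = 0\<^sub>v n"
proof (rule W_fixed[OF assms(1)])
  fix w assume "w \<in> W"
  then show "w *\<^sub>v v = v"
  proof (induction rule: W_induct)
    case (mult u w)
    then show ?case using assms(1) by (simp add: assoc_mult_mat_vec[of _ n n _ n])
  qed (use assms in auto)
qed

text \<open>By commutation r negates s a, so s a is a multiple of a. But s a is also a minus a
  multiple of b, and independence of the roots makes that multiple 0.\<close>

lemma commuting_orthogonal:
  assumes r: "r \<in> reflections n W" "is_root a r" and s: "s \<in> reflections n W" "is_root b s"
    and "r * s = s * r" "r \<noteq> s"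
  shows "form a b = 0"
proof -
  note rD = reflectionsD[OF r(1)] and sD = reflectionsD[OF s(1)]
  note a = is_rootD[OF r(2)] and b = is_rootD[OF s(2)]
  define k where "k = 2 * form b a / form b b"
  have sa: "s *\<^sub>v a = a - k \<cdot>\<^sub>v b" unfolding k_def by (rule b(5)[OF a(1)])
  define c where "c = form a (s *\<^sub>v a) / form a a"
  have "r *\<^sub>v (s *\<^sub>v a) = s *\<^sub>v (r *\<^sub>v a)"
    using W_mult_vec[OF rD(1) sD(1) a(1)] W_mult_vec[OF sD(1) rD(1) a(1)] assms(5) by simp
  also have "\<dots> = - (s *\<^sub>v a)"
  proof -
    have m: "- x = (-1) \<cdot>\<^sub>v x" for x :: "complex vec" by auto
    show ?thesis unfolding root_negated[OF r(2)] m by (rule W_smult[OF sD(1) a(1)])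
  qed
  finally have neg: "r *\<^sub>v (s *\<^sub>v a) = - (s *\<^sub>v a)" .
  have sac: "s *\<^sub>v a \<in> carrier_vec n" using sD a by simp
  have "s *\<^sub>v a = c \<cdot>\<^sub>v a"
  proof (rule eq_vecI)
    fix i assume "i < dim_vec (c \<cdot>\<^sub>v a)"
    then have i: "i < n" using a(1) by simp
    have "(s *\<^sub>v a - (2 * form a (s *\<^sub>v a) / form a a) \<cdot>\<^sub>v a) $ i = (- (s *\<^sub>v a)) $ i"
      using neg a(5)[OF sac] by simp
    moreover have "(s *\<^sub>v a - (2 * form a (s *\<^sub>v a) / form a a) \<cdot>\<^sub>v a) $ i =
        (s *\<^sub>v a) $ i - 2 * c * a $ i"
      using i a(1) by (simp add: c_def del: index_mult_mat_vec)
    moreover have "(- (s *\<^sub>v a)) $ i = - ((s *\<^sub>v a) $ i)"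
      using i carrier_vecD[OF sac] by (metis index_uminus_vec(1))
    ultimately show "(s *\<^sub>v a) $ i = (c \<cdot>\<^sub>v a) $ i"
      using i a(1) by (simp del: index_mult_mat_vec)
  qed (use a(1) sac sD(1) in auto)
  then have e: "a - k \<cdot>\<^sub>v b = c \<cdot>\<^sub>v a" using sa by simp
  have "(1 - c) \<cdot>\<^sub>v a + (- k) \<cdot>\<^sub>v b = 0\<^sub>v n"
  proof (rule eq_vecI)
    fix i assume "i < dim_vec (0\<^sub>v n)"
    then show "((1 - c) \<cdot>\<^sub>v a + (- k) \<cdot>\<^sub>v b) $ i = 0\<^sub>v n $ i"
      using arg_cong[OF e, of "\<lambda>v. v $ i"] a(1) b(1) by (simp add: algebra_simps)
  qed (use a(1) b(1) in simp)
  then have "- k = 0"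
    using roots_independent[OF r(2) s(2) rD(1) sD(1) assms(6)] by blast
  then have "form b a = 0" using b(4) by (simp add: k_def)
  then show ?thesis using form_comm[OF a(1) b(1)] by simp
qed

lemma orthogonal_independent:
  fixes m :: nat
  assumes "\<And>i. i < m \<Longrightarrow> \<alpha> i \<in> carrier_vec n" "\<And>i. i < m \<Longrightarrow> form (\<alpha> i) (\<alpha> i) \<noteq> 0"
    and orth: "\<And>i j. i < m \<Longrightarrow> j < m \<Longrightarrow> i \<noteq> j \<Longrightarrow> form (\<alpha> i) (\<alpha> j) = 0"
    and z: "\<And>k. k < n \<Longrightarrow> (\<Sum>i<m. \<alpha> i $ k * z i) = 0" and j: "j < m"
  shows "z j = 0"
proof -
  have "(\<Sum>k<n. dual (\<alpha> j) $ k * (\<Sum>i<m. \<alpha> i $ k * z i)) = (\<Sum>i<m. (dual (\<alpha> j) \<bullet> \<alpha> i) * z i)"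
  proof -
    have "(\<Sum>i<m. (dual (\<alpha> j) \<bullet> \<alpha> i) * z i) = (\<Sum>i<m. \<Sum>k<n. dual (\<alpha> j) $ k * (\<alpha> i $ k * z i))"
      using carrier_vecD[OF assms(1)]
      by (intro sum.cong refl) (simp add: scalar_prod_def atLeast0LessThan sum_distrib_right mult.assoc)
    then show ?thesis unfolding sum_distrib_left by (subst sum.swap) simp
  qed
  also have "\<dots> = (\<Sum>i<m. form (\<alpha> j) (\<alpha> i) * z i)"
    using assms(1) j by (intro sum.cong refl) (simp add: dual_scalar_prod)
  also have "\<dots> = (\<Sum>i\<in>{j}. form (\<alpha> j) (\<alpha> i) * z i)"
    by (rule sum.mono_neutral_right) (use orth j in auto)
  finally show ?thesis using z assms(2)[OF j] by simp
qed

lemma det_zero_row: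
  fixes A :: "'a::comm_ring_1 mat"
  assumes "A \<in> carrier_mat k k" "i < k" "\<And>j. j < k \<Longrightarrow> A $$ (i, j) = 0"
  shows "det A = 0"
  using laplace_expansion_row[OF assms(1,2)] assms(3) by simp

text \<open>Indexing by \<open>{..<n}\<close> records that there are as many reflections as
  dimensions, so that the roots form an orthogonal basis.\<close>

definition orthogonal_roots :: "(nat \<Rightarrow> complex mat) \<Rightarrow> (nat \<Rightarrow> complex vec) \<Rightarrow> bool" where
  "orthogonal_roots \<sigma> \<alpha> \<longleftrightarrow> bij_betw \<sigma> {..<n} (reflections n W) \<and>
    (\<forall>i<n. is_root (\<alpha> i) (\<sigma> i)) \<and> (\<forall>i<n. \<forall>j<n. i \<noteq> j \<longrightarrow> form (\<alpha> i) (\<alpha> j) = 0)"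

text \<open>Fewer than n reflections would fix a common nonzero vector, which the absence of W-fixed
  vectors forbids; more than n would give too many orthogonal roots.\<close>

lemma exists_orthogonal_roots:
  assumes commuting_reflections
  shows "\<exists>\<sigma> \<alpha>. orthogonal_roots \<sigma> \<alpha>"
proof -
  let ?R = "reflections n W"
  define m where "m = card ?R"
  obtain \<sigma> where \<sigma>: "bij_betw \<sigma> {..<m} ?R"
    using ex_bij_betw_nat_finite[OF finite_reflections] by (auto simp: m_def atLeast0LessThan)
  then have \<sigma>R: "\<sigma> i \<in> ?R" if "i < m" for i using that by (auto simp: bij_betw_def)
  define \<alpha> where "\<alpha> i = (SOME a. is_root a (\<sigma> i))" for i
  have \<alpha>: "is_root (\<alpha> i) (\<sigma> i)" if "i < m" for i
    unfolding \<alpha>_def using exists_root[OF \<sigma>R[OF that]] by (metis someI)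
  have orth: "form (\<alpha> i) (\<alpha> j) = 0" if "i < m" "j < m" "i \<noteq> j" for i j
  proof (rule commuting_orthogonal[OF \<sigma>R[OF that(1)] \<alpha>[OF that(1)] \<sigma>R[OF that(2)] \<alpha>[OF that(2)]])
    show "\<sigma> i * \<sigma> j = \<sigma> j * \<sigma> i"
      using assms \<sigma>R that by (simp add: commuting_reflections_def)
    show "\<sigma> i \<noteq> \<sigma> j" using \<sigma> that by (auto simp: bij_betw_def inj_on_def)
  qed
  note \<alpha>D = is_rootD[OF \<alpha>]
  have "\<not> m < n"
  proof
    assume mn: "m < n"
    \<comment> \<open>Zero rows pad the linear system to a singular square matrix, which yields a
      nonzero solution.\<close>
    define A where "A = mat n n (\<lambda>(i, j). if i < m then dual (\<alpha> i) $ j else 0)"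
    have A: "A \<in> carrier_mat n n" by (simp add: A_def)
    have "det A = 0" by (rule det_zero_row[OF A mn]) (use mn in \<open>simp add: A_def\<close>)
    then obtain v where v: "v \<in> carrier_vec n" "v \<noteq> 0\<^sub>v n" "A *\<^sub>v v = 0\<^sub>v n"
      using det_0_iff_vec_prod_zero[OF A] by blast
    have "form (\<alpha> i) v = 0" if i: "i < m" for i
    proof -
      have "row A i = dual (\<alpha> i)" using i mn by (intro eq_vecI) (auto simp: A_def)
      then have "dual (\<alpha> i) \<bullet> v = 0"
        using arg_cong[OF v(3), of "\<lambda>u. u $ i"] A i mn by simp
      then show ?thesis using dual_scalar_prod \<alpha>D(1)[OF i] v(1) by simp
    qed
    then have "s *\<^sub>v v = v" if s: "s \<in> ?R" for s
    proof -
      have "s \<in> \<sigma> ` {..<m}" using s \<sigma> by (simp add: bij_betw_def)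
      then obtain i where "i < m" "s = \<sigma> i" by auto
      then show ?thesis using root_fixed_iff[OF \<alpha> v(1)] \<open>\<And>i. i < m \<Longrightarrow> form (\<alpha> i) v = 0\<close> by simp
    qed
    then show False using fixed_by_reflections v by blast
  qed
  moreover have "\<not> n < m"
  proof
    assume nm: "n < m"
    define A where "A = mat m m (\<lambda>(k, i). if k < n then \<alpha> i $ k else 0)"
    have A: "A \<in> carrier_mat m m" by (simp add: A_def)
    have "det A = 0" by (rule det_zero_row[OF A nm]) (use nm in \<open>simp add: A_def\<close>)
    then obtain z where z: "z \<in> carrier_vec m" "z \<noteq> 0\<^sub>v m" "A *\<^sub>v z = 0\<^sub>v m"
      using det_0_iff_vec_prod_zero[OF A] by blast
    have zk: "(\<Sum>i<m. \<alpha> i $ k * z $ i) = 0" if "k < n" for k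
      using arg_cong[OF z(3), of "\<lambda>u. u $ k"] z(1) that nm
      by (simp add: A_def scalar_prod_def atLeast0LessThan)
    have "z $ j = 0" if "j < m" for j
      by (rule orthogonal_independent[where m = m and \<alpha> = \<alpha>]) (use \<alpha>D orth zk that in auto)
    then have "z = 0\<^sub>v m" using z(1) by (intro eq_vecI) auto
    then show False using z(2) by simp
  qed
  ultimately have "m = n" by simp
  then show ?thesis
    unfolding orthogonal_roots_def using \<sigma> \<alpha> orth by blast
qed

context
  fixes \<sigma> \<alpha>
  assumes roots: "orthogonal_roots \<sigma> \<alpha>"
begin

lemma root_at: "i < n \<Longrightarrow> is_root (\<alpha> i) (\<sigma> i)"
  and root_orthogonal: "i < n \<Longrightarrow> j < n \<Longrightarrow> i \<noteq> j \<Longrightarrow> form (\<alpha> i) (\<alpha> j) = 0"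
  and reflection_bij: "bij_betw \<sigma> {..<n} (reflections n W)"
  using roots by (auto simp: orthogonal_roots_def)

lemma reflection_at: "i < n \<Longrightarrow> \<sigma> i \<in> reflections n W"
  using reflection_bij by (auto simp: bij_betw_def)

lemmas root_at_D = is_rootD[OF root_at]

lemma perp_roots_zero:
  assumes "v \<in> carrier_vec n" "\<And>i. i < n \<Longrightarrow> form (\<alpha> i) v = 0"
  shows "v = 0\<^sub>v n"
proof (rule fixed_by_reflections[OF assms(1)])
  fix s assume "s \<in> reflections n W"
  then have "s \<in> \<sigma> ` {..<n}" using reflection_bij by (simp add: bij_betw_def)
  then obtain i where "i < n" "s = \<sigma> i" by auto
  then show "s *\<^sub>v v = v" using root_fixed_iff[OF root_at assms(1)] assms(2) by simp
qed

lemma W_root_sign: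
  assumes "w \<in> W" "i < n"
  shows "\<exists>c. (c = 1 \<or> c = -1) \<and> w *\<^sub>v \<alpha> i = c \<cdot>\<^sub>v \<alpha> i"
  using assms(1)
proof (induction rule: W_induct)
  case (reflection s)
  then obtain j where j: "j < n" "s = \<sigma> j" using reflection_bij by (auto simp: bij_betw_def)
  show ?case
  proof (cases "j = i")
    case True
    then show ?thesis
      using root_negated[OF root_at[OF assms(2)]] j by (intro exI[of _ "-1"]) auto
  next
    case False
    then have "s *\<^sub>v \<alpha> i = \<alpha> i"
      using root_fixed_iff[OF root_at[OF j(1)] root_at_D(1)[OF assms(2)]] root_orthogonal[OF j(1) assms(2)] j(2)
      by simp
    then show ?thesis by (intro exI[of _ 1]) auto
  qed
next
  case one
  then show ?case using root_at_D(1)[OF assms(2)] by (intro exI[of _ 1]) auto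
next
  case (mult u w)
  then obtain c d where "c = 1 \<or> c = -1" "u *\<^sub>v \<alpha> i = c \<cdot>\<^sub>v \<alpha> i" "d = 1 \<or> d = -1" "w *\<^sub>v \<alpha> i = d \<cdot>\<^sub>v \<alpha> i"
    by blast
  then show ?case
    using mult root_at_D(1)[OF assms(2)]
    by (intro exI[of _ "d * c"])
      (auto simp: assoc_mult_mat_vec[of _ n n _ n] mult_mat_vec[of _ n n] smult_smult_assoc)
qed

lemma form_root_mult:
  assumes "w \<in> W" "i < n" "w *\<^sub>v \<alpha> i = c \<cdot>\<^sub>v \<alpha> i" "v \<in> carrier_vec n"
  shows "c * form (\<alpha> i) (w *\<^sub>v v) = form (\<alpha> i) v"
  using form_invariant[OF assms(1) root_at_D(1)[OF assms(2)] assms(4)] assms root_at_D(1)[OF assms(2)]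
  by (simp add: form_linear)

lemma commuting_boolean: "boolean_arrangement n (arrangement n W)"
proof -
  define P where "P = mat n n (\<lambda>(i, j). dual (\<alpha> i) $ j)"
  have P: "P \<in> carrier_mat n n" by (simp add: P_def)
  have row: "row P i = dual (\<alpha> i)" if "i < n" for i
    using that by (intro eq_vecI) (auto simp: P_def)
  have "det P \<noteq> 0"
  proof
    assume "det P = 0"
    then obtain v where v: "v \<in> carrier_vec n" "v \<noteq> 0\<^sub>v n" "P *\<^sub>v v = 0\<^sub>v n"
      using det_0_iff_vec_prod_zero[OF P] by blast
    have "form (\<alpha> i) v = 0" if i: "i < n" for i
      using arg_cong[OF v(3), of "\<lambda>u. u $ i"] P i row[OF i] dual_scalar_prod root_at_D(1)[OF i] v(1)
      by simp
    then show False using perp_roots_zero v by blast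
  qed
  then have "P \<in> Units (ring_mat TYPE(complex) n ())" by (rule det_non_zero_imp_unit[OF P])
  then obtain Q where "Q \<in> carrier_mat n n" "Q * P = 1\<^sub>m n" "P * Q = 1\<^sub>m n"
    by (auto simp: Units_def ring_mat_simps)
  then have "invertible_mat P"
    using P by (auto simp: invertible_mat_def inverts_mat_def)
  moreover have "arrangement n W = (\<lambda>i. hyperplane n (row P i)) ` {..<n}"
  proof -
    have "reflections n W = \<sigma> ` {..<n}" using reflection_bij by (simp add: bij_betw_def)
    then have "arrangement n W = (\<lambda>i. fixed_space n (\<sigma> i)) ` {..<n}"
      by (simp add: arrangement_def image_image)
    also have "\<dots> = (\<lambda>i. hyperplane n (row P i)) ` {..<n}"
      by (rule image_cong) (use root_fixed_space[OF root_at] row in auto)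
    finally show ?thesis .
  qed
  ultimately show ?thesis unfolding boolean_arrangement_def using P by blast
qed

text \<open>An element of W corresponds to the set of roots it negates. The signs determine it
  because the roots separate vectors, and composing with \<open>\<sigma> i\<close> flips the sign at
  i alone, so every set occurs.\<close>

lemma commuting_card: "card W = 2 ^ n"
proof -
  define \<phi> where "\<phi> w = {i \<in> {..<n}. w *\<^sub>v \<alpha> i = - \<alpha> i}" for w :: "complex mat"
  have nz: "- \<alpha> i \<noteq> \<alpha> i" if "i < n" for i
  proof
    assume "- \<alpha> i = \<alpha> i"
    then have "form (\<alpha> i) (- \<alpha> i) = form (\<alpha> i) (\<alpha> i)" by simp
    moreover have "- \<alpha> i = (-1) \<cdot>\<^sub>v \<alpha> i" by auto
    ultimately show False
      using root_at_D(1,4)[OF that] form_smult_right[OF root_at_D(1)[OF that] root_at_D(1)[OF that], of "-1"] by simp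
  qed
  have neg: "(-1) \<cdot>\<^sub>v \<alpha> i = - \<alpha> i" for i by auto
  have "inj_on \<phi> W"
  proof (rule inj_onI)
    fix w w' assume w: "w \<in> W" "w' \<in> W" "\<phi> w = \<phi> w'"
    have same: "\<exists>c. c \<noteq> 0 \<and> w *\<^sub>v \<alpha> i = c \<cdot>\<^sub>v \<alpha> i \<and> w' *\<^sub>v \<alpha> i = c \<cdot>\<^sub>v \<alpha> i" if i: "i < n" for i
    proof -
      have "i \<in> \<phi> w \<longleftrightarrow> i \<in> \<phi> w'" using w(3) by simp
      then have "w *\<^sub>v \<alpha> i = - \<alpha> i \<longleftrightarrow> w' *\<^sub>v \<alpha> i = - \<alpha> i" using i by (simp add: \<phi>_def)
      moreover have "w *\<^sub>v \<alpha> i = \<alpha> i \<or> w *\<^sub>v \<alpha> i = - \<alpha> i" "w' *\<^sub>v \<alpha> i = \<alpha> i \<or> w' *\<^sub>v \<alpha> i = - \<alpha> i"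
        using W_root_sign[OF w(1) i] W_root_sign[OF w(2) i] neg by auto
      ultimately consider "w *\<^sub>v \<alpha> i = \<alpha> i \<and> w' *\<^sub>v \<alpha> i = \<alpha> i" | "w *\<^sub>v \<alpha> i = - \<alpha> i \<and> w' *\<^sub>v \<alpha> i = - \<alpha> i"
        by metis
      then show ?thesis
      proof cases
        case 1
        then show ?thesis by (intro exI[of _ 1]) auto
      next
        case 2
        then show ?thesis by (intro exI[of _ "-1"]) auto
      qed
    qed
    show "w = w'"
    proof (rule mat_eq_by_vec[of _ n])
      fix v :: "complex vec" assume v: "v \<in> carrier_vec n"
      have "w *\<^sub>v v - w' *\<^sub>v v = 0\<^sub>v n"
      proof (rule perp_roots_zero)
        show "w *\<^sub>v v - w' *\<^sub>v v \<in> carrier_vec n" using w v by simp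
        fix i assume i: "i < n"
        obtain c where c: "c \<noteq> 0" "w *\<^sub>v \<alpha> i = c \<cdot>\<^sub>v \<alpha> i" "w' *\<^sub>v \<alpha> i = c \<cdot>\<^sub>v \<alpha> i" using same[OF i] by blast
        have "c * form (\<alpha> i) (w *\<^sub>v v) = c * form (\<alpha> i) (w' *\<^sub>v v)"
          using form_root_mult[OF w(1) i c(2) v] form_root_mult[OF w(2) i c(3) v] by simp
        then show "form (\<alpha> i) (w *\<^sub>v v - w' *\<^sub>v v) = 0"
          using c(1) w v root_at_D(1)[OF i] by (simp add: form_minus_right)
      qed
      then show "w *\<^sub>v v = w' *\<^sub>v v"
        using vec_minus_eq_zeroD[of "w *\<^sub>v v" n "w' *\<^sub>v v"] w v by simp
    qed (use w in auto)
  qed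
  moreover have "\<phi> ` W = Pow {..<n}"
  proof
    show "\<phi> ` W \<subseteq> Pow {..<n}" by (auto simp: \<phi>_def)
    have "\<exists>w\<in>W. \<phi> w = T" if "finite T" "T \<subseteq> {..<n}" for T
      using that
    proof (induction T rule: finite_induct)
      case empty
      have "\<phi> (1\<^sub>m n) = {}" unfolding \<phi>_def using root_at_D(1) nz by (auto simp: eq_commute)
      then show ?case using one_W by blast
    next
      case (insert i T)
      then obtain w where w: "w \<in> W" "\<phi> w = T" by auto
      have i: "i < n" "i \<notin> \<phi> w" using insert w by auto
      have s: "\<sigma> i \<in> W" using reflection_at[OF i(1)] reflectionsD by blast
      have wj: "w *\<^sub>v \<alpha> j = \<alpha> j \<or> w *\<^sub>v \<alpha> j = - \<alpha> j" if "j < n" for j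
        using W_root_sign[OF w(1) that] neg by auto
      have act: "(\<sigma> i * w) *\<^sub>v \<alpha> j = (if j = i then - (w *\<^sub>v \<alpha> j) else w *\<^sub>v \<alpha> j)" if j: "j < n" for j
      proof -
        obtain c where c: "w *\<^sub>v \<alpha> j = c \<cdot>\<^sub>v \<alpha> j" using W_root_sign[OF w(1) j] by blast
        have "(\<sigma> i * w) *\<^sub>v \<alpha> j = c \<cdot>\<^sub>v (\<sigma> i *\<^sub>v \<alpha> j)"
          using s w(1) root_at_D(1)[OF j] by (simp add: W_mult_vec c W_smult)
        also have "\<sigma> i *\<^sub>v \<alpha> j = (if j = i then - \<alpha> j else \<alpha> j)"
          using root_negated[OF root_at[OF i(1)]] root_fixed_iff[OF root_at[OF i(1)] root_at_D(1)[OF j]]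
            root_orthogonal[OF i(1) j] by auto
        finally show ?thesis unfolding c using root_at_D(1)[OF j] by auto
      qed
      have "\<phi> (\<sigma> i * w) = insert i T"
      proof (rule Set.set_eqI)
        fix j
        show "j \<in> \<phi> (\<sigma> i * w) \<longleftrightarrow> j \<in> insert i T"
        proof (cases "j < n")
          case False
          then show ?thesis using i(1) w(2) by (auto simp: \<phi>_def)
        next
          case j: True
          show ?thesis
          proof (cases "j = i")
            case True
            then show ?thesis
              using i act[OF j] wj[OF j] by (auto simp: \<phi>_def)
          next
            case False
            then show ?thesis using act[OF j] w(2) j by (auto simp: \<phi>_def)
          qed
        qed
      qed
      then show ?case using s w(1) by (metis mult_W)
    qed
    then show "Pow {..<n} \<subseteq> \<phi> ` W" by (auto simp: image_iff) (metis finite_lessThan finite_subset)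
  qed
  ultimately have "card W = card (Pow {..<n})" by (metis card_image)
  then show ?thesis by (simp add: card_Pow)
qed

text \<open>Orthogonality forces commutation: the third reflection of a noncommuting pair would have
  a root in the span of two roots orthogonal to its own, and so would fix its own root.\<close>

lemma commuting_type: "type_A1_power n n W"
proof -
  have "card (reflections n W) = n" using bij_betw_same_card[OF reflection_bij] by simp
  moreover have "r * s = s * r" if rs: "r \<in> reflections n W" "s \<in> reflections n W" for r s
  proof -
    have "r \<in> \<sigma> ` {..<n}" "s \<in> \<sigma> ` {..<n}"
      using rs reflection_bij by (simp_all add: bij_betw_def)
    then obtain i j where ij: "i < n" "j < n" "r = \<sigma> i" "s = \<sigma> j" by auto
    show ?thesis
    proof (rule ccontr)
      assume nc: "r * s \<noteq> s * r"
      obtain t c where t: "t \<in> reflections n W" "t \<noteq> r" "t \<noteq> s" "is_root (\<alpha> j + c \<cdot>\<^sub>v \<alpha> i) t"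
        using noncommuting_third[OF rs(1) _ rs(2) _ nc, of "\<alpha> i" "\<alpha> j"] root_at ij by metis
      then obtain k where k: "k < n" "t = \<sigma> k" using reflection_bij by (auto simp: bij_betw_def)
      have ki: "k \<noteq> i" "k \<noteq> j" using k t ij by auto
      have "form (\<alpha> k) (\<alpha> j + c \<cdot>\<^sub>v \<alpha> i) = 0"
        using root_at_D(1) k ij ki root_orthogonal by (simp add: form_linear)
      then have "t *\<^sub>v (\<alpha> j + c \<cdot>\<^sub>v \<alpha> i) = \<alpha> j + c \<cdot>\<^sub>v \<alpha> i"
        using root_fixed_iff[OF root_at[OF k(1)]] is_rootD(1)[OF t(4)] k(2) by blast
      then show False
        using root_fixed_iff[OF t(4)] is_rootD(1,4)[OF t(4)] by blast
    qed
  qed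
  ultimately show ?thesis
    unfolding type_A1_power_def using W_generated commuting_card by (intro exI[of _ "reflections n W"]) auto
qed

end

section \<open>Boolean arrangements, commuting reflections and products of type A1\<close>

text \<open>In Boolean coordinates a dual basis vector lies on all hyperplanes but one. For a
  noncommuting pair the third hyperplane contains the intersection of the first two, which leaves no
  such vector for it.\<close>

lemma boolean_commuting:
  assumes "boolean_arrangement n (arrangement n W)"
  shows commuting_reflections
proof (rule ccontr)
  assume "\<not> commuting_reflections"
  then obtain r s where rs: "r \<in> reflections n W" "s \<in> reflections n W" and nc: "r * s \<noteq> s * r"
    by (auto simp: commuting_reflections_def)
  obtain a b where a: "is_root a r" and b: "is_root b s" using exists_root rs by metis
  obtain t c where t: "t \<in> reflections n W" "t \<noteq> r" "t \<noteq> s" "is_root (b + c \<cdot>\<^sub>v a) t"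
    using noncommuting_third[OF rs(1) a rs(2) b nc] .
  obtain P where P: "P \<in> carrier_mat n n" "invertible_mat P"
    and A: "arrangement n W = (\<lambda>i. hyperplane n (row P i)) ` {..<n}"
    using assms by (auto simp: boolean_arrangement_def)
  have "\<exists>i<n. fixed_space n u = hyperplane n (row P i)" if "u \<in> reflections n W" for u
  proof -
    have "fixed_space n u \<in> arrangement n W" using that by (simp add: arrangement_def)
    then show ?thesis unfolding A by auto
  qed
  then obtain i j k where ijk: "i < n" "j < n" "k < n" and
    H: "fixed_space n r = hyperplane n (row P i)" "fixed_space n s = hyperplane n (row P j)"
    "fixed_space n t = hyperplane n (row P k)"
    using rs t(1) by metis
  have "k \<noteq> i" "k \<noteq> j" using H t reflection_eq_iff rs by metis+
  obtain Q where Q: "P * Q = 1\<^sub>m n" "Q \<in> carrier_mat n n"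
    using P by (auto simp: invertible_mat_def inverts_mat_def)
      (metis carrier_matD(1) carrier_matD(2) carrier_matI index_mult_mat(2,3) index_one_mat(2,3))
  define v where "v = Q *\<^sub>v unit_vec n k"
  have v: "v \<in> carrier_vec n" unfolding v_def using Q(2) by simp
  have "P *\<^sub>v v = unit_vec n k"
  proof -
    have "P *\<^sub>v v = (P * Q) *\<^sub>v unit_vec n k"
      unfolding v_def using P(1) Q(2) by (simp add: assoc_mult_mat_vec[of _ n n _ n])
    then show ?thesis using Q(1) by simp
  qed
  then have Pv: "row P m \<bullet> v = (if m = k then 1 else 0)" if "m < n" for m
  proof -
    have "row P m \<bullet> v = (P *\<^sub>v v) $ m" using P(1) that by simp
    then show ?thesis using \<open>P *\<^sub>v v = unit_vec n k\<close> that ijk(3) by (simp add: unit_vec_def)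
  qed
  have "v \<in> fixed_space n r" "v \<in> fixed_space n s" "v \<notin> fixed_space n t"
    unfolding H hyperplane_def using Pv ijk v \<open>k \<noteq> i\<close> \<open>k \<noteq> j\<close> by auto
  then have "form a v = 0" "form b v = 0" "form (b + c \<cdot>\<^sub>v a) v \<noteq> 0"
    using root_fixed_iff[OF a v] root_fixed_iff[OF b v] root_fixed_iff[OF t(4) v] v
    by (auto simp: fixed_space_def)
  then show False using is_rootD(1)[OF a] is_rootD(1)[OF b] v by (simp add: form_linear)
qed

text \<open>Commuting generators make the whole group abelian, so reflections outside R commute as
  well.\<close>

lemma type_commuting:
  assumes "type_A1_power k n W"
  shows commuting_reflections
proof -
  obtain R where R: "R \<subseteq> reflections n W" "generate (GL n) R = W" "\<And>r s. r \<in> R \<Longrightarrow> s \<in> R \<Longrightarrow> r * s = s * r"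
    using assms unfolding type_A1_power_def by blast
  have inv: "r \<in> carrier_mat n n \<and> r * r = 1\<^sub>m n" if "r \<in> R" for r
    using that R(1) reflectionsD by blast
  have comm_mult: "(u * v) * r = r * (u * v)"
    if "u \<in> carrier_mat n n" "v \<in> carrier_mat n n" "r \<in> carrier_mat n n" "u * r = r * u" "v * r = r * v" for u v r :: "complex mat"
  proof -
    have "(u * v) * r = u * (v * r)" using that(1-3) by (simp add: assoc_mult_mat[of _ n n _ n _ n])
    also have "\<dots> = (u * r) * v" unfolding that(5) using that(1-3) by (simp add: assoc_mult_mat[of _ n n _ n _ n])
    also have "\<dots> = r * (u * v)" unfolding that(4) using that(1-3) by (simp add: assoc_mult_mat[of _ n n _ n _ n])
    finally show ?thesis .
  qed
  have *: "w * r = r * w" if "w \<in> W" "r \<in> R" for w r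
  proof -
    have "w \<in> generate (GL n) R" using that(1) R(2) by simp
    then show ?thesis
    proof (induction rule: generate_GL_induct)
      case (involution u)
      then show ?case using inv R(3) that(2) by blast
    next
      case one
      then show ?case using inv[OF that(2)] by auto
    next
      case (mult u v)
      then show ?case using comm_mult[of u v r] inv[OF that(2)] by blast
    qed
  qed
  have "w * u = u * w" if "w \<in> W" "u \<in> W" for w u
  proof -
    have "w \<in> generate (GL n) R" using that(1) R(2) by simp
    then show ?thesis
    proof (induction rule: generate_GL_induct)
      case (involution r)
      then show ?case using inv *[OF that(2)] by metis
    next
      case one
      then show ?case using W_carrier[OF that(2)] by auto
    next
      case (mult v v')
      then show ?case using comm_mult[of v v' u] W_carrier[OF that(2)] by blast
    qed
  qed
  then show ?thesis unfolding commuting_reflections_def using reflectionsD(1) by blast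
qed

lemma boolean_iff_commuting: "boolean_arrangement n (arrangement n W) \<longleftrightarrow> commuting_reflections"
  using boolean_commuting exists_orthogonal_roots commuting_boolean by blast

lemma type_iff_commuting: "(\<exists>k. type_A1_power k n W) \<longleftrightarrow> commuting_reflections"
  using type_commuting exists_orthogonal_roots commuting_type by blast

lemma card_one_dim:
  assumes "card (arrangement n W) = 1"
  shows "n = 1 \<and> commuting_reflections"
proof -
  have "card (reflections n W) = 1" using assms card_arrangement by simp
  then obtain r where "reflections n W = {r}" by (metis card_1_singletonE)
  then have c: commuting_reflections by (simp add: commuting_reflections_def)
  obtain \<sigma> \<alpha> where "orthogonal_roots \<sigma> \<alpha>" using exists_orthogonal_roots[OF c] by blast
  then have "card (reflections n W) = n"
    using bij_betw_same_card[OF reflection_bij] by fastforce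
  then show ?thesis using c \<open>card (reflections n W) = 1\<close> by simp
qed

lemma card_one_iff_type: "card (arrangement n W) = 1 \<longleftrightarrow> type_A1_power 1 n W"
proof
  assume "card (arrangement n W) = 1"
  then have "n = 1" commuting_reflections using card_one_dim by auto
  then show "type_A1_power 1 n W" using exists_orthogonal_roots commuting_type by metis
next
  assume t: "type_A1_power 1 n W"
  then have c: commuting_reflections by (rule type_commuting)
  obtain \<sigma> \<alpha> where r: "orthogonal_roots \<sigma> \<alpha>" using exists_orthogonal_roots[OF c] by blast
  \<comment> \<open>W has order 2 by its type and 2^n by the count of sign patterns.\<close>
  have "(2::nat) ^ n = 2 ^ 1" using t commuting_card[OF r] unfolding type_A1_power_def by metis
  then have "n = 1" using power_inject_exp[of "2::nat" n 1] by simp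
  moreover have "card (reflections n W) = n"
    using bij_betw_same_card[OF reflection_bij[OF r]] by simp
  ultimately show "card (arrangement n W) = 1" using card_arrangement by simp
qed

end

section \<open>The Boolean case\<close>

text \<open>The product is homogeneous of degree d in a and b and monic in a, which is the shape
  that \<open>integral_fraction\<close> asks for.\<close>

lemma prod_linear_expand:
  fixes a b :: mpoly and c :: "nat \<Rightarrow> mpoly"
  assumes "\<And>i. i < d \<Longrightarrow> c i \<in> mpolys n"
  shows "\<exists>c'. (\<forall>i. c' i \<in> mpolys n) \<and>
    (\<Prod>i<d. a - b * c i) = a ^ d + (\<Sum>i<d. c' i * a ^ i * b ^ (d - i))"
  using assms
proof (induction d)
  case 0
  then show ?case by (auto intro!: exI[of _ "\<lambda>_. 0"])
next
  case (Suc d)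
  then obtain c' where c': "\<And>i. c' i \<in> mpolys n"
    "(\<Prod>i<d. a - b * c i) = a ^ d + (\<Sum>i<d. c' i * a ^ i * b ^ (d - i))" by auto
  \<comment> \<open>The coefficients with the leading 1 included at index d, so that one sum covers
    all terms.\<close>
  define u where "u i = (if i < d then c' i else if i = d then 1 else 0)" for i
  have u: "u i \<in> mpolys n" for i using c' by (simp add: u_def)
  have expand: "a ^ d + (\<Sum>i<d. c' i * a ^ i * b ^ (d - i)) = (\<Sum>i\<le>d. u i * a ^ i * b ^ (d - i))"
    unfolding lessThan_Suc_atMost[symmetric] by (simp add: u_def)
  define c'' where "c'' i = (case i of 0 \<Rightarrow> - (c d * u 0) | Suc j \<Rightarrow> u j - c d * u (Suc j))" for i
  have "(\<Prod>i<Suc d. a - b * c i) = (\<Sum>i\<le>d. u i * a ^ i * b ^ (d - i)) * (a - b * c d)"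
    using c'(2) expand by simp
  also have "\<dots> = (\<Sum>i\<le>d. u i * a ^ Suc i * b ^ (d - i)) - (\<Sum>i\<le>d. c d * u i * a ^ i * b ^ (Suc d - i))"
    unfolding sum_distrib_right sum_subtractf[symmetric]
    by (intro sum.cong refl) (simp add: right_diff_distrib Suc_diff_le mult_ac)
  also have "(\<Sum>i\<le>d. u i * a ^ Suc i * b ^ (d - i)) = a ^ Suc d + (\<Sum>i<d. u i * a ^ Suc i * b ^ (d - i))"
    unfolding lessThan_Suc_atMost[symmetric] by (simp add: u_def)
  also have "(\<Sum>i\<le>d. c d * u i * a ^ i * b ^ (Suc d - i)) =
      c d * u 0 * b ^ Suc d + (\<Sum>i<d. c d * u (Suc i) * a ^ Suc i * b ^ (d - i))"
    unfolding lessThan_Suc_atMost[symmetric] by (subst sum.lessThan_Suc_shift) simp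
  finally have "(\<Prod>i<Suc d. a - b * c i) = a ^ Suc d + (\<Sum>i<d. u i * a ^ Suc i * b ^ (d - i)) -
      (c d * u 0 * b ^ Suc d + (\<Sum>i<d. c d * u (Suc i) * a ^ Suc i * b ^ (d - i)))" .
  also have "\<dots> = a ^ Suc d + (- (c d * u 0) * b ^ Suc d +
      (\<Sum>i<d. (u i - c d * u (Suc i)) * a ^ Suc i * b ^ (d - i)))"
    by (simp add: left_diff_distrib sum_subtractf algebra_simps)
  also have "\<dots> = a ^ Suc d + (\<Sum>i<Suc d. c'' i * a ^ i * b ^ (Suc d - i))"
    unfolding sum.lessThan_Suc_shift by (simp add: c''_def)
  finally have "(\<Prod>i<Suc d. a - b * c i) = a ^ Suc d + (\<Sum>i<Suc d. c'' i * a ^ i * b ^ (Suc d - i))" .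
  moreover have "c'' i \<in> mpolys n" for i
    using u Suc.prems[of d] by (simp add: c''_def split: nat.split)
  ultimately show ?case by blast
qed

lemma map_mat_mconst_det: "det (map_mat mconst A) = mconst (det A)"
proof -
  interpret m: comm_ring_hom mconst by (rule mconst_hom)
  show ?thesis by simp
qed

context coxeter_invariants
begin

context
  fixes \<sigma> \<alpha>
  assumes roots: "orthogonal_roots \<sigma> \<alpha>"
begin

lemmas rootD = root_at_D[OF roots]

definition Lf :: "nat \<Rightarrow> mpoly" where "Lf i = rootform (\<alpha> i)"
definition Lprod :: mpoly where "Lprod = (\<Prod>i<n. Lf i)"
definition Lhat :: "nat \<Rightarrow> mpoly" where "Lhat i = (\<Prod>j\<in>{..<n} - {i}. Lf j)"

lemma Lf_mpolys [simp]: "Lf i \<in> mpolys n" by (simp add: Lf_def)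
lemma Lhat_mpolys [simp]: "Lhat i \<in> mpolys n" by (simp add: Lhat_def prod_mpolys)

lemma Lprod_split: "i < n \<Longrightarrow> Lprod = Lf i * Lhat i"
  unfolding Lprod_def Lhat_def by (rule prod.remove) auto

lemma Lf_nonzero: "i < n \<Longrightarrow> Lf i \<noteq> 0"
  unfolding Lf_def using rootform_nonzero root_at[OF roots] by blast

lemma Lf_prime: "i < n \<Longrightarrow> f \<in> mpolys n \<Longrightarrow> g \<in> mpolys n \<Longrightarrow> Lf i dvd f * g \<Longrightarrow> Lf i dvd f \<or> Lf i dvd g"
  unfolding Lf_def using rootform_prime root_at[OF roots] by blast

lemma Lf_not_dvd: "i < n \<Longrightarrow> j < n \<Longrightarrow> i \<noteq> j \<Longrightarrow> \<not> Lf i dvd Lf j"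
proof -
  assume ij: "i < n" "j < n" "i \<noteq> j"
  have "form (\<alpha> i) (\<alpha> j) = 0" "form (\<alpha> j) (\<alpha> j) \<noteq> 0"
    using root_orthogonal[OF roots] rootD(4) ij by auto
  then have "peval (\<alpha> j) (Lf j) \<noteq> 0" "\<alpha> j \<in> carrier_vec n"
    using rootD(1) ij by (auto simp: Lf_def)
  then show ?thesis
    using rootform_dvd_iff[OF root_at[OF roots ij(1)], of "Lf j"] \<open>form (\<alpha> i) (\<alpha> j) = 0\<close>
    by (auto simp: Lf_def)
qed

lemma Lf_dvd_Lhat: "j < n \<Longrightarrow> i \<noteq> j \<Longrightarrow> Lf j dvd Lhat i"
  unfolding Lhat_def by (rule dvd_prodI) auto

lemma Lf_not_dvd_Lhat:
  assumes "i < n"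
  shows "\<not> Lf i dvd Lhat i"
proof -
  have "\<not> Lf i dvd (\<Prod>j\<in>A. Lf j)" if "finite A" "A \<subseteq> {..<n} - {i}" for A
    using that
  proof (induction A rule: finite_induct)
    case empty
    show ?case
    proof
      assume "Lf i dvd (\<Prod>j\<in>{}. Lf j)"
      then obtain k where "1 = Lf i * k" by auto
      then have "peval (0\<^sub>v n) 1 = peval (0\<^sub>v n) (Lf i * k)" by simp
      moreover have "peval (0\<^sub>v n) (Lf i) = 0"
        using rootD(1)[OF assms] by (simp add: Lf_def form_zero_right)
      ultimately show False by (simp add: peval.hom_mult)
    qed
  next
    case (insert j A)
    show ?case
    proof
      assume "Lf i dvd (\<Prod>j\<in>insert j A. Lf j)"
      then have "Lf i dvd Lf j * (\<Prod>j\<in>A. Lf j)" using insert by simp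
      moreover have "(\<Prod>j\<in>A. Lf j) \<in> mpolys n" by (rule prod_mpolys) simp
      ultimately have "Lf i dvd Lf j \<or> Lf i dvd (\<Prod>j\<in>A. Lf j)"
        using Lf_prime[OF assms Lf_mpolys] by blast
      then show False using insert Lf_not_dvd[OF assms, of j] by auto
    qed
  qed
  then show ?thesis unfolding Lhat_def by simp
qed

lemma Lprod_dvd:
  assumes "\<And>i. i < n \<Longrightarrow> Lf i dvd g i"
  shows "Lprod dvd (\<Prod>i<n. g i)"
  unfolding Lprod_def by (rule prod_dvd_prod) (use assms in auto)

definition root_mat :: "complex mat" where
  "root_mat = mat n n (\<lambda>(j, i). \<alpha> i $ j)"

lemma root_mat_carrier [simp]: "root_mat \<in> carrier_mat n n"
  by (simp add: root_mat_def)

lemma root_mat_det: "det root_mat \<noteq> 0"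
proof
  assume "det root_mat = 0"
  then obtain z where z: "z \<in> carrier_vec n" "z \<noteq> 0\<^sub>v n" "root_mat *\<^sub>v z = 0\<^sub>v n"
    using det_0_iff_vec_prod_zero[OF root_mat_carrier] by blast
  have zk: "(\<Sum>i<n. \<alpha> i $ k * z $ i) = 0" if "k < n" for k
    using arg_cong[OF z(3), of "\<lambda>u. u $ k"] z(1) that
    by (simp add: root_mat_def scalar_prod_def atLeast0LessThan)
  have "z $ j = 0" if "j < n" for j
    by (rule orthogonal_independent[where m = n and \<alpha> = \<alpha>])
      (use rootD root_orthogonal[OF roots] zk that in auto)
  then have "z = 0\<^sub>v n" using z(1) by (intro eq_vecI) auto
  then show False using z(2) by simp
qed

text \<open>The derivative of an invariant along a root is divisible by the corresponding linear form:
  \<open>J \<cdot> root_mat = H \<cdot> diag(Lf)\<close>.  The squares of the linear forms are invariants, which provides a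
  left inverse of \<open>H\<close> up to a constant diagonal matrix.\<close>

lemma exists_quotient_matrix:
  obtains H F :: "mpoly mat" where "H \<in> carrier_mat n n" "F \<in> carrier_mat n n"
    "\<And>i j. i < n \<Longrightarrow> j < n \<Longrightarrow> H $$ (i, j) \<in> mpolys n" "\<And>i j. i < n \<Longrightarrow> j < n \<Longrightarrow> F $$ (i, j) \<in> mpolys n"
    "J * map_mat mconst root_mat = H * mat n n (\<lambda>(i, j). if i = j then Lf i else 0)"
    "F * H = mat n n (\<lambda>(i, j). if i = j then mconst (2 * form (\<alpha> i) (\<alpha> i)) else 0)"
proof -
  have "\<exists>h\<in>mpolys n. dderiv n (\<alpha> i) (p k) = Lf i * h" if ik: "i < n" "k < n" for k i
  proof -
    have "Lf i dvd dderiv n (\<alpha> i) (p k)"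
      unfolding Lf_def
      using rootform_dvd_iff[OF root_at[OF roots ik(1)], of "dderiv n (\<alpha> i) (p k)"]
        reflection_derivative_zero[OF root_at[OF roots ik(1)] _ _ _ p_invariant[OF ik(2)]]
        reflection_at[OF roots ik(1)] reflectionsD(1) ik by auto
    then show ?thesis
      using dvd_mpolys[OF Lf_mpolys, of "dderiv n (\<alpha> i) (p k)"] ik by (metis dderiv_mpolys p_mpolys)
  qed
  then obtain h' where h': "\<And>i k. i < n \<Longrightarrow> k < n \<Longrightarrow> h' i k \<in> mpolys n \<and> dderiv n (\<alpha> i) (p k) = Lf i * h' i k"
    by metis
  define h where "h k i = h' i k" for k i
  have h: "\<And>i k. i < n \<Longrightarrow> k < n \<Longrightarrow> h k i \<in> mpolys n \<and> dderiv n (\<alpha> i) (p k) = Lf i * h k i"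
    using h' by (simp add: h_def)
  \<comment> \<open>Every w maps the root to itself or its negative, so the square of its linear
    form does not change.\<close>
  have "\<exists>f\<in>mpolys n. Lf i * Lf i = insertion mconst p f" if i: "i < n" for i
  proof -
    have "Lf i * Lf i \<in> invariants n W"
      unfolding invariants_iff
    proof (intro conjI ballI)
      fix w and v :: "complex vec" assume w: "w \<in> W" and v: "v \<in> carrier_vec n"
      obtain c where c: "c = 1 \<or> c = -1" "w *\<^sub>v \<alpha> i = c \<cdot>\<^sub>v \<alpha> i" using W_root_sign[OF roots w i] by blast
      have "peval (w *\<^sub>v v) (Lf i * Lf i) = form (\<alpha> i) (w *\<^sub>v v) * form (\<alpha> i) (w *\<^sub>v v)"
        using w v rootD(1)[OF i] by (simp add: Lf_def peval.hom_mult)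
      also have "\<dots> = (c * form (\<alpha> i) (w *\<^sub>v v)) * (c * form (\<alpha> i) (w *\<^sub>v v))"
        using c(1) by auto
      also have "\<dots> = form (\<alpha> i) v * form (\<alpha> i) v"
        unfolding form_root_mult[OF roots w i c(2) v] ..
      also have "\<dots> = peval v (Lf i * Lf i)"
        using v rootD(1)[OF i] by (simp add: Lf_def peval.hom_mult)
      finally show "peval (w *\<^sub>v v) (Lf i * Lf i) = peval v (Lf i * Lf i)" .
    qed simp
    then show ?thesis using invariant_obtain by metis
  qed
  then obtain f where f: "\<And>i. i < n \<Longrightarrow> f i \<in> mpolys n \<and> Lf i * Lf i = insertion mconst p (f i)" by metis
  define H where "H = mat n n (\<lambda>(k, i). h k i)"
  define F where "F = mat n n (\<lambda>(i, k). insertion mconst p (mderiv k (f i)))"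
  have "J * map_mat mconst root_mat = H * mat n n (\<lambda>(i, j). if i = j then Lf i else 0)"
  proof (rule eq_matI)
    fix k i assume "k < dim_row (H * mat n n (\<lambda>(i, j). if i = j then Lf i else 0))"
      "i < dim_col (H * mat n n (\<lambda>(i, j). if i = j then Lf i else 0))"
    then have ki: "k < n" "i < n" by (simp_all add: H_def)
    have "(J * map_mat mconst root_mat) $$ (k, i) = (\<Sum>j<n. mderiv j (p k) * mconst (\<alpha> i $ j))"
      using ki by (simp add: scalar_prod_def atLeast0LessThan jacobian_def root_mat_def)
    also have "\<dots> = dderiv n (\<alpha> i) (p k)" unfolding dderiv_def by (simp add: mult.commute)
    also have "\<dots> = h k i * Lf i" using h ki by (simp add: mult.commute)
    also have "\<dots> = (\<Sum>j<n. h k j * (if j = i then Lf j else 0))"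
      using ki by (simp add: if_distrib[of "(*) _"] cong: if_cong)
    also have "\<dots> = (H * mat n n (\<lambda>(i, j). if i = j then Lf i else 0)) $$ (k, i)"
      using ki by (simp add: scalar_prod_def atLeast0LessThan H_def)
    finally show "(J * map_mat mconst root_mat) $$ (k, i) =
      (H * mat n n (\<lambda>(i, j). if i = j then Lf i else 0)) $$ (k, i)" .
  qed (simp_all add: H_def jacobian_def root_mat_def)
  moreover have "F * H = mat n n (\<lambda>(i, j). if i = j then mconst (2 * form (\<alpha> i) (\<alpha> i)) else 0)"
  proof (rule eq_matI)
    fix i j assume "i < dim_row (mat n n (\<lambda>(i, j). if i = j then mconst (2 * form (\<alpha> i) (\<alpha> i)) else 0))"
      "j < dim_col (mat n n (\<lambda>(i, j). if i = j then mconst (2 * form (\<alpha> i) (\<alpha> i)) else 0))"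
    then have ij: "i < n" "j < n" by simp_all
    \<comment> \<open>The derivative of the square along \<open>\<alpha> j\<close> is computed by
      the chain rule and directly. Orthogonality confines the direct result to i = j, and
      \<open>Lf j\<close> cancels.\<close>
    have "dderiv n (\<alpha> j) (Lf i * Lf i) = (\<Sum>k<n. insertion mconst p (mderiv k (f i)) * dderiv n (\<alpha> j) (p k))"
      using f[OF ij(1)] dderiv_insertion[of "f i" n n "\<alpha> j" p] by simp
    also have "\<dots> = Lf j * (\<Sum>k<n. insertion mconst p (mderiv k (f i)) * h k j)"
      unfolding sum_distrib_left by (intro sum.cong refl) (use h ij in \<open>simp add: mult_ac\<close>)
    also have "(\<Sum>k<n. insertion mconst p (mderiv k (f i)) * h k j) = (F * H) $$ (i, j)"
      using ij by (simp add: F_def H_def scalar_prod_def atLeast0LessThan)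
    finally have e1: "dderiv n (\<alpha> j) (Lf i * Lf i) = Lf j * (F * H) $$ (i, j)" .
    have "dderiv n (\<alpha> j) (Lf i) = mconst (form (\<alpha> i) (\<alpha> j))"
      unfolding Lf_def rootform_def using rootD(1) ij by (simp add: dderiv_linform dual_scalar_prod)
    then have "dderiv n (\<alpha> j) (Lf i * Lf i) =
        mconst (form (\<alpha> i) (\<alpha> j)) * Lf i + Lf i * mconst (form (\<alpha> i) (\<alpha> j))"
      by (simp only: dderiv_mult)
    also have "\<dots> = Lf i * mconst (2 * form (\<alpha> i) (\<alpha> j))"
      unfolding mult_2 mconst_add distrib_left by (rule arg_cong2[of _ _ _ _ "(+)"], rule mult.commute, rule refl)
    also have "\<dots> = Lf j * (if i = j then mconst (2 * form (\<alpha> i) (\<alpha> i)) else 0)"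
      using root_orthogonal[OF roots ij] by auto
    finally have "Lf j * (F * H) $$ (i, j) = Lf j * (if i = j then mconst (2 * form (\<alpha> i) (\<alpha> i)) else 0)"
      using e1 by simp
    then have "(F * H) $$ (i, j) = (if i = j then mconst (2 * form (\<alpha> i) (\<alpha> i)) else 0)"
      using Lf_nonzero[OF ij(2)] by simp
    then show "(F * H) $$ (i, j) =
        mat n n (\<lambda>(i, j). if i = j then mconst (2 * form (\<alpha> i) (\<alpha> i)) else 0) $$ (i, j)"
      using ij by simp
  qed (simp_all add: F_def H_def)
  moreover have "F $$ (i, j) \<in> mpolys n" if "i < n" "j < n" for i j
    using that f insertion_mpolys[of "mderiv j (f i)" n p n] by (simp add: F_def)
  moreover have "H $$ (i, j) \<in> mpolys n" if "i < n" "j < n" for i j using that h by (simp add: H_def)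
  moreover have "H \<in> carrier_mat n n" "F \<in> carrier_mat n n" by (simp_all add: H_def F_def)
  ultimately show ?thesis using that by blast
qed

lemma det_diag:
  fixes d :: "nat \<Rightarrow> mpoly"
  shows "det (mat n n (\<lambda>(i, j). if i = j then d i else 0)) = (\<Prod>i<n. d i)"
proof -
  have "det (mat n n (\<lambda>(i, j). if i = j then d i else 0)) =
      prod_list (diag_mat (mat n n (\<lambda>(i, j). if i = j then d i else 0)))"
    by (rule det_lower_triangular[of n]) auto
  also have "\<dots> = (\<Prod>i<n. d i)"
    by (simp add: diag_mat_def prod.list_conv_set_nth atLeast0LessThan)
  finally show ?thesis .
qed

text \<open>With R for \<open>root_mat\<close> and D for the diagonal matrix of the
  \<open>Lf i\<close>, J R = H D, where R and H are invertible over S. Hence the discriminant is det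
  D up to a unit, and adj J differs from adj D, the diagonal matrix of the \<open>Lhat i\<close>, by
  invertible factors on both sides.\<close>

lemma boolean_structure:
  shows "det J dvd Lprod" "Lprod dvd det J"
    "\<And>j. j < n \<Longrightarrow> Lhat j \<in> minor_ideal"
    "\<And>M. M \<in> minor_ideal \<Longrightarrow> \<exists>t. (\<forall>j. t j \<in> mpolys n) \<and> M = (\<Sum>j<n. t j * Lhat j)"
proof -
  obtain H F :: "mpoly mat" where H: "H \<in> carrier_mat n n" and F: "F \<in> carrier_mat n n"
    and Hm: "\<And>i j. i < n \<Longrightarrow> j < n \<Longrightarrow> H $$ (i, j) \<in> mpolys n"
    and Fm: "\<And>i j. i < n \<Longrightarrow> j < n \<Longrightarrow> F $$ (i, j) \<in> mpolys n"
    and JH: "J * map_mat mconst root_mat = H * mat n n (\<lambda>(i, j). if i = j then Lf i else 0)"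
    and FH: "F * H = mat n n (\<lambda>(i, j). if i = j then mconst (2 * form (\<alpha> i) (\<alpha> i)) else 0)"
    using exists_quotient_matrix by blast
  define m where "m = det root_mat"
  have m: "m \<noteq> 0" unfolding m_def by (rule root_mat_det)
  define c where "c = (\<Prod>i<n. 2 * form (\<alpha> i) (\<alpha> i))"
  have c: "c \<noteq> 0" unfolding c_def using rootD(4) by simp
  have "det (F * H) = mconst c"
    unfolding FH det_diag c_def by (induction n) (simp_all add: mconst_mult)
  then have dFH: "det F * det H = mconst c" using det_mult[OF F H] by simp
  have "det (J * map_mat mconst root_mat) = det (H * mat n n (\<lambda>(i, j). if i = j then Lf i else 0))"
    unfolding JH ..
  then have dJ: "det J * mconst m = det H * Lprod"
    using det_mult[OF J_carrier, of "map_mat mconst root_mat"]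
      det_mult[OF H, of "mat n n (\<lambda>(i, j). if i = j then Lf i else 0)"] root_mat_carrier
    by (simp add: det_diag Lprod_def map_mat_mconst_det m_def)
  have unit: "mconst (inverse k) * (mconst k * g) = g" if "k \<noteq> 0" for k g
    using that by (simp add: mult.assoc[symmetric] mconst_mult[symmetric])
  have "mconst c * Lprod = det F * (det H * Lprod)" by (simp add: dFH[symmetric] mult.assoc)
  also have "\<dots> = det J * (det F * mconst m)" unfolding dJ[symmetric] by (simp add: mult_ac)
  finally have "Lprod = det J * (mconst (inverse c) * (det F * mconst m))"
    using unit[OF c, of Lprod] by (metis mult.left_commute)
  then show "det J dvd Lprod" by (metis dvd_triv_left)
  have "det J = Lprod * (mconst (inverse m) * det H)"
    using unit[OF m, of "det J"] dJ by (metis mult.commute mult.left_commute)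
  then show "Lprod dvd det J" by (metis dvd_triv_left)
  have dH: "det H \<noteq> 0" using dFH c by auto
  define K where "K i k = cofactor J k i" for i k
  have KJ: "(\<Sum>k<n. K i k * J $$ (k, j)) = (if i = j then det J else 0)" if ij: "i < n" "j < n" for i j
  proof -
    have "(adj_mat J * J) $$ (i, j) = (det J \<cdot>\<^sub>m 1\<^sub>m n) $$ (i, j)" using adj_mat[OF J_carrier] by simp
    then show ?thesis
      using ij adj_mat(1)[OF J_carrier]
      by (auto simp: K_def adj_mat_def scalar_prod_def atLeast0LessThan jacobian_def)
  qed
  have Jroot: "(\<Sum>l<n. J $$ (k, l) * mconst (\<alpha> j $ l)) = H $$ (k, j) * Lf j" if kj: "k < n" "j < n" for k j
  proof -
    have "(J * map_mat mconst root_mat) $$ (k, j) =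
        (H * mat n n (\<lambda>(i, j). if i = j then Lf i else 0)) $$ (k, j)" unfolding JH ..
    moreover have "(J * map_mat mconst root_mat) $$ (k, j) = (\<Sum>l<n. J $$ (k, l) * mconst (\<alpha> j $ l))"
      using kj by (simp add: scalar_prod_def atLeast0LessThan jacobian_def root_mat_def)
    moreover have "(H * mat n n (\<lambda>(i, j). if i = j then Lf i else 0)) $$ (k, j) =
        (\<Sum>l<n. H $$ (k, l) * (if l = j then Lf l else 0))"
      using kj H by (simp add: scalar_prod_def atLeast0LessThan)
    moreover have "\<dots> = H $$ (k, j) * Lf j"
      using kj by (simp add: if_distrib[of "(*) _"] cong: if_cong)
    ultimately show ?thesis by simp
  qed
  \<comment> \<open>K J = det J times the identity gives K H D = det J times R; dividing column j by
    \<open>Lf j\<close> leaves a multiple of \<open>Lhat j\<close>.\<close>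
  have KH: "(\<Sum>k<n. K i k * H $$ (k, j)) * mconst m = det H * Lhat j * mconst (\<alpha> j $ i)"
    if ij: "i < n" "j < n" for i j
  proof -
    have "(\<Sum>k<n. K i k * H $$ (k, j)) * Lf j = (\<Sum>k<n. K i k * (\<Sum>l<n. J $$ (k, l) * mconst (\<alpha> j $ l)))"
      unfolding sum_distrib_right by (intro sum.cong refl) (use ij Jroot in \<open>simp add: mult.assoc\<close>)
    also have "\<dots> = (\<Sum>l<n. (\<Sum>k<n. K i k * J $$ (k, l)) * mconst (\<alpha> j $ l))"
      unfolding sum_distrib_left sum_distrib_right by (subst sum.swap) (simp add: mult.assoc)
    also have "\<dots> = (\<Sum>l<n. (if i = l then det J else 0) * mconst (\<alpha> j $ l))"
      by (intro sum.cong refl) (use KJ ij in simp)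
    also have "\<dots> = det J * mconst (\<alpha> j $ i)"
      using ij by (simp add: if_distrib[of "\<lambda>x. x * _"] cong: if_cong)
    finally have "(\<Sum>k<n. K i k * H $$ (k, j)) * Lf j = det J * mconst (\<alpha> j $ i)" .
    then have "Lf j * ((\<Sum>k<n. K i k * H $$ (k, j)) * mconst m) = det J * mconst m * mconst (\<alpha> j $ i)"
      by (simp add: mult_ac)
    also have "\<dots> = Lf j * (det H * Lhat j * mconst (\<alpha> j $ i))"
      unfolding dJ Lprod_split[OF ij(2)] by (simp add: mult_ac)
    finally show ?thesis using Lf_nonzero[OF ij(2)] by simp
  qed
  have Kideal: "K i k \<in> minor_ideal" if "i < n" "k < n" for i k
    unfolding K_def cofactor_def minor_def[symmetric]
    using that minor_in_ideal minor_ideal_mult by simp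
  show "Lhat j \<in> minor_ideal" if j: "j < n" for j
  proof -
    \<comment> \<open>A nonzero entry of the root makes the relation \<open>KH\<close> solvable for
      \<open>Lhat j\<close>, and multiplying by det F turns det H into the constant c.\<close>
    obtain i where i: "i < n" "\<alpha> j $ i \<noteq> 0"
      using rootD(1,2)[OF j] by (metis carrier_vecD eq_vecI index_zero_vec)
    have dF: "det F \<in> mpolys n" by (rule det_mpolys[OF F Fm])
    define g where "g = det F * mconst m * (\<Sum>k<n. K i k * H $$ (k, j))"
    have "(\<Sum>k<n. H $$ (k, j) * K i k) \<in> minor_ideal"
      by (intro minor_ideal_sum minor_ideal_mult Kideal Hm) (use i j in auto)
    then have "g \<in> minor_ideal"
      unfolding g_def using dF by (intro minor_ideal_mult) (auto simp: mult.commute)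
    moreover have "g = mconst (c * \<alpha> j $ i) * Lhat j"
      unfolding g_def using KH[OF i(1) j] by (simp add: mconst_mult dFH[symmetric] mult_ac)
    ultimately have "mconst (inverse (c * \<alpha> j $ i)) * (mconst (c * \<alpha> j $ i) * Lhat j) \<in> minor_ideal"
      by (simp add: minor_ideal_mult)
    moreover have ne: "c * \<alpha> j $ i \<noteq> 0" using c i by simp
    ultimately show ?thesis by (simp only: unit[OF ne])
  qed
  define adjH where "adjH = adj_mat H"
  have adjH: "adjH \<in> carrier_mat n n" "H * adjH = det H \<cdot>\<^sub>m 1\<^sub>m n"
    unfolding adjH_def using adj_mat[OF H] by auto
  have adjHm: "adjH $$ (i, j) \<in> mpolys n" if "i < n" "j < n" for i j
  proof -
    have "det (mat_delete H j i) \<in> mpolys n"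
      by (rule det_mpolys[OF mat_delete_carrier[OF H]]) (use Hm H in \<open>auto simp: mat_delete_def\<close>)
    then show ?thesis unfolding adjH_def adj_mat_def cofactor_def using that H by simp
  qed
  have Kspan: "\<exists>t. (\<forall>j. t j \<in> mpolys n) \<and> K i l = (\<Sum>j<n. t j * Lhat j)" if il: "i < n" "l < n" for i l
  proof -
    have HadjH: "(\<Sum>j<n. H $$ (k, j) * adjH $$ (j, l)) = (if k = l then det H else 0)" if "k < n" for k
    proof -
      have "(H * adjH) $$ (k, l) = (det H \<cdot>\<^sub>m 1\<^sub>m n) $$ (k, l)" unfolding adjH(2) ..
      then show ?thesis
        using that il H adjH(1) by (auto simp: scalar_prod_def atLeast0LessThan)
    qed
    \<comment> \<open>The same relation is solved for K: multiply by adj H on the right and cancel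
      det H.\<close>
    have "det H * (K i l * mconst m) = (\<Sum>k<n. K i k * (if k = l then det H else 0)) * mconst m"
      using il by (simp add: if_distrib[of "(*) _"] mult_ac cong: if_cong)
    also have "\<dots> = (\<Sum>k<n. K i k * (\<Sum>j<n. H $$ (k, j) * adjH $$ (j, l))) * mconst m"
      using HadjH by simp
    also have "\<dots> = (\<Sum>j<n. ((\<Sum>k<n. K i k * H $$ (k, j)) * mconst m) * adjH $$ (j, l))"
      unfolding sum_distrib_left sum_distrib_right by (subst sum.swap) (simp add: mult_ac)
    also have "\<dots> = (\<Sum>j<n. det H * Lhat j * mconst (\<alpha> j $ i) * adjH $$ (j, l))"
      by (intro sum.cong refl) (use KH il in simp)
    also have "\<dots> = det H * (\<Sum>j<n. Lhat j * mconst (\<alpha> j $ i) * adjH $$ (j, l))"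
      by (simp add: sum_distrib_left mult.assoc)
    finally have "mconst m * K i l = (\<Sum>j<n. Lhat j * mconst (\<alpha> j $ i) * adjH $$ (j, l))"
      using dH by (simp add: mult.commute)
    then have "K i l = mconst (inverse m) * (\<Sum>j<n. Lhat j * mconst (\<alpha> j $ i) * adjH $$ (j, l))"
      using unit[OF m, of "K i l"] by simp
    also have "\<dots> = (\<Sum>j<n. (if j < n then mconst (inverse m) * mconst (\<alpha> j $ i) * adjH $$ (j, l) else 0) * Lhat j)"
      unfolding sum_distrib_left by (intro sum.cong refl) (simp add: mult_ac)
    finally show ?thesis
      using adjHm il by (intro exI[of _ "\<lambda>j. if j < n then mconst (inverse m) * mconst (\<alpha> j $ i) * adjH $$ (j, l) else 0"]) auto
  qed
  define span where "span = {\<Sum>j<n. t j * Lhat j | t. \<forall>j. t j \<in> mpolys n}"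
  have span_add: "f + g \<in> span" if fg: "f \<in> span" "g \<in> span" for f g
  proof -
    obtain t u where "\<forall>j. t j \<in> mpolys n" "\<forall>j. u j \<in> mpolys n" "f = (\<Sum>j<n. t j * Lhat j)" "g = (\<Sum>j<n. u j * Lhat j)"
      using fg by (auto simp: span_def)
    then show ?thesis unfolding span_def
      by (auto intro!: exI[of _ "\<lambda>j. t j + u j"] simp: distrib_right sum.distrib)
  qed
  have span_mult: "g * f \<in> span" if fg: "f \<in> span" "g \<in> mpolys n" for f g
  proof -
    obtain t where "\<forall>j. t j \<in> mpolys n" "f = (\<Sum>j<n. t j * Lhat j)"
      using fg by (auto simp: span_def)
    then show ?thesis unfolding span_def using fg(2)
      by (auto intro!: exI[of _ "\<lambda>j. g * t j"] simp: sum_distrib_left mult.assoc)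
  qed
  have span0: "0 \<in> span" unfolding span_def by (auto intro!: exI[of _ "\<lambda>_. 0"])
  have span_sum: "sum f A \<in> span" if "\<And>i. i \<in> A \<Longrightarrow> f i \<in> span" for f and A :: "nat set"
    using that by (induction A rule: infinite_finite_induct) (auto simp: span0 span_add)
  have minor_span: "minor l i \<in> span" if "i < n" "l < n" for i l
  proof -
    have "K i l \<in> span" using Kspan[OF that] by (auto simp: span_def)
    then have "(-1) ^ (l + i) * K i l \<in> span" by (rule span_mult) simp
    moreover have "(-1) ^ (l + i) * K i l = minor l i"
      by (cases "even (l + i)") (simp_all add: K_def cofactor_def minor_def)
    ultimately show ?thesis by simp
  qed
  show "\<exists>t. (\<forall>j. t j \<in> mpolys n) \<and> M = (\<Sum>j<n. t j * Lhat j)" if M: "M \<in> minor_ideal" for M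
  proof -
    obtain s where s: "M = (\<Sum>i<n. \<Sum>j<n. s i j * minor i j)" "\<forall>i j. s i j \<in> mpolys n"
      using M by (auto simp: minor_ideal_def)
    have "M \<in> span"
      unfolding s(1) by (intro span_sum span_mult minor_span) (use s(2) in auto)
    then show ?thesis by (auto simp: span_def)
  qed
qed

text \<open>The multiplier condition at \<open>Lhat i\<close>, read modulo \<open>Lf i\<close> where
  all other \<open>Lhat j\<close> vanish, makes a congruent to a multiple of b. The product of these
  n congruences is divisible by the discriminant and expands to an integral equation.\<close>

lemma boolean_multiplier_integral:
  assumes a: "a \<in> mpolys n" and b: "b \<in> mpolys n" and mult: "multiplier_fraction a b"
  shows "integral_fraction a b"
proof -
  have "\<exists>c\<in>mpolys n. Lf i dvd a - b * c" if i: "i < n" for i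
  proof -
    obtain M where M: "M \<in> minor_ideal" "det J dvd a * Lhat i - b * M"
      using mult boolean_structure(3)[OF i] by (auto simp: multiplier_fraction_def)
    obtain t where t: "\<forall>j. t j \<in> mpolys n" "M = (\<Sum>j<n. t j * Lhat j)"
      using boolean_structure(4)[OF M(1)] by blast
    have "M = t i * Lhat i + (\<Sum>j\<in>{..<n} - {i}. t j * Lhat j)"
      unfolding t(2) by (rule sum.remove) (use i in auto)
    moreover have "Lf i dvd (\<Sum>j\<in>{..<n} - {i}. t j * Lhat j)"
      by (rule dvd_sum) (use Lf_dvd_Lhat[OF i] in auto)
    ultimately have d1: "Lf i dvd M - t i * Lhat i" by simp
    have "Lf i dvd Lprod" using Lprod_split[OF i] by simp
    then have d2: "Lf i dvd a * Lhat i - b * M"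
      using dvd_trans[OF dvd_trans[OF _ boolean_structure(2)] M(2)] by blast
    have "Lf i dvd (a * Lhat i - b * M) + b * (M - t i * Lhat i)"
      by (rule dvd_add) (use d1 d2 in auto)
    also have "(a * Lhat i - b * M) + b * (M - t i * Lhat i) = Lhat i * (a - b * t i)"
      by (simp add: algebra_simps)
    finally have "Lf i dvd a - b * t i"
      using Lf_prime[OF i Lhat_mpolys, of "a - b * t i"] Lf_not_dvd_Lhat[OF i] a b t(1) by auto
    then show ?thesis using t(1) by blast
  qed
  then obtain c where c: "\<And>i. i < n \<Longrightarrow> c i \<in> mpolys n \<and> Lf i dvd a - b * c i" by metis
  have "det J dvd (\<Prod>i<n. a - b * c i)"
    using dvd_trans[OF boolean_structure(1) Lprod_dvd[of "\<lambda>i. a - b * c i"]] c by blast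
  moreover obtain c' where c': "\<forall>i. c' i \<in> mpolys n"
    "(\<Prod>i<n. a - b * c i) = a ^ n + (\<Sum>i<n. c' i * a ^ i * b ^ (n - i))"
    using prod_linear_expand[of n c n a b] conjunct1[OF c] by auto
  ultimately have "det J dvd a ^ n + (\<Sum>i<n. c' i * a ^ i * b ^ (n - i))" by (simp only: c'(2))
  then show ?thesis unfolding integral_fraction_def using c'(1) by blast
qed

text \<open>The integral equation survives restriction to each hyperplane, where integral closedness
  makes a congruent to b k i modulo \<open>Lf i\<close>. On \<open>Lhat j\<close> the fraction then
  acts as multiplication by k j, because \<open>Lf j * Lhat j\<close> is the discriminant up to a
  unit.\<close>

lemma boolean_integral_multiplier:
  assumes a: "a \<in> mpolys n" and b: "regular b" and int: "integral_fraction a b"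
  shows "multiplier_fraction a b"
proof -
  have bm: "b \<in> mpolys n" using b by (simp add: regular_def)
  obtain d c where c: "\<forall>i<d. c i \<in> mpolys n" "det J dvd a ^ d + (\<Sum>i<d. c i * a ^ i * b ^ (d - i))"
    using int by (auto simp: integral_fraction_def)
  have "\<exists>k\<in>mpolys n. Lf i dvd a - b * k" if i: "i < n" for i
  proof -
    note dual_i = dual_carrier[of "\<alpha> i"] dual_nonzero[OF root_at[OF roots i]]
    obtain u where u: "u \<in> carrier_vec n" "dual (\<alpha> i) \<bullet> u = 1"
      using exists_scalar_prod_one[OF dual_i] .
    let ?\<rho> = "proj_along n (dual (\<alpha> i)) u"
    have zero_iff: "?\<rho> f = 0 \<longleftrightarrow> Lf i dvd f" if "f \<in> mpolys n" for f
      using proj_along_eq_0_iff[OF dual_i(1) u that] by (simp add: Lf_def rootform_def)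
    have "Lf i dvd Lprod" using Lprod_split[OF i] by simp
    then have LD: "Lf i dvd det J" using boolean_structure(2) by (rule dvd_trans)
    \<comment> \<open>Otherwise b would annihilate the class of \<open>Lhat i\<close>, which is
      nonzero, against regularity.\<close>
    have "\<not> Lf i dvd b"
    proof
      assume "Lf i dvd b"
      then obtain b' where "b = Lf i * b'" by blast
      then have "Lhat i * b = Lprod * b'" using Lprod_split[OF i] by (simp add: mult_ac)
      then have "det J dvd Lhat i * b" using dvd_mult2[OF boolean_structure(1), of b'] by simp
      then have "det J dvd Lhat i" using b Lhat_mpolys[of i] unfolding regular_def by blast
      with LD have "Lf i dvd Lhat i" by (rule dvd_trans)
      then show False using Lf_not_dvd_Lhat[OF i] by blast
    qed
    then have \<rho>b: "?\<rho> b \<noteq> 0" using zero_iff[OF bm] by simp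
    have "Lf i dvd a ^ d + (\<Sum>i<d. c i * a ^ i * b ^ (d - i))"
      using LD c(2) by (rule dvd_trans)
    moreover have "a ^ d + (\<Sum>i<d. c i * a ^ i * b ^ (d - i)) \<in> mpolys n"
      using a bm c(1) by (intro add_mpolys sum_mpolys mult_mpolys power_mpolys) auto
    ultimately have "?\<rho> (a ^ d + (\<Sum>i<d. c i * a ^ i * b ^ (d - i))) = 0" using zero_iff by blast
    then have "?\<rho> a ^ d + (\<Sum>i<d. ?\<rho> (c i) * ?\<rho> a ^ i * ?\<rho> b ^ (d - i)) = 0"
      by (simp add: proj.hom_add proj.hom_sum proj.hom_mult proj.hom_power)
    then have "?\<rho> b dvd ?\<rho> a"
      by (rule mpolys_integrally_closed[OF proj_along_mpolys[OF a] proj_along_mpolys[OF bm] \<rho>b])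
    then obtain k where k: "k \<in> mpolys n" "?\<rho> a = ?\<rho> b * k"
      using dvd_mpolys[of "?\<rho> b" n "?\<rho> a"] a bm by (metis proj_along_mpolys)
    \<comment> \<open>Projecting once more replaces k by its projection, so that both sides become
      values of one homomorphism.\<close>
    have "?\<rho> a = ?\<rho> (?\<rho> a)" using proj_along_idem[OF dual_i(1) u a] by simp
    also have "\<dots> = ?\<rho> b * ?\<rho> k"
      unfolding k(2) using proj_along_idem[OF dual_i(1) u bm] by (simp add: proj.hom_mult)
    finally have "?\<rho> (a - b * k) = 0" by (simp add: proj.hom_minus proj.hom_mult)
    then show ?thesis using zero_iff[of "a - b * k"] a bm k(1) by auto
  qed
  then obtain k where k: "\<And>i. i < n \<Longrightarrow> k i \<in> mpolys n \<and> Lf i dvd a - b * k i" by metis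
  show ?thesis
    unfolding multiplier_fraction_def
  proof
    fix M assume "M \<in> minor_ideal"
    then obtain t where t: "\<forall>j. t j \<in> mpolys n" "M = (\<Sum>j<n. t j * Lhat j)"
      using boolean_structure(4) by blast
    define m where "m = (\<Sum>j<n. t j * k j * Lhat j)"
    have "m \<in> minor_ideal"
      unfolding m_def by (intro minor_ideal_sum minor_ideal_mult boolean_structure(3)) (use t(1) k in auto)
    moreover have "det J dvd (a - b * k j) * Lhat j" if j: "j < n" for j
    proof -
      have "Lf j * Lhat j dvd (a - b * k j) * Lhat j" using k[OF j] by (simp add: mult_dvd_mono)
      then show ?thesis using dvd_trans[OF boolean_structure(1)] Lprod_split[OF j] by simp
    qed
    then have "det J dvd (\<Sum>j<n. t j * ((a - b * k j) * Lhat j))"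
      by (intro dvd_sum) auto
    moreover have "(\<Sum>j<n. t j * ((a - b * k j) * Lhat j)) = a * M - b * m"
      unfolding t(2) m_def sum_distrib_left sum_subtractf[symmetric]
      by (intro sum.cong refl) (simp add: algebra_simps)
    ultimately show "\<exists>m\<in>minor_ideal. det J dvd a * M - b * m" by metis
  qed
qed

end

end

section \<open>Total rings of fractions\<close>

text \<open>The operations on fractions are unions over all representatives; this evaluates them
  once independence of the representatives is shown.\<close>

lemma UN_UN_const:
  assumes "(x0, y0) \<in> X" "(z0, w0) \<in> Y"
    and "\<And>x y z w. (x, y) \<in> X \<Longrightarrow> (z, w) \<in> Y \<Longrightarrow> g x y z w = F"
  shows "(\<Union>(x, y)\<in>X. \<Union>(z, w)\<in>Y. g x y z w) = F"
proof (rule SUP_eq_const)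
  show "X \<noteq> {}" using assms(1) by auto
  fix q assume q: "q \<in> X"
  have "(\<Union>(z, w)\<in>Y. g (fst q) (snd q) z w) = F"
    by (rule SUP_eq_const) (use assms q in auto)
  then show "(case q of (x, y) \<Rightarrow> \<Union>(z, w)\<in>Y. g x y z w) = F" by (simp add: case_prod_beta)
qed

context cring
begin

lemma nonzerodivisors_carrier: "b \<in> nonzerodivisors R \<Longrightarrow> b \<in> carrier R"
  by (simp add: nonzerodivisors_def)

lemma nonzerodivisors_cancel:
  assumes "b \<in> nonzerodivisors R" "x \<in> carrier R" "y \<in> carrier R" "x \<otimes> b = y \<otimes> b"
  shows "x = y"
proof -
  have b: "b \<in> carrier R" using assms(1) by (rule nonzerodivisors_carrier)
  have "(x \<ominus> y) \<otimes> b = \<zero>"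
    using assms(2-4) b by (simp add: l_distr minus_eq l_minus r_neg)
  then have "x \<ominus> y = \<zero>" using assms by (simp add: nonzerodivisors_def)
  moreover have "x = (x \<ominus> y) \<oplus> y" using assms(2,3) by (simp add: minus_eq a_assoc l_neg)
  ultimately show ?thesis using assms(3) by simp
qed

lemma nonzerodivisors_mult:
  assumes "b \<in> nonzerodivisors R" "d \<in> nonzerodivisors R"
  shows "b \<otimes> d \<in> nonzerodivisors R"
proof -
  have c: "b \<in> carrier R" "d \<in> carrier R" using assms nonzerodivisors_carrier by auto
  have "a = \<zero>" if "a \<in> carrier R" "a \<otimes> (b \<otimes> d) = \<zero>" for a
  proof -
    have "(a \<otimes> b) \<otimes> d = \<zero>" using that c by (simp add: m_assoc)
    then have "a \<otimes> b = \<zero>" using assms(2) that c by (simp add: nonzerodivisors_def)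
    then show ?thesis using assms(1) that by (simp add: nonzerodivisors_def)
  qed
  then show ?thesis using c by (simp add: nonzerodivisors_def)
qed

lemma one_nonzerodivisor: "\<one> \<in> nonzerodivisors R"
  by (simp add: nonzerodivisors_def)

lemma frac_of_self: "a \<in> carrier R \<Longrightarrow> b \<in> nonzerodivisors R \<Longrightarrow> (a, b) \<in> frac_of R a b"
  by (simp add: frac_of_def)

lemma frac_of_eq_iff:
  assumes "a \<in> carrier R" "c \<in> carrier R" "b \<in> nonzerodivisors R" "d \<in> nonzerodivisors R"
  shows "frac_of R a b = frac_of R c d \<longleftrightarrow> a \<otimes> d = c \<otimes> b"
proof
  assume "frac_of R a b = frac_of R c d"
  then have "(c, d) \<in> frac_of R a b" using frac_of_self assms by simp
  then show "a \<otimes> d = c \<otimes> b" by (simp add: frac_of_def)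
next
  have sub: "frac_of R a b \<subseteq> frac_of R c d"
    if "a \<in> carrier R" "c \<in> carrier R" "b \<in> nonzerodivisors R" "d \<in> nonzerodivisors R"
      and eq: "a \<otimes> d = c \<otimes> b" for a b c d
  proof clarify
    fix x y assume "(x, y) \<in> frac_of R a b"
    then have xy: "x \<in> carrier R" "y \<in> nonzerodivisors R" "a \<otimes> y = x \<otimes> b" by (auto simp: frac_of_def)
    note cs = that(1,2) nonzerodivisors_carrier[OF that(3)] nonzerodivisors_carrier[OF that(4)]
      xy(1) nonzerodivisors_carrier[OF xy(2)]
    have "(c \<otimes> y) \<otimes> b = (c \<otimes> b) \<otimes> y" using cs by (simp add: m_ac)
    also have "\<dots> = (a \<otimes> y) \<otimes> d" unfolding eq[symmetric] using cs by (simp add: m_ac)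
    also have "\<dots> = (x \<otimes> d) \<otimes> b" unfolding xy(3) using cs by (simp add: m_ac)
    finally have "c \<otimes> y = x \<otimes> d" using nonzerodivisors_cancel[OF that(3)] cs by simp
    then show "(x, y) \<in> frac_of R c d" using xy by (simp add: frac_of_def)
  qed
  assume "a \<otimes> d = c \<otimes> b"
  then show "frac_of R a b = frac_of R c d" using sub[of a c b d] sub[of c a d b] assms by auto
qed

lemma frac_of_memD:
  assumes "(x, y) \<in> frac_of R a b" "a \<in> carrier R" "b \<in> nonzerodivisors R"
  shows "x \<in> carrier R" "y \<in> nonzerodivisors R" "a \<otimes> y = x \<otimes> b" "y \<in> carrier R"
  using assms nonzerodivisors_carrier by (auto simp: frac_of_def)

lemma frac_mult:
  assumes "a \<in> carrier R" "c \<in> carrier R" "b \<in> nonzerodivisors R" "d \<in> nonzerodivisors R"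
  shows "frac_of R a b \<otimes>\<^bsub>total_fractions R\<^esub> frac_of R c d = frac_of R (a \<otimes> c) (b \<otimes> d)"
proof -
  note cs = assms(1,2) nonzerodivisors_carrier[OF assms(3)] nonzerodivisors_carrier[OF assms(4)]
  have eq: "frac_of R (x \<otimes> z) (y \<otimes> w) = frac_of R (a \<otimes> c) (b \<otimes> d)"
    if xy: "(x, y) \<in> frac_of R a b" and zw: "(z, w) \<in> frac_of R c d" for x y z w
  proof -
    note m = frac_of_memD[OF xy assms(1,3)] and m' = frac_of_memD[OF zw assms(2,4)]
    have "(x \<otimes> z) \<otimes> (b \<otimes> d) = (x \<otimes> b) \<otimes> (z \<otimes> d)" using cs m(1,4) m'(1,4) by (simp add: m_ac)
    also have "\<dots> = (a \<otimes> c) \<otimes> (y \<otimes> w)" unfolding m(3)[symmetric] m'(3)[symmetric] using cs m(1,4) m'(1,4) by (simp add: m_ac)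
    finally show ?thesis
      using cs m m' assms by (subst frac_of_eq_iff) (auto intro: nonzerodivisors_mult)
  qed
  show ?thesis
    unfolding total_fractions_def
    using UN_UN_const[OF frac_of_self[OF assms(1,3)] frac_of_self[OF assms(2,4)] eq] by simp
qed

lemma frac_add:
  assumes "a \<in> carrier R" "c \<in> carrier R" "b \<in> nonzerodivisors R" "d \<in> nonzerodivisors R"
  shows "frac_of R a b \<oplus>\<^bsub>total_fractions R\<^esub> frac_of R c d = frac_of R (a \<otimes> d \<oplus> c \<otimes> b) (b \<otimes> d)"
proof -
  note cs = assms(1,2) nonzerodivisors_carrier[OF assms(3)] nonzerodivisors_carrier[OF assms(4)]
  have eq: "frac_of R (x \<otimes> w \<oplus> z \<otimes> y) (y \<otimes> w) = frac_of R (a \<otimes> d \<oplus> c \<otimes> b) (b \<otimes> d)"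
    if xy: "(x, y) \<in> frac_of R a b" and zw: "(z, w) \<in> frac_of R c d" for x y z w
  proof -
    note m = frac_of_memD[OF xy assms(1,3)] and m' = frac_of_memD[OF zw assms(2,4)]
    have "(x \<otimes> w \<oplus> z \<otimes> y) \<otimes> (b \<otimes> d) = (x \<otimes> b) \<otimes> (w \<otimes> d) \<oplus> (z \<otimes> d) \<otimes> (y \<otimes> b)"
      using cs m(1,4) m'(1,4) by (simp add: m_ac l_distr r_distr)
    also have "\<dots> = (a \<otimes> d \<oplus> c \<otimes> b) \<otimes> (y \<otimes> w)"
      unfolding m(3)[symmetric] m'(3)[symmetric] using cs m(1,4) m'(1,4) by (simp add: m_ac l_distr r_distr)
    finally show ?thesis
      using cs m m' assms by (subst frac_of_eq_iff) (auto intro: nonzerodivisors_mult)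
  qed
  show ?thesis
    unfolding total_fractions_def
    using UN_UN_const[OF frac_of_self[OF assms(1,3)] frac_of_self[OF assms(2,4)] eq] by simp
qed

lemma frac_carrier:
  "carrier (total_fractions R) = {frac_of R a b | a b. a \<in> carrier R \<and> b \<in> nonzerodivisors R}"
  by (simp add: total_fractions_def)

text \<open>Supplies the structure through which the finite sums in integral equations are
  evaluated.\<close>

lemma total_fractions_abelian_monoid: "abelian_monoid (total_fractions R)"
proof (rule abelian_monoidI)
  let ?Q = "total_fractions R"
  fix X Y assume "X \<in> carrier ?Q" "Y \<in> carrier ?Q"
  then obtain a b c d where X: "X = frac_of R a b" "a \<in> carrier R" "b \<in> nonzerodivisors R"
    and Y: "Y = frac_of R c d" "c \<in> carrier R" "d \<in> nonzerodivisors R"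
    unfolding frac_carrier by blast
  note cs = X(2) Y(2) nonzerodivisors_carrier[OF X(3)] nonzerodivisors_carrier[OF Y(3)]
  show "X \<oplus>\<^bsub>?Q\<^esub> Y \<in> carrier ?Q"
    unfolding X(1) Y(1) frac_add[OF X(2) Y(2) X(3) Y(3)] frac_carrier
    using cs nonzerodivisors_mult[OF X(3) Y(3)] by blast
  show "X \<oplus>\<^bsub>?Q\<^esub> Y = Y \<oplus>\<^bsub>?Q\<^esub> X"
    unfolding X(1) Y(1) frac_add[OF X(2) Y(2) X(3) Y(3)] frac_add[OF Y(2) X(2) Y(3) X(3)]
    using cs by (simp add: a_comm m_comm)
  fix Z assume "Z \<in> carrier ?Q"
  then obtain e f where Z: "Z = frac_of R e f" "e \<in> carrier R" "f \<in> nonzerodivisors R"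
    unfolding frac_carrier by blast
  note cs' = cs Z(2) nonzerodivisors_carrier[OF Z(3)]
  show "(X \<oplus>\<^bsub>?Q\<^esub> Y) \<oplus>\<^bsub>?Q\<^esub> Z = X \<oplus>\<^bsub>?Q\<^esub> (Y \<oplus>\<^bsub>?Q\<^esub> Z)"
  proof -
    have "(X \<oplus>\<^bsub>?Q\<^esub> Y) \<oplus>\<^bsub>?Q\<^esub> Z = frac_of R ((a \<otimes> d \<oplus> c \<otimes> b) \<otimes> f \<oplus> e \<otimes> (b \<otimes> d)) ((b \<otimes> d) \<otimes> f)"
      unfolding X(1) Y(1) Z(1) frac_add[OF X(2) Y(2) X(3) Y(3)]
      by (rule frac_add) (use cs' X Y Z nonzerodivisors_mult in auto)
    moreover have "X \<oplus>\<^bsub>?Q\<^esub> (Y \<oplus>\<^bsub>?Q\<^esub> Z) = frac_of R (a \<otimes> (d \<otimes> f) \<oplus> (c \<otimes> f \<oplus> e \<otimes> d) \<otimes> b) (b \<otimes> (d \<otimes> f))"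
      unfolding X(1) Y(1) Z(1) frac_add[OF Y(2) Z(2) Y(3) Z(3)]
      by (rule frac_add) (use cs' X Y Z nonzerodivisors_mult in auto)
    moreover have "(a \<otimes> d \<oplus> c \<otimes> b) \<otimes> f \<oplus> e \<otimes> (b \<otimes> d) = a \<otimes> (d \<otimes> f) \<oplus> (c \<otimes> f \<oplus> e \<otimes> d) \<otimes> b"
      using cs' by (simp add: l_distr r_distr m_ac a_assoc)
    ultimately show ?thesis using cs' by (simp add: m_assoc)
  qed
next
  let ?Q = "total_fractions R"
  have zero: "\<zero>\<^bsub>?Q\<^esub> = frac_of R \<zero> \<one>" by (simp add: total_fractions_def)
  show "\<zero>\<^bsub>?Q\<^esub> \<in> carrier ?Q" unfolding zero frac_carrier using one_nonzerodivisor by blast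
  fix X assume "X \<in> carrier ?Q"
  then obtain a b where X: "X = frac_of R a b" "a \<in> carrier R" "b \<in> nonzerodivisors R"
    unfolding frac_carrier by blast
  then show "\<zero>\<^bsub>?Q\<^esub> \<oplus>\<^bsub>?Q\<^esub> X = X"
    unfolding zero using frac_add[OF zero_closed X(2) one_nonzerodivisor X(3)] nonzerodivisors_carrier by simp
qed

end

section \<open>The polynomial ring as a ring with carrier\<close>

lemma S_ring_simps [simp]:
  "carrier (S_ring n) = mpolys n" "mult (S_ring n) = (*)" "one (S_ring n) = 1"
  "zero (S_ring n) = 0" "add (S_ring n) = (+)"
  by (simp_all add: S_ring_def)

lemma S_ring_cring: "cring (S_ring n)"
proof (rule cringI)
  show "abelian_group (S_ring n)"
    by (rule abelian_groupI) (auto simp: algebra_simps intro!: bexI[of _ "- x" for x])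
  show "comm_monoid (S_ring n)"
    by (rule comm_monoidI) (auto simp: algebra_simps)
qed (auto simp: algebra_simps)

lemma S_ring_minus:
  assumes "f \<in> mpolys n" "g \<in> mpolys n"
  shows "f \<ominus>\<^bsub>S_ring n\<^esub> g = f - g"
proof -
  interpret S: cring "S_ring n" by (rule S_ring_cring)
  have "\<ominus>\<^bsub>S_ring n\<^esub> g = - g"
    by (rule S.minus_equality) (use assms in auto)
  then show ?thesis by (simp add: a_minus_def)
qed

section \<open>The rings of the theorem in terms of polynomials\<close>

context coxeter_invariants
begin

abbreviation cl :: "mpoly \<Rightarrow> mpoly set" where "cl \<equiv> residue_class n p"

lemma Delta_ideal: "ideal (PIdl\<^bsub>S_ring n\<^esub> det J) (S_ring n)"
  by (rule cring.cgenideal_ideal[OF S_ring_cring]) simp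

lemma Delta_ideal_iff: "f \<in> mpolys n \<Longrightarrow> f \<in> PIdl\<^bsub>S_ring n\<^esub> det J \<longleftrightarrow> det J dvd f"
  unfolding cgenideal_def
  by (auto simp: mult.commute elim!: dvd_mpolys[rotated 2])

lemma S_A_cring: "cring (S_A n p)"
  unfolding S_A_def by (rule ideal.quotient_is_cring[OF Delta_ideal S_ring_cring])

sublocale SA: cring "S_A n p" by (rule S_A_cring)

lemma cl_hom: "cl \<in> ring_hom (S_ring n) (S_A n p)"
proof -
  have "cl = (+>\<^bsub>S_ring n\<^esub>) (PIdl\<^bsub>S_ring n\<^esub> det J)" by (rule ext) (simp add: residue_class_def)
  then show ?thesis unfolding S_A_def using ideal.rcos_ring_hom[OF Delta_ideal] by simp
qed

lemma cl_carrier [simp]: "f \<in> mpolys n \<Longrightarrow> cl f \<in> carrier (S_A n p)"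
  using ring_hom_closed[OF cl_hom] by simp

lemma cl_mult: "f \<in> mpolys n \<Longrightarrow> g \<in> mpolys n \<Longrightarrow> cl (f * g) = cl f \<otimes>\<^bsub>S_A n p\<^esub> cl g"
  and cl_add: "f \<in> mpolys n \<Longrightarrow> g \<in> mpolys n \<Longrightarrow> cl (f + g) = cl f \<oplus>\<^bsub>S_A n p\<^esub> cl g"
  and cl_one: "cl 1 = \<one>\<^bsub>S_A n p\<^esub>"
  using ring_hom_mult[OF cl_hom, of f g] ring_hom_add[OF cl_hom, of f g] ring_hom_one[OF cl_hom] by simp_all

lemma cl_zero: "cl 0 = \<zero>\<^bsub>S_A n p\<^esub>"
  using ring_hom_zero[OF cl_hom] S_ring_cring SA.ring_axioms by (simp add: cring_def)

lemma cl_surj: "carrier (S_A n p) = cl ` mpolys n"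
  by (auto simp: S_A_def FactRing_simps residue_class_def a_r_coset_def)

lemma cl_eq_iff: "f \<in> mpolys n \<Longrightarrow> g \<in> mpolys n \<Longrightarrow> cl f = cl g \<longleftrightarrow> det J dvd f - g"
  using ring.quotient_eq_iff_same_a_r_cos[OF _ Delta_ideal, of f g] S_ring_cring
  by (simp add: residue_class_def S_ring_minus Delta_ideal_iff cring_def)

lemma cl_eq_zero_iff: "f \<in> mpolys n \<Longrightarrow> cl f = \<zero>\<^bsub>S_A n p\<^esub> \<longleftrightarrow> det J dvd f"
  using cl_eq_iff[of f 0] by (simp add: cl_zero)

lemma nonzerodivisor_iff: "b \<in> mpolys n \<Longrightarrow> cl b \<in> nonzerodivisors (S_A n p) \<longleftrightarrow> regular b"
  by (auto simp: nonzerodivisors_def regular_def cl_surj cl_mult[symmetric] cl_eq_zero_iff)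

text \<open>Fractions named by polynomial representatives, so that questions in \<open>Q_A\<close>
  become divisibility by the discriminant in S.\<close>

definition Fr :: "mpoly \<Rightarrow> mpoly \<Rightarrow> (mpoly set \<times> mpoly set) set" where
  "Fr a b = frac_of (S_A n p) (cl a) (cl b)"

lemma regularD:
  assumes "regular b"
  shows "b \<in> mpolys n" "cl b \<in> nonzerodivisors (S_A n p)"
proof -
  show b: "b \<in> mpolys n" using assms unfolding regular_def by blast
  show "cl b \<in> nonzerodivisors (S_A n p)" using assms nonzerodivisor_iff[OF b] by simp
qed

lemma regular_one: "regular 1"
  by (simp add: regular_def)

lemma regular_mult: "regular b \<Longrightarrow> regular d \<Longrightarrow> regular (b * d)"
  using SA.nonzerodivisors_mult[OF regularD(2) regularD(2), of b d] regularD(1)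
  by (simp add: nonzerodivisor_iff[symmetric] cl_mult)

lemma regular_power: "regular b \<Longrightarrow> regular (b ^ k)"
  by (induction k) (auto simp: regular_one regular_mult)

lemma Fr_eq_iff:
  assumes "a \<in> mpolys n" "c \<in> mpolys n" "regular b" "regular d"
  shows "Fr a b = Fr c d \<longleftrightarrow> det J dvd a * d - c * b"
  unfolding Fr_def using assms regularD
  by (simp add: SA.frac_of_eq_iff cl_mult[symmetric] cl_eq_iff)

lemma Fr_mult:
  assumes "a \<in> mpolys n" "c \<in> mpolys n" "regular b" "regular d"
  shows "Fr a b \<otimes>\<^bsub>Q_A n p\<^esub> Fr c d = Fr (a * c) (b * d)"
  unfolding Fr_def Q_A_def using assms regularD by (simp add: SA.frac_mult cl_mult)

lemma Fr_add:
  assumes "a \<in> mpolys n" "c \<in> mpolys n" "regular b" "regular d"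
  shows "Fr a b \<oplus>\<^bsub>Q_A n p\<^esub> Fr c d = Fr (a * d + c * b) (b * d)"
  unfolding Fr_def Q_A_def using assms regularD by (simp add: SA.frac_add cl_mult cl_add)

lemma Q_carrier: "carrier (Q_A n p) = {Fr a b | a b. a \<in> mpolys n \<and> regular b}"
proof -
  have "carrier (Q_A n p) = {frac_of (S_A n p) x y | x y. x \<in> cl ` mpolys n \<and> y \<in> nonzerodivisors (S_A n p)}"
    by (simp add: Q_A_def SA.frac_carrier cl_surj)
  also have "nonzerodivisors (S_A n p) = cl ` {b. regular b}"
    using SA.nonzerodivisors_carrier regularD nonzerodivisor_iff by (fastforce simp: cl_surj image_iff)
  finally show ?thesis by (auto simp: Fr_def)
qed

lemma Fr_carrier: "a \<in> mpolys n \<Longrightarrow> regular b \<Longrightarrow> Fr a b \<in> carrier (Q_A n p)"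
  unfolding Q_carrier by blast

lemma embed_cl: "frac_embed (S_A n p) (cl f) = Fr f 1"
  by (simp add: frac_embed_def Fr_def cl_one)

lemma S_A_in_Q_eq: "S_A_in_Q n p = (\<lambda>f. Fr f 1) ` mpolys n"
  by (simp add: S_A_in_Q_def cl_surj image_image embed_cl)

lemma S_A_in_Q_iff:
  assumes "a \<in> mpolys n" "regular b"
  shows "Fr a b \<in> S_A_in_Q n p \<longleftrightarrow> polynomial_fraction a b"
  unfolding S_A_in_Q_eq polynomial_fraction_def
  using assms by (auto simp: image_iff Fr_eq_iff regular_one mult.commute)

lemma I_tilde_eq: "I_tilde n p = cl ` minor_ideal"
proof
  let ?G = "{residue_class n p (det (mat_delete (jacobian n p) i j)) | i j. i < n \<and> j < n}"
  have G: "?G = {cl (minor i j) | i j. i < n \<and> j < n}" by (simp add: minor_def)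
  have Gc: "?G \<subseteq> carrier (S_A n p)" unfolding G by auto
  have idl: "ideal (I_tilde n p) (S_A n p)"
    unfolding I_tilde_def by (rule SA.genideal_ideal[OF Gc])
  then interpret I: ideal "I_tilde n p" "S_A n p" .
  have gen: "cl (minor i j) \<in> I_tilde n p" if "i < n" "j < n" for i j
    using SA.genideal_self[OF Gc] that unfolding I_tilde_def G by blast
  have sum: "cl (sum f A) \<in> I_tilde n p" if "\<And>i. i \<in> A \<Longrightarrow> f i \<in> mpolys n \<and> cl (f i) \<in> I_tilde n p"
    for f and A :: "nat set"
    using that
  proof (induction A rule: infinite_finite_induct)
    case (insert i A)
    then show ?case by (simp add: cl_add sum_mpolys)
  qed (simp_all add: cl_zero)
  show "cl ` minor_ideal \<subseteq> I_tilde n p"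
  proof clarify
    fix f assume "f \<in> minor_ideal"
    then obtain s where s: "f = (\<Sum>i<n. \<Sum>j<n. s i j * minor i j)" "\<forall>i j. s i j \<in> mpolys n"
      by (auto simp: minor_ideal_def)
    have "cl (s i j * minor i j) \<in> I_tilde n p" if "i < n" "j < n" for i j
      using s(2) that gen by (simp add: cl_mult I.I_l_closed)
    then show "cl f \<in> I_tilde n p"
      unfolding s(1) using s(2) by (intro sum conjI) (auto intro!: sum_mpolys)
  qed
  have "ideal (cl ` minor_ideal) (S_A n p)"
  proof (rule idealI[OF SA.ring_axioms])
    show "subgroup (cl ` minor_ideal) (add_monoid (S_A n p))"
    proof (rule group.subgroupI[OF SA.add.is_group])
      show "cl ` minor_ideal \<subseteq> carrier (add_monoid (S_A n p))"
        using minor_ideal_mpolys by auto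
      show "cl ` minor_ideal \<noteq> {}" using zero_minor_ideal by blast
      fix x assume "x \<in> cl ` minor_ideal"
      then obtain f where f: "f \<in> minor_ideal" "x = cl f" by blast
      have fm: "f \<in> mpolys n" using f(1) by (rule minor_ideal_mpolys)
      have "\<ominus>\<^bsub>S_A n p\<^esub> x = cl (- f)"
        using fm f(2) by (intro SA.minus_equality) (simp_all add: cl_add[symmetric] cl_zero)
      moreover have "- f \<in> minor_ideal" using minor_ideal_mult[OF f(1), of "- 1"] by simp
      ultimately show "inv\<^bsub>add_monoid (S_A n p)\<^esub> x \<in> cl ` minor_ideal"
        unfolding a_inv_def by auto
      fix y assume "y \<in> cl ` minor_ideal"
      then obtain g where g: "g \<in> minor_ideal" "y = cl g" by blast
      have "x \<oplus>\<^bsub>S_A n p\<^esub> y = cl (f + g)"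
        using f g minor_ideal_mpolys by (simp add: cl_add)
      then show "x \<otimes>\<^bsub>add_monoid (S_A n p)\<^esub> y \<in> cl ` minor_ideal"
        using minor_ideal_add[OF f(1) g(1)] by simp
    qed
    fix a x assume a: "a \<in> cl ` minor_ideal" and x: "x \<in> carrier (S_A n p)"
    obtain f where f: "f \<in> minor_ideal" "a = cl f" using a by blast
    obtain g where g: "g \<in> mpolys n" "x = cl g" using x by (auto simp: cl_surj)
    have "x \<otimes>\<^bsub>S_A n p\<^esub> a = cl (g * f)" using f g minor_ideal_mpolys by (simp add: cl_mult)
    then show 1: "x \<otimes>\<^bsub>S_A n p\<^esub> a \<in> cl ` minor_ideal" using minor_ideal_mult[OF f(1) g(1)] by simp
    have "a \<in> carrier (S_A n p)" using f minor_ideal_mpolys by auto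
    then show "a \<otimes>\<^bsub>S_A n p\<^esub> x \<in> cl ` minor_ideal" using 1 x SA.m_comm by metis
  qed
  then show "I_tilde n p \<subseteq> cl ` minor_ideal"
    unfolding I_tilde_def G by (rule SA.genideal_minimal) (use minor_in_ideal in blast)
qed

lemma S_tilde_iff:
  assumes a: "a \<in> mpolys n" and b: "regular b"
  shows "Fr a b \<in> S_tilde n p \<longleftrightarrow> multiplier_fraction a b"
proof -
  have I: "frac_embed (S_A n p) ` I_tilde n p = (\<lambda>f. Fr f 1) ` minor_ideal"
    by (simp add: I_tilde_eq image_image embed_cl)
  have "Fr a b \<otimes>\<^bsub>Q_A n p\<^esub> Fr M 1 \<in> (\<lambda>f. Fr f 1) ` minor_ideal \<longleftrightarrow>
      (\<exists>m\<in>minor_ideal. det J dvd a * M - b * m)" if "M \<in> minor_ideal" for M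
  proof -
    have M: "M \<in> mpolys n" using that by (rule minor_ideal_mpolys)
    have "Fr a b \<otimes>\<^bsub>Q_A n p\<^esub> Fr M 1 = Fr (a * M) b" using Fr_mult[OF a M b regular_one] by simp
    moreover have "Fr (a * M) b = Fr m 1 \<longleftrightarrow> det J dvd a * M - b * m" if "m \<in> minor_ideal" for m
      using Fr_eq_iff[of "a * M" m b 1] a M b regular_one minor_ideal_mpolys[OF that] by (simp add: mult.commute)
    ultimately show ?thesis by (auto simp: image_iff)
  qed
  then show ?thesis
    unfolding S_tilde_def I multiplier_fraction_def using Fr_carrier[OF a b] by simp
qed

lemma Fr_power:
  assumes "a \<in> mpolys n" "regular b"
  shows "Fr a b [^]\<^bsub>Q_A n p\<^esub> (k::nat) = Fr (a ^ k) (b ^ k)"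
proof (induction k)
  case 0
  have "\<one>\<^bsub>Q_A n p\<^esub> = Fr 1 1" by (simp add: Q_A_def total_fractions_def Fr_def cl_one)
  then show ?case by (simp add: nat_pow_def)
next
  case (Suc k)
  have "Fr a b [^]\<^bsub>Q_A n p\<^esub> Suc k = Fr a b [^]\<^bsub>Q_A n p\<^esub> k \<otimes>\<^bsub>Q_A n p\<^esub> Fr a b"
    by (simp add: nat_pow_def)
  also have "\<dots> = Fr (a ^ Suc k) (b ^ Suc k)"
    unfolding Suc by (subst Fr_mult) (use assms regular_power in \<open>auto simp: mult.commute\<close>)
  finally show ?case .
qed

text \<open>The exponents d - i and the common denominator depend on the upper limit, so the
  induction runs over partial sums whose denominators grow with them.\<close>

lemma Fr_sum:
  assumes a: "a \<in> mpolys n" and b: "regular b" and c: "\<And>i. i < d \<Longrightarrow> c i \<in> mpolys n"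
  shows "(\<Oplus>\<^bsub>Q_A n p\<^esub>i\<in>{..<d}. Fr (c i) 1 \<otimes>\<^bsub>Q_A n p\<^esub> Fr a b [^]\<^bsub>Q_A n p\<^esub> i) =
    Fr (\<Sum>i<d. c i * a ^ i * b ^ (d - i)) (b ^ d)"
proof -
  interpret Q: abelian_monoid "Q_A n p"
    unfolding Q_A_def by (rule SA.total_fractions_abelian_monoid)
  have bm: "b \<in> mpolys n" using b by (rule regularD)
  have summand: "Fr (c i) 1 \<otimes>\<^bsub>Q_A n p\<^esub> Fr a b [^]\<^bsub>Q_A n p\<^esub> i = Fr (c i * a ^ i) (b ^ i)" if "i < d" for i
    unfolding Fr_power[OF a b] using Fr_mult[OF c[OF that] _ regular_one regular_power[OF b]] a by simp
  have "(\<Oplus>\<^bsub>Q_A n p\<^esub>i\<in>{..<k}. Fr (c i) 1 \<otimes>\<^bsub>Q_A n p\<^esub> Fr a b [^]\<^bsub>Q_A n p\<^esub> i) =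
    Fr (\<Sum>i<k. c i * a ^ i * b ^ (k - i)) (b ^ k)" if "k \<le> d" for k
    using that
  proof (induction k)
    case 0
    have "\<zero>\<^bsub>Q_A n p\<^esub> = Fr 0 1" by (simp add: Q_A_def total_fractions_def Fr_def cl_one cl_zero)
    then show ?case by simp
  next
    case (Suc k)
    define s where "s = (\<Sum>i<k. c i * a ^ i * b ^ (k - i))"
    have s: "s \<in> mpolys n" unfolding s_def using c Suc.prems a bm by (intro sum_mpolys mult_mpolys power_mpolys) auto
    have tc: "Fr (c i) 1 \<otimes>\<^bsub>Q_A n p\<^esub> Fr a b [^]\<^bsub>Q_A n p\<^esub> i \<in> carrier (Q_A n p)" if "i < Suc k" for i
      using summand[of i] that Suc.prems c a b by (simp add: Fr_carrier regular_power)
    have "(\<Oplus>\<^bsub>Q_A n p\<^esub>i\<in>{..<Suc k}. Fr (c i) 1 \<otimes>\<^bsub>Q_A n p\<^esub> Fr a b [^]\<^bsub>Q_A n p\<^esub> i) =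
        Fr (c k * a ^ k) (b ^ k) \<oplus>\<^bsub>Q_A n p\<^esub> Fr s (b ^ k)"
      unfolding lessThan_Suc
      by (subst Q.finsum_insert) (use tc tc[of k] Suc summand[of k] in \<open>auto simp: s_def\<close>)
    also have "\<dots> = Fr (c k * a ^ k * b ^ k + s * b ^ k) (b ^ k * b ^ k)"
      by (rule Fr_add) (use s c Suc.prems a b regular_power in auto)
    \<comment> \<open>Addition produced the denominator b^k b^k; cross-multiplication replaces it by
      b^(k+1).\<close>
    also have "\<dots> = Fr (\<Sum>i<Suc k. c i * a ^ i * b ^ (Suc k - i)) (b ^ Suc k)"
    proof (subst Fr_eq_iff)
      have "(\<Sum>i<Suc k. c i * a ^ i * b ^ (Suc k - i)) = s * b + c k * a ^ k * b"
        unfolding s_def by (simp add: sum_distrib_left Suc_diff_le mult_ac)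
      then show "det J dvd (c k * a ^ k * b ^ k + s * b ^ k) * b ^ Suc k -
          (\<Sum>i<Suc k. c i * a ^ i * b ^ (Suc k - i)) * (b ^ k * b ^ k)"
        by (simp add: algebra_simps)
    qed (use s c Suc.prems a b bm in \<open>auto intro!: sum_mpolys add_mpolys mult_mpolys regular_mult regular_power power_mpolys\<close>)
    finally show ?case .
  qed
  then show ?thesis by simp
qed

text \<open>The common denominator b^d is regular and can be cancelled, which turns the equation in
  \<open>Q_A\<close> into a divisibility in S. Coefficients lift because every residue class has a
  representative.\<close>

lemma S_bar_iff:
  assumes a: "a \<in> mpolys n" and b: "regular b"
  shows "Fr a b \<in> S_bar n p \<longleftrightarrow> integral_fraction a b"
proof -
  have bm: "b \<in> mpolys n" using b by (rule regularD)
  have zero: "\<zero>\<^bsub>Q_A n p\<^esub> = Fr 0 1" by (simp add: Q_A_def total_fractions_def Fr_def cl_one cl_zero)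
  have key: "Fr a b [^]\<^bsub>Q_A n p\<^esub> d \<oplus>\<^bsub>Q_A n p\<^esub>
        (\<Oplus>\<^bsub>Q_A n p\<^esub>i\<in>{..<d}. Fr (c i) 1 \<otimes>\<^bsub>Q_A n p\<^esub> Fr a b [^]\<^bsub>Q_A n p\<^esub> i) = \<zero>\<^bsub>Q_A n p\<^esub> \<longleftrightarrow>
      det J dvd a ^ d + (\<Sum>i<d. c i * a ^ i * b ^ (d - i))"
    if c: "\<And>i. i < d \<Longrightarrow> c i \<in> mpolys n" for c and d :: nat
  proof -
    let ?s = "\<Sum>i<d. c i * a ^ i * b ^ (d - i)"
    have s: "?s \<in> mpolys n" using c a bm by (intro sum_mpolys mult_mpolys power_mpolys) auto
    have fs: "(\<Oplus>\<^bsub>Q_A n p\<^esub>i\<in>{..<d}. Fr (c i) 1 \<otimes>\<^bsub>Q_A n p\<^esub> Fr a b [^]\<^bsub>Q_A n p\<^esub> i) =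
        Fr ?s (b ^ d)"
      by (rule Fr_sum[OF a b]) (rule c)
    have "Fr a b [^]\<^bsub>Q_A n p\<^esub> d \<oplus>\<^bsub>Q_A n p\<^esub>
        (\<Oplus>\<^bsub>Q_A n p\<^esub>i\<in>{..<d}. Fr (c i) 1 \<otimes>\<^bsub>Q_A n p\<^esub> Fr a b [^]\<^bsub>Q_A n p\<^esub> i) =
        Fr (a ^ d * b ^ d + ?s * b ^ d) (b ^ d * b ^ d)"
      unfolding fs unfolding Fr_power[OF a b]
      by (rule Fr_add) (use s a regular_power[OF b] in auto)
    moreover have "Fr (a ^ d * b ^ d + ?s * b ^ d) (b ^ d * b ^ d) = Fr 0 1 \<longleftrightarrow> det J dvd (a ^ d + ?s) * b ^ d"
      using s a bm regular_mult[OF regular_power[OF b] regular_power[OF b]] regular_one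
      by (subst Fr_eq_iff) (auto simp: distrib_right)
    moreover have "det J dvd (a ^ d + ?s) * b ^ d \<longleftrightarrow> det J dvd a ^ d + ?s"
    proof
      have m: "a ^ d + ?s \<in> mpolys n" using s a by simp
      assume "det J dvd (a ^ d + ?s) * b ^ d"
      then show "det J dvd a ^ d + ?s" using regular_power[OF b, of d] m unfolding regular_def by blast
    qed (rule dvd_mult2)
    ultimately show ?thesis unfolding zero by simp
  qed
  show ?thesis
  proof
    assume "Fr a b \<in> S_bar n p"
    then obtain d :: nat and q where q: "\<And>i. i < d \<Longrightarrow> q i \<in> S_A_in_Q n p"
      and eq: "Fr a b [^]\<^bsub>Q_A n p\<^esub> d \<oplus>\<^bsub>Q_A n p\<^esub>
        (\<Oplus>\<^bsub>Q_A n p\<^esub>i\<in>{..<d}. q i \<otimes>\<^bsub>Q_A n p\<^esub> Fr a b [^]\<^bsub>Q_A n p\<^esub> i) = \<zero>\<^bsub>Q_A n p\<^esub>"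
      unfolding S_bar_def integral_closure_def by blast
    have "\<forall>i. \<exists>f. i < d \<longrightarrow> f \<in> mpolys n \<and> q i = Fr f 1" using q by (auto simp: S_A_in_Q_eq)
    then obtain c where c: "\<And>i. i < d \<Longrightarrow> c i \<in> mpolys n \<and> q i = Fr (c i) 1" by metis
    interpret Q: abelian_monoid "Q_A n p"
      unfolding Q_A_def by (rule SA.total_fractions_abelian_monoid)
    have "(\<Oplus>\<^bsub>Q_A n p\<^esub>i\<in>{..<d}. q i \<otimes>\<^bsub>Q_A n p\<^esub> Fr a b [^]\<^bsub>Q_A n p\<^esub> i) =
        (\<Oplus>\<^bsub>Q_A n p\<^esub>i\<in>{..<d}. Fr (c i) 1 \<otimes>\<^bsub>Q_A n p\<^esub> Fr a b [^]\<^bsub>Q_A n p\<^esub> i)"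
      by (rule Q.finsum_cong')
        (use c a b Fr_power[OF a b] Fr_mult[OF _ _ regular_one regular_power[OF b]] Fr_carrier regular_power in auto)
    then have "det J dvd a ^ d + (\<Sum>i<d. c i * a ^ i * b ^ (d - i))"
      using key[of d c] c eq by simp
    then show "integral_fraction a b" unfolding integral_fraction_def using c by blast
  next
    assume "integral_fraction a b"
    then obtain d c where c: "\<forall>i<d. c i \<in> mpolys n" "det J dvd a ^ d + (\<Sum>i<d. c i * a ^ i * b ^ (d - i))"
      unfolding integral_fraction_def by blast
    then have "Fr a b [^]\<^bsub>Q_A n p\<^esub> d \<oplus>\<^bsub>Q_A n p\<^esub>
        (\<Oplus>\<^bsub>Q_A n p\<^esub>i\<in>{..<d}. Fr (c i) 1 \<otimes>\<^bsub>Q_A n p\<^esub> Fr a b [^]\<^bsub>Q_A n p\<^esub> i) = \<zero>\<^bsub>Q_A n p\<^esub>"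
      using key[of d c] by simp
    moreover have "\<forall>i<d. Fr (c i) 1 \<in> S_A_in_Q n p" using c(1) by (simp add: S_A_in_Q_eq)
    ultimately show "Fr a b \<in> S_bar n p"
      unfolding S_bar_def integral_closure_def using Fr_carrier[OF a b]
      by (intro CollectI conjI exI[of _ d] exI[of _ "\<lambda>i. Fr (c i) 1"]) auto
  qed
qed

lemma fraction_set_eq_iff:
  assumes "A \<subseteq> carrier (Q_A n p)" "B \<subseteq> carrier (Q_A n p)"
    and "\<And>a b. a \<in> mpolys n \<Longrightarrow> regular b \<Longrightarrow> Fr a b \<in> A \<longleftrightarrow> P a b"
    and "\<And>a b. a \<in> mpolys n \<Longrightarrow> regular b \<Longrightarrow> Fr a b \<in> B \<longleftrightarrow> Q a b"
  shows "A = B \<longleftrightarrow> (\<forall>a b. a \<in> mpolys n \<longrightarrow> regular b \<longrightarrow> (P a b \<longleftrightarrow> Q a b))"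
proof
  assume "A = B"
  then show "\<forall>a b. a \<in> mpolys n \<longrightarrow> regular b \<longrightarrow> (P a b \<longleftrightarrow> Q a b)" using assms(3,4) by blast
next
  assume PQ: "\<forall>a b. a \<in> mpolys n \<longrightarrow> regular b \<longrightarrow> (P a b \<longleftrightarrow> Q a b)"
  have "x \<in> A \<longleftrightarrow> x \<in> B" if x: "x \<in> carrier (Q_A n p)" for x
  proof -
    obtain a b where "x = Fr a b" "a \<in> mpolys n" "regular b" using x unfolding Q_carrier by blast
    then show ?thesis using PQ assms(3,4) by blast
  qed
  then show "A = B" using assms(1,2) by blast
qed

lemma fraction_subsets:
  "S_A_in_Q n p \<subseteq> carrier (Q_A n p)" "S_tilde n p \<subseteq> carrier (Q_A n p)" "S_bar n p \<subseteq> carrier (Q_A n p)"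
  using Fr_carrier regular_one by (auto simp: S_A_in_Q_eq S_tilde_def S_bar_def integral_closure_def)

section \<open>The two equalities of rings\<close>

lemma S_A_eq_S_tilde_iff:
  assumes "n \<ge> 1"
  shows "S_A_in_Q n p = S_tilde n p \<longleftrightarrow> card (arrangement n W) = 1"
proof -
  have eq: "S_A_in_Q n p = S_tilde n p \<longleftrightarrow>
      (\<forall>a b. a \<in> mpolys n \<longrightarrow> regular b \<longrightarrow> (polynomial_fraction a b \<longleftrightarrow> multiplier_fraction a b))"
    by (rule fraction_set_eq_iff[OF fraction_subsets(1,2) S_A_in_Q_iff S_tilde_iff])
  show ?thesis
  proof
    assume "card (arrangement n W) = 1"
    then have "n = 1" using card_one_dim by blast
    then show "S_A_in_Q n p = S_tilde n p"
      unfolding eq using multiplier_iff_polynomial_one regularD(1) by blast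
  next
    assume e: "S_A_in_Q n p = S_tilde n p"
    show "card (arrangement n W) = 1"
    proof (rule ccontr)
      assume "card (arrangement n W) \<noteq> 1"
      then have c: "card (reflections n W) \<noteq> 1" using card_arrangement by simp
      have "reflections n W \<noteq> {}"
      proof
        assume "reflections n W = {}"
        \<comment> \<open>Without reflections every vector is fixed by W and hence 0, whereas n
          \<ge> 1 provides a nonzero one.\<close>
        then have "unit_vec n 0 = (0\<^sub>v n :: complex vec)" by (intro fixed_by_reflections) auto
        then have "unit_vec n 0 $ 0 = (0\<^sub>v n :: complex vec) $ 0" by simp
        then show False using assms by simp
      qed
      then obtain s where s: "s \<in> reflections n W" by blast
      moreover have "reflections n W \<noteq> {s}" using c by auto
      ultimately obtain t where t: "t \<in> reflections n W" "t \<noteq> s" by blast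
      obtain a b where "is_root a s" "is_root b t" using exists_root s t by metis
      then show False
        using multiplier_not_polynomial reflectionsD(1)[OF s] reflectionsD(1)[OF t(1)] t(2) e eq by metis
    qed
  qed
qed

lemma S_tilde_eq_S_bar_iff: "S_tilde n p = S_bar n p \<longleftrightarrow> commuting_reflections"
proof -
  have eq: "S_tilde n p = S_bar n p \<longleftrightarrow>
      (\<forall>a b. a \<in> mpolys n \<longrightarrow> regular b \<longrightarrow> (multiplier_fraction a b \<longleftrightarrow> integral_fraction a b))"
    by (rule fraction_set_eq_iff[OF fraction_subsets(2,3) S_tilde_iff S_bar_iff])
  show ?thesis
  proof
    assume c: commuting_reflections
    obtain \<sigma> \<alpha> where "orthogonal_roots \<sigma> \<alpha>" using exists_orthogonal_roots[OF c] by blast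
    then show "S_tilde n p = S_bar n p"
      unfolding eq using boolean_multiplier_integral boolean_integral_multiplier regularD(1) by blast
  next
    assume "S_tilde n p = S_bar n p"
    then show commuting_reflections
      unfolding commuting_reflections_def eq using integral_not_multiplier by metis
  qed
qed

end

theorem corollary4p22:
  fixes l :: nat and W :: "complex mat set" and p :: "nat \<Rightarrow> mpoly"
  assumes "l \<ge> 1"
    and "coxeter_group l W"
    and "basic_invariants l W p"
  shows "((S_A_in_Q l p = S_tilde l p \<longleftrightarrow> card (arrangement l W) = 1) \<and>
          (card (arrangement l W) = 1 \<longleftrightarrow> type_A1_power 1 l W)) \<and>
         ((S_tilde l p = S_bar l p \<longleftrightarrow> boolean_arrangement l (arrangement l W)) \<and>
          (boolean_arrangement l (arrangement l W) \<longleftrightarrow> (\<exists>k. type_A1_power k l W)))"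
proof -
  interpret coxeter_invariants l W p
    by unfold_locales (use assms in auto)
  show ?thesis
    using S_A_eq_S_tilde_iff[OF assms(1)] card_one_iff_type S_tilde_eq_S_bar_iff
      boolean_iff_commuting type_iff_commuting by blast
qed

end
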